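(* Let $p>5$ be a prime such that $p\equiv 1,5,19,23\pmod{24}$. If $p\equiv 1,19\pmod{24}$ and $x,y$ are integers with $p=x^2+2y^2$ (such integers exist), then $$\sum_{k=0}^{p-1}\binom{2k}{k}\frac{f_k}{96^k}\equiv 4x^2\pmod p.$$ If $p\equiv 5,23\pmod{24}$, then $$\sum_{k=0}^{p-1}\binom{2k}{k}\frac{f_k}{96^k}\equiv 0\pmod p.$$
   Context: The Franel numbers are $f_n=\sum_{k=0}^n\binom{n}{k}^3$ for $n=0,1,2,\ldots$. Congruences modulo $p$ are taken in the ring of rational numbers whose denominator is not divisible by $p$. *)

theory Defs
  imports Complex_Main "HOL-Computational_Algebra.Primes"
begin

definition franel :: "nat \<Rightarrow> nat" where
  "franel n = (\<Sum>k=0..n. (n choose k) ^ 3)"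

(* quotient_of yields the fraction in lowest terms with positive denominator. *)
definition p_integral :: "nat \<Rightarrow> rat set" where
  "p_integral p = {r. \<not> int p dvd snd (quotient_of r)}"

(* Both sides are required to lie in the ring, and the difference must be p times
   an element of the ring. *)
definition rat_cong :: "rat \<Rightarrow> rat \<Rightarrow> nat \<Rightarrow> bool" where
  "rat_cong a b p \<longleftrightarrow>
     a \<in> p_integral p \<and> b \<in> p_integral p \<and> (\<exists>c\<in>p_integral p. a - b = of_nat p * c)"

end

theory Submission
  imports Defs "HOL-Computational_Algebra.Computational_Algebra" "HOL-Number_Theory.Number_Theory"
begin

text \<open>
  Write \<open>c k\<close> for the central binomial coefficient \<open>2 * k choose k\<close>, \<open>f k\<close> for the
  Franel number, \<open>\<chi>\<close> for the Legendre symbol modulo \<open>p\<close>, and consider the power series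
    \<open>S = \<Sum> c k * f k * X ^ k\<close>, \<open>G = \<Sum> f k * X ^ k\<close>, \<open>M = \<Sum> c (2 * k) * c k * X ^ k\<close>.

  First, in characteristic 0. The differential equation of order three satisfied by \<open>S\<close> is
  the symmetric square of one of order two, and after the substitutions
    \<open>z = x (1 + x) (1 - 8 x) / q\<^sup>2\<close>, \<open>y = x\<^sup>3 (1 + x) / r\<^sup>2\<close>, \<open>q = 1 + 8 x\<^sup>2\<close>, \<open>r = 1 - 4 x - 8 x\<^sup>2\<close>
  the equations of \<open>S\<close>, \<open>G\<close> and \<open>M\<close> agree. Uniqueness of their solutions gives
  \<open>S(z) = q G(x)\<^sup>2\<close> and \<open>M(y)\<^sup>2 = r G(x)\<^sup>2\<close> (\<open>central_franel_compose\<close>, \<open>quartic_compose\<close>), hence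
  \<open>r S(z) = q M(y)\<^sup>2\<close>.

  Second, modulo \<open>p\<close>. The coefficients of \<open>S\<close> and \<open>M\<close> satisfy Lucas congruences, so each of
  these series is congruent to its truncation below degree \<open>p\<close> times its own \<open>p\<close>-th power
  (\<open>lucas_seq_fcong\<close>). Dividing the identity \<open>r S(z) = q M(y)\<^sup>2\<close> by its \<open>p\<close>-th power therefore
  leaves the same kind of relation between truncations, which is a congruence between
  polynomials in \<open>x\<close>. If 6 is a square modulo \<open>p\<close>, then \<open>8 x\<^sup>2 + 8 x = 1\<close> is solvable modulo
  \<open>p\<close>, and at a solution \<open>z = 1/96\<close> and \<open>y = 1/128\<close>. So the sum in question is congruent to
  the square of \<open>\<Sum>k<p. c (2 * k) * c k / 128 ^ k\<close> (\<open>special_value\<close>). By Euler's criterion and the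
  vanishing of power sums, the latter is \<open>- \<Lambda>\<close> with
  \<open>\<Lambda> = \<Sum>u. \<chi> (u (u\<^sup>2 + 4 u + 2))\<close> (\<open>curve_sum_cong_truncated_series\<close>).

  Third, \<open>\<Lambda>\<close> is evaluated exactly; it belongs to an elliptic curve with complex
  multiplication by \<open>\<surd>-2\<close>. Over the Gaussian integers modulo \<open>p\<close>, with norm \<open>N\<close>, put
  \<open>K b = \<Sum>a. \<chi> (N a) * \<chi> (Re (b * a ^ 4))\<close>. Then \<open>K 1 = 2 (p - 1) \<chi>(-2) \<Lambda>\<close>, and
  \<open>K (c ^ 4 * b) = \<chi> (N c) * K b\<close> for every unit \<open>c\<close>. The choice \<open>c = 1 + i\<close>, where \<open>c ^ 4 = -4\<close>,
  shows \<open>\<Lambda> = 0\<close> if \<open>\<chi>(-2) = -1\<close>. If \<open>\<chi>(-2) = 1\<close>, the second moment of \<open>K\<close> can be computed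
  (\<open>second_moment\<close>). On the other hand \<open>K\<^sup>2\<close> is constant on the cosets of the group of all
  \<open>c * a ^ 4\<close> with \<open>c\<close> rational, there are four of them, represented by \<open>1, g, g\<^sup>2, g\<^sup>3\<close> when
  \<open>\<chi> (N g) = -1\<close>, and \<open>K\<close> vanishes on that of \<open>g\<^sup>2\<close> while \<open>K\<^sup>2\<close> agrees on those of \<open>g\<close> and \<open>g\<^sup>3\<close>.
  This gives \<open>(K 1)\<^sup>2 + 2 (K g)\<^sup>2 = 16 p (p - 1)\<^sup>2\<close>, that is, \<open>\<Lambda> = 2 a\<close> with \<open>p = a\<^sup>2 + 2 b\<^sup>2\<close>.
  Such a representation is unique up to signs, and the residue of \<open>p\<close> modulo 24 determines
  \<open>\<chi> 6\<close> and \<open>\<chi>(-2)\<close> by the laws for \<open>-1\<close>, \<open>2\<close> and \<open>3\<close>.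
\<close>

section \<open>Recurrences for binomial sums\<close>

abbreviation central_franel :: "nat \<Rightarrow> nat" where
  "central_franel k \<equiv> ((2 * k) choose k) * franel k"

abbreviation quartic_coeff :: "nat \<Rightarrow> nat" where
  "quartic_coeff k \<equiv> ((4 * k) choose (2 * k)) * ((2 * k) choose k)"

lemma Suc_mult_binomial_Suc: "int (Suc k) * int (n choose Suc k) = (int n - int k) * int (n choose k)"
proof (cases "k \<le> n")
  case True
  have "Suc k * (n choose Suc k) = (n - k) * (n choose k)"
    by (simp only: binomial_absorption binomial_absorb_comp)
  then have "int (Suc k * (n choose Suc k)) = int ((n - k) * (n choose k))" by (simp only:)
  then show ?thesis using True by (simp only: of_nat_mult of_nat_diff)
qed (simp add: binomial_eq_0)

lemma Suc_mult_central_binomial: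
  "(j + 1) * ((2 * (j + 1)) choose (j + 1)) = 2 * (2 * j + 1) * ((2 * j) choose j)"
proof -
  have "Suc j * (Suc (Suc (2 * j)) choose Suc j) = Suc (Suc (2 * j)) * (Suc (2 * j) choose j)"
    using Suc_times_binomial_eq [of "Suc (2 * j)" j] by (simp only: mult.commute)
  moreover have "Suc j * (Suc (2 * j) choose j) = Suc (2 * j) * ((2 * j) choose j)"
    using binomial_absorb_comp [of "Suc (2 * j)" j] by (simp add: Suc_diff_le mult_2)
  ultimately have "Suc j * (Suc j * (Suc (Suc (2 * j)) choose Suc j))
      = Suc j * (2 * Suc (2 * j) * ((2 * j) choose j))"
    by (simp add: algebra_simps)
  then have "Suc j * (Suc (Suc (2 * j)) choose Suc j) = 2 * Suc (2 * j) * ((2 * j) choose j)"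
    by (simp only: mult_cancel1) simp
  then show ?thesis by simp
qed

text \<open>
  Zeilberger's method: the summands of the recurrence are the differences of
  \<open>k ^ 3 * w k * b k ^ 3\<close>. Up to polynomial factors, all three binomial coefficients are
  \<open>b k = n! / (k! (n + 2 - k)!)\<close>, which is meaningful on the whole range \<open>k \<le> n + 2\<close>;
  with \<open>n choose k\<close> as the base, the certificate would have poles at its end.
\<close>

lemma franel_recurrence:
  "(of_nat n + 2)\<^sup>2 * (of_nat (franel (n + 2)) :: rat) =
     (7 * (of_nat n)\<^sup>2 + 21 * of_nat n + 16) * of_nat (franel (n + 1))
     + 8 * (of_nat n + 1)\<^sup>2 * of_nat (franel n)"
proof -
  define t :: rat where "t = of_nat n"
  define b :: "nat \<Rightarrow> rat" where "b k = fact n / (fact k * fact (n + 2 - k))" for k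
  \<comment> \<open>the certificate, obtained by solving the telescoping equation for a cubic in \<open>x\<close>\<close>
  define w :: "rat \<Rightarrow> rat" where
    "w x = 4 * (t + 1)\<^sup>2 * x ^ 3 - (18 * t ^ 3 + 66 * t\<^sup>2 + 78 * t + 30) * x\<^sup>2
       + (27 * t ^ 4 + 147 * t ^ 3 + 291 * t\<^sup>2 + 249 * t + 78) * x
       - (14 * t ^ 5 + 102 * t ^ 4 + 290 * t ^ 3 + 402 * t\<^sup>2 + 272 * t + 72)" for x
  define G where "G k = (of_nat k) ^ 3 * w (of_nat k) * b k ^ 3" for k
  have b2: "of_nat ((n + 2) choose k) = (t + 2) * (t + 1) * b k" if "k \<le> n + 2" for k
    using that unfolding b_def t_def
    by (simp add: binomial_fact field_simps)
  have b1: "of_nat ((n + 1) choose k) = (t + 1) * (t + 2 - of_nat k) * b k" if "k \<le> n + 2" for k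
  proof (cases "k = n + 2")
    case True then show ?thesis by (simp add: t_def binomial_eq_0)
  next
    case False
    with that obtain d where d: "n + 1 = k + d" by (metis le_Suc_eq add_2_eq_Suc' le_iff_add Suc_eq_plus1)
    then have "(of_nat (n + 1) :: rat) = of_nat (k + d)" by simp
    then have n: "(of_nat n :: rat) = of_nat k + of_nat d - 1" by simp
    from d have *: "n + 2 - k = Suc d" "n + 1 - k = d" "k \<le> n + 1" by auto
    have "(of_nat ((n + 1) choose k) :: rat) = fact (n + 1) / (fact k * fact d)"
      using binomial_fact [OF *(3), where 'a = rat] by (simp only: *)
    moreover have "t + 2 - of_nat k = of_nat (Suc d)" by (simp add: n t_def)
    moreover have "(fact (n + 1) :: rat) = (t + 1) * fact n" by (simp add: t_def)
    moreover have "(of_nat (Suc d) :: rat) \<noteq> 0" by (simp del: of_nat_Suc)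
    ultimately show ?thesis unfolding b_def *(1) fact_Suc [of d]
      by (simp del: of_nat_Suc)
  qed
  have b0: "of_nat (n choose k) = (t + 2 - of_nat k) * (t + 1 - of_nat k) * b k" if "k \<le> n + 2" for k
  proof -
    consider "k = n + 2" | "k = n + 1" | "k \<le> n" using \<open>k \<le> n + 2\<close> by linarith
    then show ?thesis
    proof cases
      case 3
      then obtain d where d: "n = k + d" by (metis le_iff_add)
      have *: "n + 2 - k = Suc (Suc d)" "n - k = d" "k \<le> n" using d by auto
      have e: "t + 2 - of_nat k = of_nat (Suc (Suc d))" "t + 1 - of_nat k = of_nat (Suc d)"
        by (simp_all add: d t_def)
      have c: "(of_nat (n choose k) :: rat) = fact n / (fact k * fact d)"
        using binomial_fact [OF *(3), where 'a = rat] by (simp only: *)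
      have "(of_nat (Suc d) :: rat) \<noteq> 0" "(of_nat (Suc (Suc d)) :: rat) \<noteq> 0"
        by (simp_all del: of_nat_Suc)
      then show ?thesis unfolding b_def *(1) fact_Suc e c
        by (simp del: of_nat_Suc)
    qed (simp_all add: t_def binomial_eq_0)
  qed
  have bS: "(of_nat k + 1) * b (k + 1) = (t + 2 - of_nat k) * b k" if k: "k < n + 2" for k
  proof -
    obtain d where d: "n + 2 = Suc (k + d)" using k by (metis less_iff_Suc_add)
    then have *: "n + 2 - k = Suc d" "n + 2 - (k + 1) = d" by auto
    have "(of_nat (n + 2) :: rat) = of_nat (Suc (k + d))" using d by simp
    then have e: "t + 2 - of_nat k = of_nat (Suc d)" "of_nat k + 1 = (of_nat (Suc k) :: rat)"
      unfolding t_def by simp_all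
    have "(of_nat (Suc d) :: rat) \<noteq> 0" "(of_nat (Suc k) :: rat) \<noteq> 0"
      by (simp_all del: of_nat_Suc)
    then show ?thesis unfolding b_def * e by (simp add: fact_Suc del: of_nat_Suc)
  qed
  have scale: "c\<^sub>1 * (u\<^sub>1 * \<beta>) ^ 3 - c\<^sub>2 * (u\<^sub>2 * \<beta>) ^ 3 - c\<^sub>3 * (u\<^sub>3 * \<beta>) ^ 3 = v\<^sub>1 * \<beta> ^ 3 - v\<^sub>2 * \<beta> ^ 3"
    if "c\<^sub>1 * u\<^sub>1 ^ 3 - c\<^sub>2 * u\<^sub>2 ^ 3 - c\<^sub>3 * u\<^sub>3 ^ 3 = v\<^sub>1 - v\<^sub>2"
    for c\<^sub>1 c\<^sub>2 c\<^sub>3 u\<^sub>1 u\<^sub>2 u\<^sub>3 v\<^sub>1 v\<^sub>2 \<beta> :: rat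
    using arg_cong [OF that, of "\<lambda>u. u * \<beta> ^ 3"] by (simp add: power_mult_distrib algebra_simps)
  have tel: "(t + 2)\<^sup>2 * (of_nat ((n + 2) choose k)) ^ 3
       - (7 * t\<^sup>2 + 21 * t + 16) * (of_nat ((n + 1) choose k)) ^ 3
       - 8 * (t + 1)\<^sup>2 * (of_nat (n choose k)) ^ 3
     = (if k = n + 2 then 0 else G (k + 1)) - G k" if "k \<le> n + 2" for k
  proof -
    define x :: rat where "x = of_nat k"
    have *: "(if k = n + 2 then 0 else G (k + 1)) = (t + 2 - x) ^ 3 * w (x + 1) * b k ^ 3"
    proof (cases "k = n + 2")
      case True then show ?thesis by (simp add: x_def t_def)
    next
      case False
      with that have "k < n + 2" by simp
      have "G (k + 1) = w (x + 1) * ((of_nat k + 1) * b (k + 1)) ^ 3"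
        unfolding G_def x_def power_mult_distrib by (simp add: add.commute)
      then have "G (k + 1) = w (x + 1) * ((t + 2 - x) * b k) ^ 3"
        using bS [OF \<open>k < n + 2\<close>] by (simp add: x_def)
      then show ?thesis using False by (simp add: power_mult_distrib mult_ac)
    qed
    have "(t + 2)\<^sup>2 * ((t + 2) * (t + 1)) ^ 3
        - (7 * t\<^sup>2 + 21 * t + 16) * ((t + 1) * (t + 2 - x)) ^ 3
        - 8 * (t + 1)\<^sup>2 * ((t + 2 - x) * (t + 1 - x)) ^ 3
      = (t + 2 - x) ^ 3 * w (x + 1) - x ^ 3 * w x"
      unfolding w_def by (simp add: power2_eq_square power3_eq_cube power4_eq_xxxx algebra_simps eval_nat_numeral)
    then show ?thesis
      unfolding * unfolding b0 [OF that] b1 [OF that] b2 [OF that] G_def x_def [symmetric]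
      by (rule scale)
  qed
  have ext: "(\<Sum>k=0..m. (of_nat (m choose k) :: rat) ^ 3) = (\<Sum>k=0..n+2. of_nat (m choose k) ^ 3)"
    if "m \<le> n + 2" for m
    using that by (intro sum.mono_neutral_left) auto
  have "(\<Sum>k=0..n+2. (if k = n + 2 then 0 else G (k + 1)) - G k)
      = (\<Sum>k=0..n+1. G (Suc k) - G k) - G (n + 2)"
    by simp
  also have "\<dots> = G (Suc (n + 1)) - G 0 - G (n + 2)"
    by (subst sum_Suc_diff) auto
  also have "\<dots> = 0" by (simp add: G_def)
  finally have "(\<Sum>k=0..n+2. (t + 2)\<^sup>2 * (of_nat ((n + 2) choose k)) ^ 3
       - (7 * t\<^sup>2 + 21 * t + 16) * (of_nat ((n + 1) choose k)) ^ 3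
       - 8 * (t + 1)\<^sup>2 * (of_nat (n choose k)) ^ 3) = 0"
    by (subst sum.cong [OF refl tel]) auto
  then have "(t + 2)\<^sup>2 * of_nat (franel (n + 2)) - (7 * t\<^sup>2 + 21 * t + 16) * of_nat (franel (n + 1))
      - 8 * (t + 1)\<^sup>2 * of_nat (franel n) = 0"
    using ext [of n] ext [of "n + 1"] ext [of "n + 2"]
    by (simp only: sum_distrib_left sum_subtractf franel_def of_nat_sum of_nat_power)
  then show ?thesis by (simp add: t_def)
qed

section \<open>Generating functions and their differential equations\<close>

text \<open>
  The Euler derivation. It acts diagonally on coefficients, so a recurrence turns directly
  into a differential equation.
\<close>

definition \<theta> :: "rat fps \<Rightarrow> rat fps" where "\<theta> F = fps_X * fps_deriv F"

lemma \<theta>_nth [simp]: "fps_nth (\<theta> F) n = of_nat n * fps_nth F n"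
  by (cases n) (simp_all add: \<theta>_def)

lemma \<theta>_add: "\<theta> (F + G) = \<theta> F + \<theta> G"
  and \<theta>_diff: "\<theta> (F - G) = \<theta> F - \<theta> G"
  and \<theta>_mult: "\<theta> (F * G) = \<theta> F * G + F * \<theta> G"
  by (simp_all add: \<theta>_def algebra_simps)

lemma \<theta>_const [simp]: "\<theta> (fps_const c) = 0" "\<theta> 1 = 0" "\<theta> 0 = 0" "\<theta> (numeral k) = 0"
  "\<theta> (- F) = - \<theta> F"
  by (simp_all add: \<theta>_def fps_numeral_fps_const)

lemma \<theta>_X [simp]: "\<theta> fps_X = fps_X"
  by (simp add: \<theta>_def)

text \<open>
  The chain rule in logarithmic form: if \<open>d / c\<close> is the logarithmic derivative of \<open>z\<close>, then
  it is also the factor by which composition with \<open>z\<close> twists \<open>\<theta>\<close>. The two series \<open>c\<close> and \<open>d\<close>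
  allow denominators to be cleared.
\<close>

lemma \<theta>_compose:
  assumes "fps_nth z 0 = 0" and "z \<noteq> 0" and "c * \<theta> z = d * z"
  shows "c * \<theta> (F oo z) = d * (\<theta> F oo z)"
proof -
  have "z * (c * \<theta> (F oo z)) = (c * \<theta> z) * (z * (fps_deriv F oo z))"
    unfolding \<theta>_def fps_compose_deriv [OF assms(1)] by (simp add: mult_ac)
  also have "z * (fps_deriv F oo z) = \<theta> F oo z"
    unfolding \<theta>_def by (simp add: fps_compose_mult_distrib [OF assms(1)] assms(1))
  finally have "z * (c * \<theta> (F oo z)) = z * (d * (\<theta> F oo z))" by (simp add: assms(3) mult_ac)
  then show ?thesis using assms(2) by simp
qed

text \<open>
  Multiplication by \<open>A\<close> scales the leading term by the constant term of \<open>A\<close>. This is what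
  decides the lowest-order coefficient in a differential equation.
\<close>

lemma fps_mult_leading:
  assumes "\<And>i. i < k \<Longrightarrow> fps_nth F i = 0"
  shows "fps_nth (A * F) k = fps_nth A 0 * (fps_nth F k :: rat)" and "i < k \<Longrightarrow> fps_nth (A * F) i = 0"
proof -
  have "fps_nth (A * F) k = (\<Sum>i=0..k. fps_nth A i * fps_nth F (k - i))" by (rule fps_mult_nth)
  also have "\<dots> = (\<Sum>i\<in>{0}. fps_nth A i * fps_nth F (k - i))"
    by (rule sum.mono_neutral_right) (auto simp: assms)
  finally show "fps_nth (A * F) k = fps_nth A 0 * fps_nth F k" by simp
  show "i < k \<Longrightarrow> fps_nth (A * F) i = 0"
    unfolding fps_mult_nth by (intro sum.neutral) (simp add: assms)
qed

lemma fps_sqrt_exists: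
  assumes "fps_nth A 0 = (1 :: rat)"
  obtains E where "E * E = A" and "fps_nth E 0 = 1"
proof -
  define E where "E = fps_radical (\<lambda>_ _. 1) 2 A"
  have "E ^ 2 = A"
    using power_radical [of A "\<lambda>_ _. 1" 1] assms by (simp add: E_def eval_nat_numeral)
  moreover have "fps_nth E 0 = 1" by (simp add: E_def fps_radical_def numeral_2_eq_2)
  ultimately show ?thesis using that by (simp add: power2_eq_square)
qed

definition franel_fps :: "rat fps" where
  "franel_fps = Abs_fps (\<lambda>n. of_nat (franel n))"
definition central_franel_fps :: "rat fps" where
  "central_franel_fps = Abs_fps (\<lambda>n. of_nat (central_franel n))"
definition quartic_fps :: "rat fps" where
  "quartic_fps = Abs_fps (\<lambda>n. of_nat (quartic_coeff n))"

lemma fps_numeral_mult_nth [simp]: "fps_nth (numeral k * F) n = numeral k * fps_nth (F :: 'a :: comm_ring_1 fps) n"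
  by (simp add: fps_numeral_fps_const)

lemma fps_ext_012:
  assumes "fps_nth F 0 = fps_nth G 0" "fps_nth F 1 = fps_nth G 1" "\<And>n. fps_nth F (n + 2) = fps_nth G (n + 2)"
  shows "F = G"
proof (rule fps_ext)
  fix n show "fps_nth F n = fps_nth G n"
    using assms by (cases n rule: nat.exhaust [case_names 0 Suc]; metis One_nat_def add_2_eq_Suc' not0_implies_Suc)
qed

lemma franel_0 [simp]: "franel 0 = 1" and franel_1 [simp]: "franel (Suc 0) = 2"
  by (simp_all add: franel_def)

lemma franel_fps_ode:
  "\<theta> (\<theta> franel_fps) = fps_X * (7 * \<theta> (\<theta> franel_fps) + 7 * \<theta> franel_fps + 2 * franel_fps)
     + fps_X * (fps_X * (8 * \<theta> (\<theta> franel_fps) + 16 * \<theta> franel_fps + 8 * franel_fps))"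
proof (rule fps_ext_012)
  fix n
  show "fps_nth (\<theta> (\<theta> franel_fps)) (n + 2) = fps_nth (fps_X * (7 * \<theta> (\<theta> franel_fps) + 7 * \<theta> franel_fps + 2 * franel_fps)
     + fps_X * (fps_X * (8 * \<theta> (\<theta> franel_fps) + 16 * \<theta> franel_fps + 8 * franel_fps))) (n + 2)"
    using franel_recurrence [of n]
    by (simp add: franel_fps_def fps_numeral_fps_const power2_eq_square algebra_simps)
qed (simp_all add: franel_fps_def fps_numeral_fps_const)

lemma central_franel_recurrence:
  "(of_nat n + 2) ^ 3 * (of_nat (((2 * (n + 2)) choose (n + 2)) * franel (n + 2)) :: rat) =
    2 * (2 * of_nat n + 3) * (7 * (of_nat n)\<^sup>2 + 21 * of_nat n + 16) * of_nat (((2 * (n + 1)) choose (n + 1)) * franel (n + 1))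
    + 32 * (of_nat n + 1) * (2 * of_nat n + 1) * (2 * of_nat n + 3) * of_nat (central_franel n)"
proof -
  define t :: rat where "t = of_nat n"
  define c :: "nat \<Rightarrow> rat" where "c k = of_nat ((2 * k) choose k)" for k
  have c: "(of_nat k + 1) * c (k + 1) = 2 * (2 * of_nat k + 1) * c k" for k
    using arg_cong [OF Suc_mult_central_binomial [of k], of "of_nat :: nat \<Rightarrow> rat"]
    unfolding c_def by (simp only: of_nat_mult of_nat_add of_nat_1 of_nat_numeral)
  have c2: "(t + 2) * c (n + 2) = 2 * (2 * t + 3) * c (n + 1)" and c1: "(t + 1) * c (n + 1) = 2 * (2 * t + 1) * c n"
    using c [of "n + 1"] c [of n] by (simp_all add: t_def algebra_simps)
  have "(t + 2) ^ 3 * (c (n + 2) * of_nat (franel (n + 2)))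
      = ((t + 2) * c (n + 2)) * ((t + 2)\<^sup>2 * of_nat (franel (n + 2)))"
    by (simp add: power2_eq_square power3_eq_cube)
  also have "\<dots> = (2 * (2 * t + 3) * c (n + 1)) * ((7 * t\<^sup>2 + 21 * t + 16) * of_nat (franel (n + 1)) + 8 * (t + 1)\<^sup>2 * of_nat (franel n))"
    unfolding c2 using franel_recurrence [of n] by (simp only: t_def)
  also have "\<dots> = 2 * (2 * t + 3) * (7 * t\<^sup>2 + 21 * t + 16) * (c (n + 1) * of_nat (franel (n + 1)))
      + 16 * (2 * t + 3) * (t + 1) * ((t + 1) * c (n + 1)) * of_nat (franel n)"
    by (simp add: power2_eq_square algebra_simps)
  also have "16 * (2 * t + 3) * (t + 1) * ((t + 1) * c (n + 1)) * of_nat (franel n)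
      = 32 * (t + 1) * (2 * t + 1) * (2 * t + 3) * (c n * of_nat (franel n))"
    unfolding c1 by (simp add: algebra_simps)
  finally show ?thesis by (simp only: c_def t_def of_nat_mult)
qed

lemma central_franel_fps_ode:
  "\<theta> (\<theta> (\<theta> central_franel_fps)) =
     fps_X * (28 * \<theta> (\<theta> (\<theta> central_franel_fps)) + 42 * \<theta> (\<theta> central_franel_fps)
        + 22 * \<theta> central_franel_fps + 4 * central_franel_fps)
     + fps_X * (fps_X * (128 * \<theta> (\<theta> (\<theta> central_franel_fps)) + 384 * \<theta> (\<theta> central_franel_fps)
        + 352 * \<theta> central_franel_fps + 96 * central_franel_fps))" (is "?L = ?R")
proof (rule fps_ext_012)
  fix n
  define t a\<^sub>0 a\<^sub>1 a\<^sub>2 :: rat where "t = of_nat n" and "a\<^sub>0 = fps_nth central_franel_fps n"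
    and "a\<^sub>1 = fps_nth central_franel_fps (n + 1)" and "a\<^sub>2 = fps_nth central_franel_fps (n + 2)"
  have rec: "(t + 2) ^ 3 * a\<^sub>2 = 2 * (2 * t + 3) * (7 * t\<^sup>2 + 21 * t + 16) * a\<^sub>1
      + 32 * (t + 1) * (2 * t + 1) * (2 * t + 3) * a\<^sub>0"
    using central_franel_recurrence [of n]
    unfolding t_def a\<^sub>0_def a\<^sub>1_def a\<^sub>2_def central_franel_fps_def fps_nth_Abs_fps .
  have "fps_nth ?L (n + 2) = (t + 2) ^ 3 * a\<^sub>2"
    by (simp add: t_def a\<^sub>2_def power3_eq_cube algebra_simps)
  moreover have "fps_nth ?R (n + 2) = 28 * (t + 1) ^ 3 * a\<^sub>1 + 42 * (t + 1)\<^sup>2 * a\<^sub>1 + 22 * (t + 1) * a\<^sub>1 + 4 * a\<^sub>1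
      + (128 * t ^ 3 * a\<^sub>0 + 384 * t\<^sup>2 * a\<^sub>0 + 352 * t * a\<^sub>0 + 96 * a\<^sub>0)"
    by (simp add: t_def a\<^sub>0_def a\<^sub>1_def; simp add: power2_eq_square power3_eq_cube algebra_simps)
  ultimately show "fps_nth ?L (n + 2) = fps_nth ?R (n + 2)"
    unfolding rec by (simp add: power2_eq_square power3_eq_cube algebra_simps)
qed (simp_all add: central_franel_fps_def fps_numeral_fps_const numeral_2_eq_2)

lemma quartic_recurrence:
  "(of_nat k + 1)\<^sup>2 * (of_nat (((4 * (k + 1)) choose (2 * (k + 1))) * ((2 * (k + 1)) choose (k + 1))) :: rat)
    = 4 * (4 * of_nat k + 1) * (4 * of_nat k + 3) * of_nat (quartic_coeff k)"
proof -
  define t :: rat where "t = of_nat k"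
  define c :: "nat \<Rightarrow> rat" where "c k = of_nat ((2 * k) choose k)" for k
  have c: "(of_nat j + 1) * c (j + 1) = 2 * (2 * of_nat j + 1) * c j" for j
    using arg_cong [OF Suc_mult_central_binomial [of j], of "of_nat :: nat \<Rightarrow> rat"]
    unfolding c_def by (simp only: of_nat_mult of_nat_add of_nat_1 of_nat_numeral)
  have c1: "(t + 1) * c (k + 1) = 2 * (2 * t + 1) * c k"
    and c2: "(2 * t + 1) * c (2 * k + 1) = 2 * (4 * t + 1) * c (2 * k)"
    and c3: "(t + 1) * c (2 * k + 2) = (4 * t + 3) * c (2 * k + 1)"
    using c [of k] c [of "2 * k"] c [of "2 * k + 1"] by (simp_all add: t_def algebra_simps)
  have "(t + 1)\<^sup>2 * (c (2 * k + 2) * c (k + 1)) = ((t + 1) * c (2 * k + 2)) * ((t + 1) * c (k + 1))"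
    by (simp add: power2_eq_square)
  also have "\<dots> = 2 * (4 * t + 3) * ((2 * t + 1) * c (2 * k + 1)) * c k"
    unfolding c1 c3 by (simp add: algebra_simps)
  also have "\<dots> = 4 * (4 * t + 1) * (4 * t + 3) * (c (2 * k) * c k)" unfolding c2 by (simp add: algebra_simps)
  also have "c (2 * k + 2) = of_nat ((4 * (k + 1)) choose (2 * (k + 1)))"
  proof -
    have e: "2 * (2 * (k + 1)) = 4 * (k + 1)" "2 * k + 2 = 2 * (k + 1)" by simp_all
    show ?thesis unfolding c_def e by (rule refl)
  qed
  finally show ?thesis by (simp only: c_def t_def of_nat_mult mult.assoc [symmetric]) simp
qed

lemma quartic_fps_ode:
  "\<theta> (\<theta> quartic_fps) = fps_X * (64 * \<theta> (\<theta> quartic_fps) + 64 * \<theta> quartic_fps + 12 * quartic_fps)" (is "?L = ?R")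
proof (rule fps_ext)
  fix n
  show "fps_nth ?L n = fps_nth ?R n"
  proof (cases n)
    case 0 then show ?thesis by simp
  next
    case (Suc k)
    define t a\<^sub>0 a\<^sub>1 :: rat where "t = of_nat k" and "a\<^sub>0 = fps_nth quartic_fps k" and "a\<^sub>1 = fps_nth quartic_fps (k + 1)"
    have rec: "(t + 1)\<^sup>2 * a\<^sub>1 = 4 * (4 * t + 1) * (4 * t + 3) * a\<^sub>0"
      using quartic_recurrence [of k]
      unfolding t_def a\<^sub>0_def a\<^sub>1_def quartic_fps_def fps_nth_Abs_fps .
    have "fps_nth ?L n = (t + 1)\<^sup>2 * a\<^sub>1"
      by (simp add: Suc t_def a\<^sub>1_def power2_eq_square algebra_simps)
    moreover have "fps_nth ?R n = 64 * t\<^sup>2 * a\<^sub>0 + 64 * t * a\<^sub>0 + 12 * a\<^sub>0"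
      by (simp add: Suc t_def a\<^sub>0_def; simp add: power2_eq_square algebra_simps)
    ultimately show ?thesis unfolding rec by (simp add: power2_eq_square algebra_simps)
  qed
qed

section \<open>Pulling the series back to a common parameter\<close>

text \<open>
  The rescaled derivation: for a suitable \<open>c\<close>, the equations below lose their denominators and
  their terms of second highest order.
\<close>

definition \<delta> :: "rat fps \<Rightarrow> rat fps \<Rightarrow> rat fps" where "\<delta> c F = c * \<theta> F"

lemma \<delta>_simps: "\<delta> c (F + G) = \<delta> c F + \<delta> c G" "\<delta> c (F - G) = \<delta> c F - \<delta> c G"
  "\<delta> c (F * G) = \<delta> c F * G + F * \<delta> c G" "\<delta> c (numeral k) = 0" "\<delta> c 1 = 0"
  by (simp_all add: \<delta>_def \<theta>_add \<theta>_diff \<theta>_mult algebra_simps)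

text \<open>
  With \<open>\<omega>\<^sup>2 = 1 - 28 z - 128 z\<^sup>2\<close>, the leading coefficient of the equation for \<open>s\<^sub>0 = S(z)\<close>, the
  derivation \<open>D = \<omega> z d/dz\<close> puts this equation into the normal form
  \<open>D\<^sup>3 s = A D s + (D A / 2) s\<close> with \<open>A = 8 z + 96 z\<^sup>2\<close>, which is that of a symmetric square.
\<close>

lemma third_order_ode:
  fixes c z \<omega> s\<^sub>0 s\<^sub>1 s\<^sub>2 s\<^sub>3 :: "rat fps"
  defines "D \<equiv> \<delta> c"
  assumes \<omega>: "\<omega> * \<omega> = 1 - 28 * z - 128 * (z * z)" and "\<omega> \<noteq> 0"
    and Dz: "D z = \<omega> * z" and s: "D s\<^sub>0 = \<omega> * s\<^sub>1" "D s\<^sub>1 = \<omega> * s\<^sub>2" "D s\<^sub>2 = \<omega> * s\<^sub>3"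
    and ode: "s\<^sub>3 = z * (28 * s\<^sub>3 + 42 * s\<^sub>2 + 22 * s\<^sub>1 + 4 * s\<^sub>0) + z * (z * (128 * s\<^sub>3 + 384 * s\<^sub>2 + 352 * s\<^sub>1 + 96 * s\<^sub>0))"
  shows "D (D (D s\<^sub>0)) = (8 * z + 96 * (z * z)) * D s\<^sub>0 + \<omega> * ((4 * z + 96 * (z * z)) * s\<^sub>0)"
proof -
  note D = \<delta>_simps [of c, folded D_def]
  have "2 * \<omega> * D \<omega> = D (\<omega> * \<omega>)" by (simp add: D)
  also have "\<dots> = 2 * \<omega> * (- 14 * z - 128 * (z * z))"
    unfolding \<omega> by (simp add: D Dz algebra_simps)
  finally have "D \<omega> = - 14 * z - 128 * (z * z)" using \<open>\<omega> \<noteq> 0\<close> by simp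
  then have D\<omega>: "D \<omega> = - (14 * z + 128 * (z * z))" by simp
  have Dneg: "D (- F) = - D F" for F by (simp add: D_def \<delta>_def)
  have D2: "D (D \<omega>) = - (\<omega> * (14 * z + 256 * (z * z)))"
    unfolding D\<omega> Dneg by (simp add: D Dz algebra_simps)
  have "D (D (D s\<^sub>0)) = D (D \<omega>) * s\<^sub>1 + 3 * D \<omega> * \<omega> * s\<^sub>2 + \<omega> * ((\<omega> * \<omega>) * s\<^sub>3)"
    by (simp add: s D algebra_simps)
  also have "(\<omega> * \<omega>) * s\<^sub>3 = z * (42 * s\<^sub>2 + 22 * s\<^sub>1 + 4 * s\<^sub>0) + z * (z * (384 * s\<^sub>2 + 352 * s\<^sub>1 + 96 * s\<^sub>0))"
    using ode unfolding \<omega> by (simp add: algebra_simps)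
  finally have D3: "D (D (D s\<^sub>0)) = D (D \<omega>) * s\<^sub>1 + 3 * D \<omega> * \<omega> * s\<^sub>2
      + \<omega> * (z * (42 * s\<^sub>2 + 22 * s\<^sub>1 + 4 * s\<^sub>0) + z * (z * (384 * s\<^sub>2 + 352 * s\<^sub>1 + 96 * s\<^sub>0)))" .
  show ?thesis unfolding D3 D2 unfolding D\<omega> s by (simp add: algebra_simps)
qed

text \<open>
  If \<open>D\<^sup>2 u = (A / 4) u\<close>, then \<open>u\<^sup>2\<close> solves \<open>D\<^sup>3 v = A D v + (D A / 2) v\<close>; here \<open>A = 8 z + 96 z\<^sup>2\<close>.
\<close>

lemma symmetric_square_ode:
  fixes c z \<omega> u :: "rat fps"
  defines "D \<equiv> \<delta> c"
  assumes Dz: "D z = \<omega> * z" and u: "D (D u) = (2 * z + 24 * (z * z)) * u"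
  shows "D (D (D (u * u))) = (8 * z + 96 * (z * z)) * D (u * u) + \<omega> * ((4 * z + 96 * (z * z)) * (u * u))"
  unfolding \<delta>_simps [of c, folded D_def] u Dz by (simp add: u Dz \<delta>_simps [of c, folded D_def] algebra_simps)

lemma \<delta>_leading:
  assumes "fps_nth c 0 = 1" and "\<And>i. i < k \<Longrightarrow> fps_nth F i = 0"
  shows "fps_nth (\<delta> c F) k = of_nat k * fps_nth F k" and "i < k \<Longrightarrow> fps_nth (\<delta> c F) i = 0"
  using fps_mult_leading [where k = k and F = "\<theta> F" and A = c] assms by (auto simp: \<delta>_def)

text \<open>
  The operator \<open>\<delta> c\<close> multiplies the lowest-order term, of degree \<open>k\<close> say, by \<open>k\<close>, and the
  right-hand side has higher order; so \<open>k ^ 3\<close> times the leading coefficient is zero.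
\<close>

lemma third_order_ode_unique:
  assumes c: "fps_nth c 0 = 1" and A: "fps_nth A 0 = 0" and B: "fps_nth B 0 = 0" and d: "fps_nth d 0 = 0"
    and ode: "\<delta> c (\<delta> c (\<delta> c d)) = A * \<delta> c d + B * d"
  shows "d = 0"
proof (rule ccontr)
  assume "d \<noteq> 0"
  define k where "k = subdegree d"
  have dk: "fps_nth d k \<noteq> 0" using \<open>d \<noteq> 0\<close> by (simp add: k_def)
  then have "k > 0" using d by (cases k) auto
  have low: "fps_nth d i = 0" if "i < k" for i using that unfolding k_def by (rule nth_less_subdegree_zero)
  note l1 = \<delta>_leading [where k = k, OF c low]
  note l2 = \<delta>_leading [where k = k, OF c l1(2)]
  note l3 = \<delta>_leading [where k = k, OF c l2(2)]
  have "fps_nth (A * \<delta> c d) k = 0" "fps_nth (B * d) k = 0"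
    using fps_mult_leading(1) [of k "\<delta> c d" A] fps_mult_leading(1) [of k d B] l1(2) low A B by simp_all
  then have "fps_nth (\<delta> c (\<delta> c (\<delta> c d))) k = 0" unfolding ode by simp
  then show False using l1(1) l2(1) l3(1) dk \<open>k > 0\<close> by simp
qed

lemma second_order_ode_unique:
  assumes c: "fps_nth c 0 = 1" and e: "fps_nth e 0 = 1"
    and A: "fps_nth A 0 = 0" and B: "fps_nth B 0 = 0" and d: "fps_nth d 0 = 0"
    and ode: "e * \<delta> c (\<delta> c d) = A * \<delta> c d + B * d"
  shows "d = 0"
proof (rule ccontr)
  assume "d \<noteq> 0"
  define k where "k = subdegree d"
  have dk: "fps_nth d k \<noteq> 0" using \<open>d \<noteq> 0\<close> by (simp add: k_def)
  then have "k > 0" using d by (cases k) auto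
  have low: "fps_nth d i = 0" if "i < k" for i using that unfolding k_def by (rule nth_less_subdegree_zero)
  note l1 = \<delta>_leading [where k = k, OF c low]
  note l2 = \<delta>_leading [where k = k, OF c l1(2)]
  have "fps_nth (A * \<delta> c d) k = 0" "fps_nth (B * d) k = 0"
    using fps_mult_leading(1) [of k "\<delta> c d" A] fps_mult_leading(1) [of k d B] l1(2) low A B by simp_all
  then have "fps_nth (e * \<delta> c (\<delta> c d)) k = 0" unfolding ode by simp
  moreover have "fps_nth (e * \<delta> c (\<delta> c d)) k = fps_nth (\<delta> c (\<delta> c d)) k"
    using fps_mult_leading(1) [of k "\<delta> c (\<delta> c d)" e] l2(2) e by simp
  ultimately show False using l1(1) l2(1) dk \<open>k > 0\<close> by simp
qed

text \<open>
  The rational functions of the parameter: \<open>zf = X Pf / qf\<^sup>2\<close> and \<open>yf = X\<^sup>3 (1 + X) / rf\<^sup>2\<close>.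
\<close>

definition Pf :: "rat fps" where "Pf = (1 + fps_X) * (1 - 8 * fps_X)"
definition qf :: "rat fps" where "qf = 1 + 8 * (fps_X * fps_X)"
definition rf :: "rat fps" where "rf = 1 - 4 * fps_X - 8 * (fps_X * fps_X)"
definition zf :: "rat fps" where "zf = fps_X * Pf * (inverse qf * inverse qf)"
definition yf :: "rat fps" where "yf = fps_X * (fps_X * (fps_X * (1 + fps_X))) * (inverse rf * inverse rf)"

lemma qf_inverse: "qf * inverse qf = 1"
  by (rule inverse_mult_eq_1') (simp add: qf_def)

lemma rf_inverse: "rf * inverse rf = 1"
  by (rule inverse_mult_eq_1') (simp add: rf_def)

lemma \<theta>_Pf: "\<theta> Pf = - (7 * fps_X + 16 * (fps_X * fps_X))"
  unfolding Pf_def \<theta>_add \<theta>_diff \<theta>_mult \<theta>_const \<theta>_X by (simp add: algebra_simps)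

lemma \<theta>_qf: "\<theta> qf = 16 * (fps_X * fps_X)"
  unfolding qf_def \<theta>_add \<theta>_mult \<theta>_const \<theta>_X by (simp add: algebra_simps)

lemma \<theta>_rf: "\<theta> rf = - (4 * fps_X + 16 * (fps_X * fps_X))"
  unfolding rf_def \<theta>_diff \<theta>_mult \<theta>_const \<theta>_X by (simp add: algebra_simps)

lemma \<theta>_inverse:
  assumes "F * G = 1"
  shows "\<theta> G = - (\<theta> F * (G * G))"
proof -
  have "\<theta> (F * G) = 0" by (simp add: assms)
  then have "F * \<theta> G = - (\<theta> F * G)" by (simp add: \<theta>_mult add_eq_0_iff)
  then have "G * (F * \<theta> G) = - (\<theta> F * (G * G))" by (simp add: algebra_simps)
  moreover have "G * (F * \<theta> G) = (F * G) * \<theta> G" by (simp only: mult_ac)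
  ultimately show ?thesis by (simp add: assms)
qed

text \<open>
  Both sides solve the equation of \<open>third_order_ode\<close> for the derivation \<open>D = (Pf / qf) \<theta>\<close>. For
  the left side this is the chain rule. For the right side, the equation of \<open>G\<close> says that
  \<open>u = \<surd>qf * G\<close> satisfies \<open>D\<^sup>2 u = (2 z + 24 z\<^sup>2) u\<close>, so \<open>u\<^sup>2\<close> is covered by
  \<open>symmetric_square_ode\<close>.
\<close>

lemma central_franel_compose:
  "central_franel_fps oo zf = qf * (franel_fps * franel_fps)"
proof -
  let ?X = "fps_X :: rat fps"
  define Q where "Q = inverse qf"
  have qQ: "qf * Q = 1" unfolding Q_def by (rule qf_inverse)
  \<comment> \<open>the numerator of \<open>z'\<close>: \<open>z' = W / qf\<^sup>3\<close>, and \<open>\<omega> = W / qf\<^sup>2\<close> is a square root of \<open>1 - 28 z - 128 z\<^sup>2\<close>\<close>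
  define W where "W = (1 + 2 * ?X - 8 * (?X * ?X)) * (1 - 16 * ?X - 8 * (?X * ?X))"
  define \<omega> where "\<omega> = W * (Q * Q)"
  define z where "z = ?X * Pf * (Q * Q)"
  define D where "D = \<delta> (Pf * Q)"
  have D: "D F = Pf * Q * \<theta> F" for F by (simp add: D_def \<delta>_def)
  have Q0: "fps_nth Q 0 = 1" by (simp add: Q_def qf_def)
  have z0: "fps_nth z 0 = 0" by (simp add: z_def mult.assoc)
  have nz: "z \<noteq> 0" "\<omega> \<noteq> 0"
  proof -
    have "fps_nth z 1 = 1" by (simp add: z_def mult.assoc Pf_def Q0)
    then show "z \<noteq> 0" by auto
    have "fps_nth \<omega> 0 = 1" by (simp add: \<omega>_def W_def Q0)
    then show "\<omega> \<noteq> 0" by auto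
  qed
  have \<omega>2: "\<omega> * \<omega> = 1 - 28 * z - 128 * (z * z)"
  proof -
    have "W * W = (qf * qf) * (qf * qf) - 28 * (?X * Pf * (qf * qf)) - 128 * (?X * Pf * (?X * Pf))"
      unfolding W_def qf_def Pf_def by (simp add: algebra_simps)
    then have "\<omega> * \<omega> = ((qf * qf) * (qf * qf) - 28 * (?X * Pf * (qf * qf)) - 128 * (?X * Pf * (?X * Pf))) * ((Q * Q) * (Q * Q))"
      unfolding \<omega>_def by (simp add: mult_ac)
    also have "\<dots> = (qf * Q) * (qf * Q) * (qf * Q) * (qf * Q) - 28 * (z * ((qf * Q) * (qf * Q))) - 128 * (z * z)"
      unfolding z_def by (simp add: algebra_simps)
    finally show ?thesis by (simp add: qQ)
  qed
  have \<theta>Q: "\<theta> Q = - (16 * (?X * ?X) * (Q * Q))"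
    using \<theta>_inverse [OF qQ] by (simp add: \<theta>_qf)
  have Dz: "D z = \<omega> * z"
  proof -
    have "D z = Pf * Q * ((?X * Pf + ?X * \<theta> Pf) * (Q * Q) - 32 * (?X * ?X * ?X * Pf) * (Q * Q * Q))"
      unfolding D z_def \<theta>_mult \<theta>_const \<theta>_X \<theta>Q by (simp add: algebra_simps)
    also have "\<dots> = z * Q * ((qf * Q) * (Pf + \<theta> Pf) - 32 * (?X * ?X) * Pf * Q)"
      unfolding qQ z_def by (simp add: algebra_simps)
    also have "\<dots> = z * (Q * Q) * (qf * (Pf + \<theta> Pf) - 32 * (?X * ?X) * Pf)"
      by (simp add: algebra_simps)
    also have "qf * (Pf + \<theta> Pf) - 32 * (?X * ?X) * Pf = W"
      unfolding \<theta>_Pf unfolding W_def qf_def Pf_def by (simp add: algebra_simps)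
    finally show ?thesis by (simp add: \<omega>_def mult_ac)
  qed
  have chain: "D (F oo z) = \<omega> * (\<theta> F oo z)" for F
    unfolding D using Dz by (intro \<theta>_compose z0 nz) (simp add: D)
  let ?S = central_franel_fps
  have num: "(numeral k :: rat fps) oo z = numeral k" for k
    by (simp add: fps_numeral_fps_const)
  have ode: "\<theta> (\<theta> (\<theta> ?S)) oo z =
     z * (28 * (\<theta> (\<theta> (\<theta> ?S)) oo z) + 42 * (\<theta> (\<theta> ?S) oo z) + 22 * (\<theta> ?S oo z) + 4 * (?S oo z))
     + z * (z * (128 * (\<theta> (\<theta> (\<theta> ?S)) oo z) + 384 * (\<theta> (\<theta> ?S) oo z) + 352 * (\<theta> ?S oo z) + 96 * (?S oo z)))"
    using arg_cong [OF central_franel_fps_ode, of "\<lambda>F. F oo z"]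
    by (simp only: fps_compose_add_distrib fps_compose_mult_distrib [OF z0] num fps_X_fps_compose_startby0 [OF z0])
  note s_ode = third_order_ode [of \<omega> z "Pf * Q", folded D_def, OF \<omega>2 nz(2) Dz chain chain chain ode]
  obtain \<epsilon> where \<epsilon>: "\<epsilon> * \<epsilon> = qf" "fps_nth \<epsilon> 0 = 1"
    using fps_sqrt_exists [of qf] by (auto simp: qf_def)
  \<comment> \<open>the logarithmic derivative of \<open>\<epsilon> = \<surd>qf\<close>\<close>
  define a where "a = 8 * (?X * ?X) * Q"
  have \<theta>a: "\<theta> a = 2 * a - 2 * (a * a)"
    unfolding a_def \<theta>_mult \<theta>_const \<theta>_X \<theta>Q by (simp add: algebra_simps)
  have \<theta>\<epsilon>: "\<theta> \<epsilon> = a * \<epsilon>"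
  proof -
    have "\<epsilon> * (2 * \<theta> \<epsilon>) = \<theta> (\<epsilon> * \<epsilon>)" by (simp add: \<theta>_mult algebra_simps)
    also have "\<dots> = 16 * (?X * ?X) * (qf * Q)" by (simp add: \<epsilon>(1) \<theta>_qf qQ)
    also have "\<dots> = \<epsilon> * (2 * (a * \<epsilon>))" unfolding \<epsilon>(1) [symmetric] a_def by (simp add: algebra_simps)
    finally show ?thesis using \<epsilon>(2) by auto
  qed
  let ?G = franel_fps
  define G\<^sub>1 G\<^sub>2 where "G\<^sub>1 = \<theta> ?G" and "G\<^sub>2 = \<theta> G\<^sub>1"
  have G: "Pf * G\<^sub>2 = - \<theta> Pf * G\<^sub>1 + (2 * ?X + 8 * (?X * ?X)) * ?G"
    using franel_fps_ode unfolding G\<^sub>1_def G\<^sub>2_def \<theta>_Pf unfolding Pf_def by (simp add: algebra_simps)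
  define u where "u = \<epsilon> * ?G"
  have Du: "D u = Pf * Q * \<epsilon> * (a * ?G + G\<^sub>1)"
    unfolding D u_def \<theta>_mult \<theta>\<epsilon> by (simp add: G\<^sub>1_def algebra_simps)
  have \<theta>Q': "\<theta> Q = - (2 * a * Q)" unfolding \<theta>Q a_def by (simp add: algebra_simps)
  have key: "a * \<theta> Pf - 3 * (a * a) * Pf + 2 * a * Pf + 8 * (?X * ?X) = 24 * (?X * ?X) * Pf * (Q * Q)"
  proof -
    have poly: "qf * \<theta> Pf - 24 * (?X * ?X) * Pf + 2 * (Pf * qf) + qf * qf = 3 * Pf"
      unfolding \<theta>_Pf unfolding qf_def Pf_def by (simp add: algebra_simps)
    have "a * \<theta> Pf - 3 * (a * a) * Pf + 2 * a * Pf + 8 * (?X * ?X)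
        = a * (qf * Q) * \<theta> Pf - 3 * (a * a) * Pf + 2 * a * (qf * Q) * Pf + 8 * (?X * ?X) * (qf * Q) * (qf * Q)"
      by (simp add: qQ)
    also have "\<dots> = 8 * (?X * ?X) * (Q * Q) * (qf * \<theta> Pf - 24 * (?X * ?X) * Pf + 2 * (Pf * qf) + qf * qf)"
      unfolding a_def by (simp add: algebra_simps)
    finally show ?thesis unfolding poly by (simp add: algebra_simps)
  qed
  have "D (D u) = (2 * z + 24 * (z * z)) * u"
  proof -
    have "D (D u) = Pf * Q * \<epsilon> * Q * ((\<theta> Pf - a * Pf) * (a * ?G + G\<^sub>1) + Pf * (2 * a - 2 * (a * a)) * ?G + Pf * a * G\<^sub>1 + Pf * G\<^sub>2)"
      unfolding Du unfolding D \<theta>_mult \<theta>_add \<theta>Q' \<theta>\<epsilon> \<theta>a G\<^sub>1_def [symmetric] G\<^sub>2_def [symmetric]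
      by (simp add: algebra_simps)
    also have "\<dots> = Pf * Q * \<epsilon> * Q * ?G * (a * \<theta> Pf - 3 * (a * a) * Pf + 2 * a * Pf + 8 * (?X * ?X) + 2 * ?X)"
      unfolding G by (simp add: algebra_simps)
    also have "\<dots> = (2 * z + 24 * (z * z)) * u"
      unfolding key z_def u_def by (simp add: algebra_simps)
    finally show ?thesis .
  qed
  note u_ode = symmetric_square_ode [of "Pf * Q" z \<omega> u, folded D_def, OF Dz this]
  have "(?S oo z) - u * u = 0"
  proof (rule third_order_ode_unique [of "Pf * Q" "8 * z + 96 * (z * z)" "\<omega> * (4 * z + 96 * (z * z))", folded D_def])
    show "D (D (D ((?S oo z) - u * u))) = (8 * z + 96 * (z * z)) * D ((?S oo z) - u * u) + \<omega> * (4 * z + 96 * (z * z)) * ((?S oo z) - u * u)"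
      unfolding \<delta>_simps(2) [of "Pf * Q", folded D_def] s_ode u_ode
      by (simp add: algebra_simps)
    show "fps_nth ((?S oo z) - u * u) 0 = 0"
      by (simp add: u_def \<epsilon> central_franel_fps_def franel_fps_def)
  qed (simp_all add: Pf_def Q0 z0)
  moreover have "u * u = qf * (?G * ?G)" unfolding u_def \<epsilon>(1) [symmetric] by (simp add: mult_ac)
  ultimately show ?thesis by (simp add: z_def Q_def zf_def)
qed

text \<open>
  Here \<open>M(yf)\<close> and \<open>\<surd>rf * G\<close> solve the same equation of order two for the derivation
  \<open>D = (1 + X) rf \<theta>\<close>, for which \<open>D yf = 3 yf\<close>. As \<open>yf\<close> starts in degree 3, it has no
  compositional inverse, so the equations are compared in the variable \<open>X\<close>.
\<close>

lemma quartic_compose: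
  "(quartic_fps oo yf) * (quartic_fps oo yf) = rf * (franel_fps * franel_fps)"
proof -
  let ?X = "fps_X :: rat fps"
  define R where "R = inverse rf"
  have rR: "rf * R = 1" unfolding R_def by (rule rf_inverse)
  define Y where "Y = ?X * (?X * (?X * (1 + ?X)))"
  define y where "y = Y * (R * R)"
  define D where "D = \<delta> ((1 + ?X) * rf)"
  have D: "D F = (1 + ?X) * rf * \<theta> F" for F by (simp add: D_def \<delta>_def)
  have R0: "fps_nth R 0 = 1" by (simp add: R_def rf_def)
  have y0: "fps_nth y 0 = 0" by (simp add: y_def Y_def mult.assoc)
  have "fps_nth y 3 = 1" by (simp add: y_def Y_def mult.assoc R0 eval_nat_numeral)
  then have nz: "y \<noteq> 0" by auto
  have \<theta>R: "\<theta> R = - (\<theta> rf * (R * R))" by (rule \<theta>_inverse [OF rR])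
  have \<theta>Y: "(1 + ?X) * \<theta> Y = (3 + 4 * ?X) * Y"
    unfolding Y_def \<theta>_mult \<theta>_add \<theta>_const \<theta>_X by (simp add: algebra_simps)
  have Dy: "D y = 3 * y"
  proof -
    have "D y = (1 + ?X) * \<theta> Y * (R * R) * rf - 2 * (1 + ?X) * (rf * R) * Y * \<theta> rf * (R * R)"
      unfolding D y_def \<theta>_mult \<theta>R by (simp add: algebra_simps)
    also have "\<dots> = y * ((3 + 4 * ?X) * rf - 2 * (1 + ?X) * \<theta> rf)"
      unfolding rR \<theta>Y y_def by (simp add: algebra_simps)
    also have "(3 + 4 * ?X) * rf - 2 * (1 + ?X) * \<theta> rf = 3"
      unfolding \<theta>_rf unfolding rf_def by (simp add: algebra_simps)
    finally show ?thesis by (simp add: mult.commute)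
  qed
  have chain: "D (F oo y) = 3 * (\<theta> F oo y)" for F
    unfolding D using Dy by (intro \<theta>_compose y0 nz) (simp add: D)
  define m\<^sub>0 m\<^sub>1 m\<^sub>2 where "m\<^sub>0 = quartic_fps oo y" and "m\<^sub>1 = \<theta> quartic_fps oo y" and "m\<^sub>2 = \<theta> (\<theta> quartic_fps) oo y"
  have num: "(numeral k :: rat fps) oo y = numeral k" for k
    by (simp add: fps_numeral_fps_const)
  have ode: "m\<^sub>2 = y * (64 * m\<^sub>2 + 64 * m\<^sub>1 + 12 * m\<^sub>0)"
    using arg_cong [OF quartic_fps_ode, of "\<lambda>F. F oo y"]
    unfolding m\<^sub>0_def m\<^sub>1_def m\<^sub>2_def
    by (simp only: fps_compose_add_distrib fps_compose_mult_distrib [OF y0] num fps_X_fps_compose_startby0 [OF y0])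
  have m: "D m\<^sub>0 = 3 * m\<^sub>1" "D (D m\<^sub>0) = 9 * m\<^sub>2"
    using chain [of quartic_fps] chain [of "\<theta> quartic_fps"] \<delta>_simps(3,4) [of "(1 + ?X) * rf", folded D_def]
    unfolding m\<^sub>0_def m\<^sub>1_def m\<^sub>2_def by simp_all
  have m_ode: "(1 - 8 * ?X) * D (D m\<^sub>0) = 192 * Y * D m\<^sub>0 + 108 * Y * m\<^sub>0"
  proof -
    have poly: "rf * rf - 64 * Y = 1 - 8 * ?X"
      unfolding rf_def Y_def by (simp add: algebra_simps)
    have "(1 - 8 * ?X) * D (D m\<^sub>0) = 9 * (rf * rf * m\<^sub>2 - 64 * Y * m\<^sub>2)"
      unfolding m(2) poly [symmetric] by (simp add: algebra_simps)
    also have "rf * rf * m\<^sub>2 = rf * rf * (y * (64 * m\<^sub>2 + 64 * m\<^sub>1 + 12 * m\<^sub>0))"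
      using ode by simp
    also have "\<dots> = (rf * R) * (rf * R) * Y * (64 * m\<^sub>2 + 64 * m\<^sub>1 + 12 * m\<^sub>0)"
      unfolding y_def by (simp only: mult_ac)
    also have "\<dots> = Y * (64 * m\<^sub>2 + 64 * m\<^sub>1 + 12 * m\<^sub>0)" by (simp add: rR)
    finally show ?thesis unfolding m(1) by (simp add: algebra_simps)
  qed
  obtain \<epsilon> where \<epsilon>: "\<epsilon> * \<epsilon> = rf" "fps_nth \<epsilon> 0 = 1"
    using fps_sqrt_exists [of rf] by (auto simp: rf_def)
  \<comment> \<open>half of \<open>\<theta> rf\<close>, so that \<open>\<epsilon> = \<surd>rf\<close> has logarithmic derivative \<open>c / rf\<close>\<close>
  define c where "c = - (2 * ?X + 8 * (?X * ?X))"
  have \<theta>r: "\<theta> rf = 2 * c" unfolding \<theta>_rf c_def by (simp add: algebra_simps)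
  have \<theta>c: "\<theta> c = - (2 * ?X + 16 * (?X * ?X))"
    unfolding c_def \<theta>_add \<theta>_mult \<theta>_const \<theta>_X by (simp add: algebra_simps)
  have r\<theta>\<epsilon>: "rf * \<theta> \<epsilon> = c * \<epsilon>"
  proof -
    have "\<epsilon> * (2 * \<theta> \<epsilon>) = \<theta> (\<epsilon> * \<epsilon>)" by (simp add: \<theta>_mult algebra_simps)
    also have "\<dots> = 2 * c" by (simp add: \<epsilon>(1) \<theta>r)
    finally have "\<epsilon> * \<theta> \<epsilon> = c" by simp
    then show ?thesis unfolding \<epsilon>(1) [symmetric] by (simp add: mult_ac)
  qed
  let ?G = franel_fps
  define G\<^sub>1 G\<^sub>2 where "G\<^sub>1 = \<theta> ?G" and "G\<^sub>2 = \<theta> G\<^sub>1"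
  have G: "(1 + ?X) * (1 - 8 * ?X) * G\<^sub>2 = (7 * ?X + 16 * (?X * ?X)) * G\<^sub>1 + (2 * ?X + 8 * (?X * ?X)) * ?G"
    using franel_fps_ode unfolding G\<^sub>1_def G\<^sub>2_def by (simp add: algebra_simps)
  define u where "u = \<epsilon> * ?G"
  have Du: "D u = (1 + ?X) * \<epsilon> * (c * ?G + rf * G\<^sub>1)"
  proof -
    have "D u = (1 + ?X) * ((rf * \<theta> \<epsilon>) * ?G + \<epsilon> * rf * G\<^sub>1)"
      unfolding D u_def \<theta>_mult G\<^sub>1_def by (simp add: algebra_simps)
    then show ?thesis unfolding r\<theta>\<epsilon> by (simp add: algebra_simps)
  qed
  have DDu: "D (D u) = (1 + ?X) * \<epsilon> * ((?X * rf + (1 + ?X) * c) * (c * ?G + rf * G\<^sub>1)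
      + (1 + ?X) * rf * (\<theta> c * ?G + 3 * c * G\<^sub>1) + (1 + ?X) * (rf * rf) * G\<^sub>2)"
  proof -
    have "D (D u) = (1 + ?X) * (?X * rf * \<epsilon> * (c * ?G + rf * G\<^sub>1) + (1 + ?X) * (rf * \<theta> \<epsilon>) * (c * ?G + rf * G\<^sub>1)
        + (1 + ?X) * \<epsilon> * rf * (\<theta> c * ?G + c * G\<^sub>1 + \<theta> rf * G\<^sub>1 + rf * G\<^sub>2))"
      unfolding Du unfolding D \<theta>_mult \<theta>_add \<theta>_const \<theta>_X G\<^sub>1_def G\<^sub>2_def by (simp add: algebra_simps)
    then show ?thesis unfolding r\<theta>\<epsilon> \<theta>r by (simp add: algebra_simps)
  qed
  have u_ode: "(1 - 8 * ?X) * D (D u) = 192 * Y * D u + 108 * Y * u"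
  proof -
    have "(1 - 8 * ?X) * D (D u) = (1 + ?X) * \<epsilon> * ((1 - 8 * ?X) * ((?X * rf + (1 + ?X) * c) * (c * ?G + rf * G\<^sub>1)
      + (1 + ?X) * rf * (\<theta> c * ?G + 3 * c * G\<^sub>1)) + (rf * rf) * ((1 + ?X) * (1 - 8 * ?X) * G\<^sub>2))"
      unfolding DDu by (simp add: algebra_simps)
    also have "(1 - 8 * ?X) * ((?X * rf + (1 + ?X) * c) * (c * ?G + rf * G\<^sub>1)
      + (1 + ?X) * rf * (\<theta> c * ?G + 3 * c * G\<^sub>1)) + (rf * rf) * ((1 + ?X) * (1 - 8 * ?X) * G\<^sub>2)
      = ((1 - 8 * ?X) * ((?X * rf + (1 + ?X) * c) * c + (1 + ?X) * rf * \<theta> c) + (rf * rf) * (2 * ?X + 8 * (?X * ?X))) * ?G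
      + ((1 - 8 * ?X) * ((?X * rf + (1 + ?X) * c) + 3 * (1 + ?X) * c) + rf * (7 * ?X + 16 * (?X * ?X))) * (rf * G\<^sub>1)"
      unfolding G by (simp add: algebra_simps)
    also have "(1 - 8 * ?X) * ((?X * rf + (1 + ?X) * c) * c + (1 + ?X) * rf * \<theta> c) + (rf * rf) * (2 * ?X + 8 * (?X * ?X))
      = 192 * Y * c + 108 * (?X * (?X * ?X))"
      unfolding \<theta>c unfolding c_def rf_def Y_def by (simp add: algebra_simps)
    also have "(1 - 8 * ?X) * ((?X * rf + (1 + ?X) * c) + 3 * (1 + ?X) * c) + rf * (7 * ?X + 16 * (?X * ?X))
      = 192 * Y"
      unfolding c_def rf_def Y_def by (simp add: algebra_simps)
    finally have main: "(1 - 8 * ?X) * D (D u)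
      = (1 + ?X) * \<epsilon> * ((192 * Y * c + 108 * (?X * (?X * ?X))) * ?G + 192 * Y * (rf * G\<^sub>1))" .
    show ?thesis unfolding main unfolding Du unfolding u_def Y_def by (simp add: algebra_simps)
  qed
  have "m\<^sub>0 - u = 0"
  proof (rule second_order_ode_unique [of "(1 + ?X) * rf" "1 - 8 * ?X" "192 * Y" "108 * Y", folded D_def])
    have "D (D (m\<^sub>0 - u)) = D (D m\<^sub>0) - D (D u)" "D (m\<^sub>0 - u) = D m\<^sub>0 - D u"
      by (simp_all add: \<delta>_simps(2) [of "(1 + ?X) * rf", folded D_def])
    then show "(1 - 8 * ?X) * D (D (m\<^sub>0 - u)) = 192 * Y * D (m\<^sub>0 - u) + 108 * Y * (m\<^sub>0 - u)"
      using m_ode u_ode by (simp only: right_diff_distrib) simp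
    show "fps_nth (m\<^sub>0 - u) 0 = 0"
      by (simp add: u_def \<epsilon> m\<^sub>0_def quartic_fps_def franel_fps_def)
  qed (simp_all add: rf_def Y_def mult.assoc)
  then have "m\<^sub>0 * m\<^sub>0 = (\<epsilon> * \<epsilon>) * (?G * ?G)" by (simp add: u_def mult_ac)
  then show ?thesis by (simp add: \<epsilon>(1) m\<^sub>0_def y_def Y_def yf_def R_def)
qed

section \<open>The Legendre symbol and sums over residues\<close>

locale odd_prime =
  fixes p :: nat
  assumes prime: "prime p" and odd_p: "p > 2"
begin

abbreviation chi :: "int \<Rightarrow> int" where "chi a \<equiv> Legendre a (int p)"

definition Fp :: "int set" where "Fp = {0..<int p}"

lemma finite_Fp [simp]: "finite Fp"
  and card_Fp [simp]: "card Fp = p"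
  by (simp_all add: Fp_def)

lemma mod_in_Fp [simp]: "x mod int p \<in> Fp"
  using odd_p by (simp add: Fp_def)

lemma prime_int_p: "prime (int p)"
  using prime by simp

lemma p_dvd_mult_iff: "int p dvd a * b \<longleftrightarrow> int p dvd a \<or> int p dvd b"
  using prime_dvd_mult_iff [OF prime_int_p] .

lemma p_dvd_power_iff: "int p dvd a ^ k \<longleftrightarrow> int p dvd a \<and> k > 0"
  using prime_dvd_power_int_iff [OF prime_int_p, of k a] odd_p
  by (cases "k = 0") auto

lemma not_p_dvd_2: "\<not> int p dvd 2"
  using odd_p zdvd_imp_le [of "int p" 2] by auto

lemma not_p_dvd_4: "\<not> int p dvd 4"
  using not_p_dvd_2 p_dvd_mult_iff [of 2 2] by simp

lemma Fp_cong_imp_eq: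
  "x \<in> Fp \<Longrightarrow> y \<in> Fp \<Longrightarrow> [x = y] (mod int p) \<Longrightarrow> x = y"
  by (simp add: Fp_def cong_def)

lemma chi_cong: "[a = b] (mod int p) \<Longrightarrow> chi a = chi b"
  by (simp add: Legendre_def QuadRes_def cong_def)

lemma chi_eq_0_iff: "chi a = 0 \<longleftrightarrow> int p dvd a"
  by (simp add: Legendre_def cong_0_iff)

lemma chi_range: "chi a \<in> {-1, 0, 1}"
  by (simp add: Legendre_def)

lemma chi_euler: "[chi a = a ^ ((p - 1) div 2)] (mod int p)"
  using euler_criterion [OF prime odd_p] .

text \<open>
  Values of quadratic characters may be compared modulo \<open>p\<close>, because \<open>p > 2\<close>.
\<close>

lemma eq_of_cong_small:
  "[a = b] (mod int p) \<Longrightarrow> a \<in> {-1, 0, 1} \<Longrightarrow> b \<in> {-1, 0, 1} \<Longrightarrow> a = b"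
proof -
  assume "[a = b] (mod int p)" "a \<in> {-1, 0, 1}" "b \<in> {-1, 0, 1}"
  then have "int p dvd a - b" "\<bar>a - b\<bar> \<le> 2"
    by (auto simp: cong_iff_dvd_diff)
  then show "a = b" using odd_p dvd_imp_le_int [of "a - b" "int p"] by linarith
qed

lemma chi_mult: "chi (a * b) = chi a * chi b"
proof (rule eq_of_cong_small)
  have "[chi (a * b) = a ^ ((p - 1) div 2) * b ^ ((p - 1) div 2)] (mod int p)"
    using chi_euler [of "a * b"] by (simp add: power_mult_distrib)
  moreover have "[chi a * chi b = a ^ ((p - 1) div 2) * b ^ ((p - 1) div 2)] (mod int p)"
    by (intro cong_mult chi_euler)
  ultimately show "[chi (a * b) = chi a * chi b] (mod int p)"
    by (metis cong_sym cong_trans)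
qed (use chi_range [of a] chi_range [of b] chi_range [of "a * b"] in auto)

lemma chi_mult_self: "chi a * chi a = (if int p dvd a then 0 else 1)"
  using chi_range [of a] chi_eq_0_iff [of a] by auto

lemma chi_1 [simp]: "chi 1 = 1"
  using chi_mult [of 1 1] chi_eq_0_iff [of 1] prime_int_p by (auto simp: not_prime_unit)

lemma chi_square: "\<not> int p dvd a \<Longrightarrow> chi (a\<^sup>2) = 1"
  by (simp add: power2_eq_square chi_mult chi_mult_self)

lemma chi_power4: "\<not> int p dvd a \<Longrightarrow> chi (a ^ 4) = 1"
  using chi_square [of "a\<^sup>2"] by (simp add: p_dvd_power_iff)

lemma fermat: "\<not> int p dvd a \<Longrightarrow> [a ^ (p - 1) = 1] (mod int p)"
proof -
  assume "\<not> int p dvd a"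
  then have "(chi a) ^ 2 = 1" by (simp add: power2_eq_square chi_mult_self)
  moreover have "[(chi a) ^ 2 = (a ^ ((p - 1) div 2)) ^ 2] (mod int p)"
    by (intro cong_pow chi_euler)
  moreover have "(p - 1) div 2 * 2 = p - 1"
    using prime_odd_nat [OF prime] odd_p by (simp add: even_two_times_div_two)
  ultimately show ?thesis by (simp add: cong_sym_eq flip: power_mult)
qed

text \<open>
  A map that is injective modulo \<open>p\<close> permutes the residue classes, so it may be substituted
  into the complete sum of a periodic function.
\<close>

lemma sum_Fp_reindex:
  assumes per: "\<And>x y. [x = y] (mod int p) \<Longrightarrow> f x = f y"
    and inj: "\<And>x y. [h x = h y] (mod int p) \<Longrightarrow> [x = y] (mod int p)"
  shows "(\<Sum>x\<in>Fp. f (h x)) = (\<Sum>x\<in>Fp. (f x :: int))"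
proof -
  have "inj_on (\<lambda>x. h x mod int p) Fp"
  proof (rule inj_onI)
    fix x y assume "x \<in> Fp" "y \<in> Fp" and "h x mod int p = h y mod int p"
    then show "x = y" using Fp_cong_imp_eq inj [of x y] by (simp add: cong_def [of "h x"])
  qed
  moreover have "(\<lambda>x. h x mod int p) ` Fp \<subseteq> Fp" by auto
  ultimately have "bij_betw (\<lambda>x. h x mod int p) Fp Fp"
    by (simp add: bij_betw_def endo_inj_surj)
  from sum.reindex_bij_betw [OF this, of f] have "(\<Sum>x\<in>Fp. f (h x mod int p)) = sum f Fp" .
  moreover have "f (h x mod int p) = f (h x)" for x by (rule per) (simp add: cong_def)
  ultimately show ?thesis by simp
qed

lemma sum_Fp_affine:
  assumes "\<And>x y. [x = y] (mod int p) \<Longrightarrow> f x = f y" and "\<not> int p dvd a"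
  shows "(\<Sum>x\<in>Fp. f (a * x + b)) = (\<Sum>x\<in>Fp. (f x :: int))"
proof (rule sum_Fp_reindex [OF assms(1)])
  fix x y assume "[a * x + b = a * y + b] (mod int p)"
  then have "int p dvd a * (x - y)" by (simp add: cong_iff_dvd_diff algebra_simps)
  then show "[x = y] (mod int p)" using assms(2) p_dvd_mult_iff by (simp add: cong_iff_dvd_diff)
qed

lemma zero_in_Fp [simp]: "0 \<in> Fp"
  using odd_p by (simp add: Fp_def)

lemma p_dvd_residue_iff: "x \<in> Fp \<Longrightarrow> int p dvd x \<longleftrightarrow> x = 0"
  by (metis Fp_cong_imp_eq cong_0_iff zero_in_Fp dvd_0_right)

lemma not_p_dvd_less: "c \<in> {1..<int p} \<Longrightarrow> \<not> int p dvd c"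
  using zdvd_imp_le [of "int p" c] by auto

lemma sum_Fp_indicator:
  "(\<Sum>x\<in>Fp. if int p dvd x then 0 else c) = (int p - 1) * (c :: int)"
proof -
  have "(\<Sum>x\<in>Fp. if int p dvd x then 0 else c) = (\<Sum>x\<in>Fp. if x = 0 then 0 else c)"
    by (rule sum.cong) (auto simp: p_dvd_residue_iff)
  also have "\<dots> = (\<Sum>x\<in>Fp. c - (if x = 0 then c else 0))" by (rule sum.cong) auto
  also have "\<dots> = (int p - 1) * c" by (simp add: sum_subtractf algebra_simps)
  finally show ?thesis .
qed

text \<open>
  A primitive root is a nonresidue. The least positive nonresidue \<open>m\<close> has the additional
  property that \<open>m - 1\<close> is a nonzero square, which makes \<open>m\<close> a sum of two squares modulo \<open>p\<close>.
\<close>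

lemma exists_nonresidue: "\<exists>m. chi m = - 1 \<and> chi (m - 1) = 1"
proof -
  have "p > 1" using odd_p by simp
  then obtain g where g: "residue_primroot p g"
    using prime_primitive_root_exists [OF _ prime] by blast
  then have ord: "ord p g = p - 1" and cop: "coprime p g"
    using prime by (simp_all add: residue_primroot_def totient_prime)
  have "chi (int g) \<noteq> 1"
  proof
    assume "chi (int g) = 1"
    then have "[int (g ^ ((p - 1) div 2)) = int 1] (mod int p)"
      using chi_euler [of "int g"] by (simp add: cong_sym_eq)
    then have "p - 1 dvd (p - 1) div 2"
      by (simp only: cong_int_iff ord_divides ord)
    moreover have "(p - 1) div 2 > 0" using odd_p by simp
    ultimately have "p - 1 \<le> (p - 1) div 2" by (rule dvd_imp_le)
    then show False using odd_p by linarith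
  qed
  moreover have "chi (int g) \<noteq> 0"
  proof
    assume "chi (int g) = 0"
    then have "p dvd g" by (simp add: chi_eq_0_iff int_dvd_int_iff)
    from coprime_common_divisor [OF cop dvd_refl this] show False using odd_p by simp
  qed
  ultimately have ex: "chi (int g) = - 1" using chi_range [of "int g"] by auto
  define m where "m = (LEAST m. chi (int m) = - 1)"
  have m: "chi (int m) = - 1" unfolding m_def using ex by (rule LeastI)
  then have "m > 0" using chi_eq_0_iff [of 0] by (cases m) auto
  then have "chi (int (m - 1)) \<noteq> - 1"
    using not_less_Least [of "m - 1" "\<lambda>m. chi (int m) = - 1"] by (auto simp: m_def)
  moreover have "chi (int (m - 1)) \<noteq> 0"
  proof
    assume "chi (int (m - 1)) = 0"
    then have "[int m = 1] (mod int p)"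
      using \<open>m > 0\<close> by (simp add: chi_eq_0_iff cong_iff_dvd_diff of_nat_diff)
    from chi_cong [OF this] m show False by simp
  qed
  ultimately have "chi (int m - 1) = 1"
    using chi_range [of "int (m - 1)"] \<open>m > 0\<close> by (auto simp: of_nat_diff)
  with m show ?thesis by blast
qed

text \<open>
  Multiplication by a nonresidue changes the sign of the sum.
\<close>

lemma sum_chi: "(\<Sum>x\<in>Fp. chi x) = 0"
proof -
  obtain m where m: "chi m = - 1" using exists_nonresidue by blast
  then have "\<not> int p dvd m" using chi_eq_0_iff [of m] by auto
  from sum_Fp_affine [of chi, OF chi_cong this, of 0]
  show ?thesis by (simp add: chi_mult m sum_negf)
qed

lemma sum_chi_affine: "\<not> int p dvd a \<Longrightarrow> (\<Sum>x\<in>Fp. chi (a * x + b)) = 0"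
  using sum_Fp_affine [of chi a b, OF chi_cong] sum_chi by simp

end

section \<open>Gaussian integers modulo an odd prime\<close>

datatype gauss = Gauss (gre: int) (gim: int)

instantiation gauss :: comm_ring_1
begin
definition "0 = Gauss 0 0"
definition "1 = Gauss 1 0"
definition "a + b = Gauss (gre a + gre b) (gim a + gim b)"
definition "a - b = Gauss (gre a - gre b) (gim a - gim b)"
definition "- a = Gauss (- gre a) (- gim a)"
definition "a * b = Gauss (gre a * gre b - gim a * gim b) (gre a * gim b + gim a * gre b)"
instance
  by standard
    (simp_all add: zero_gauss_def one_gauss_def plus_gauss_def minus_gauss_def uminus_gauss_def
      times_gauss_def gauss.expand algebra_simps)
end

lemma gauss_sel [simp]:
  "gre 0 = 0" "gim 0 = 0" "gre 1 = 1" "gim 1 = 0"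
  "gre (a + b) = gre a + gre b" "gim (a + b) = gim a + gim b"
  "gre (a - b) = gre a - gre b" "gim (a - b) = gim a - gim b"
  "gre (- a) = - gre a" "gim (- a) = - gim a"
  "gre (a * b) = gre a * gre b - gim a * gim b" "gim (a * b) = gre a * gim b + gim a * gre b"
  by (simp_all add: zero_gauss_def one_gauss_def plus_gauss_def minus_gauss_def uminus_gauss_def
      times_gauss_def)

lemma gauss_of_nat [simp]: "gre (of_nat n) = int n" "gim (of_nat n) = 0"
  by (induction n) simp_all

lemma gauss_of_int [simp]: "gre (of_int n) = n" "gim (of_int n) = 0"
  by (cases n; simp)+

lemma gauss_numeral [simp]: "gre (numeral n) = numeral n" "gim (numeral n) = 0"
  using gauss_of_int [of "numeral n"] by simp_all

definition gcnj :: "gauss \<Rightarrow> gauss" where "gcnj a = Gauss (gre a) (- gim a)"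
definition gnorm :: "gauss \<Rightarrow> int" where "gnorm a = (gre a)\<^sup>2 + (gim a)\<^sup>2"

lemma gcnj_sel [simp]: "gre (gcnj a) = gre a" "gim (gcnj a) = - gim a"
  by (simp_all add: gcnj_def)

lemma gcnj_mult: "gcnj (a * b) = gcnj a * gcnj b"
  by (rule gauss.expand) simp

lemma gcnj_power: "gcnj (a ^ n) = gcnj a ^ n"
  by (induction n) (simp_all add: gcnj_mult, simp add: gcnj_def one_gauss_def)

lemma gnorm_mult: "gnorm (a * b) = gnorm a * gnorm b"
  by (simp add: gnorm_def power2_eq_square algebra_simps)

lemma gnorm_power: "gnorm (a ^ n) = gnorm a ^ n"
  by (induction n) (simp_all add: gnorm_mult, simp add: gnorm_def)

lemma gnorm_of_int: "gnorm (of_int c) = c\<^sup>2"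
  by (simp add: gnorm_def)

lemma gnorm_gcnj: "gnorm (gcnj a) = gnorm a"
  by (simp add: gnorm_def)

lemma mult_gcnj: "a * gcnj a = of_int (gnorm a)"
  by (rule gauss.expand) (simp add: gnorm_def power2_eq_square)

lemma of_int_dvd_gauss_iff: "of_int m dvd a \<longleftrightarrow> m dvd gre a \<and> m dvd gim a"
proof
  assume "of_int m dvd a"
  then obtain b where "a = of_int m * b" by (auto elim: dvdE)
  then show "m dvd gre a \<and> m dvd gim a" by simp
next
  assume "m dvd gre a \<and> m dvd gim a"
  then obtain x y where "gre a = m * x" "gim a = m * y" by (auto elim!: dvdE)
  then have "a = of_int m * Gauss x y" by (intro gauss.expand) simp
  then show "of_int m dvd a" by simp
qed

lemma gre_power4: "gre (a ^ 4) = gre a ^ 4 - 6 * (gre a)\<^sup>2 * (gim a)\<^sup>2 + gim a ^ 4"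
  by (simp add: power4_eq_xxxx power2_eq_square algebra_simps)

lemma gim_power4: "gim (a ^ 4) = 4 * (gre a * (gim a * ((gre a - gim a) * (gre a + gim a))))"
  by (simp add: power4_eq_xxxx power2_eq_square algebra_simps)

context odd_prime
begin

definition gcong :: "gauss \<Rightarrow> gauss \<Rightarrow> bool" where
  "gcong a b \<longleftrightarrow> of_int (int p) dvd a - b"

lemma gcong_iff: "gcong a b \<longleftrightarrow> [gre a = gre b] (mod int p) \<and> [gim a = gim b] (mod int p)"
  unfolding gcong_def of_int_dvd_gauss_iff by (simp add: cong_iff_dvd_diff)

lemma gcong_refl [simp]: "gcong a a" by (simp add: gcong_def)

lemma gcong_sym: "gcong a b \<Longrightarrow> gcong b a"
  by (simp add: gcong_iff cong_sym)

lemma gcong_trans: "gcong a b \<Longrightarrow> gcong b c \<Longrightarrow> gcong a c"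
  unfolding gcong_iff using cong_trans by blast

lemma gcong_mult: "gcong a b \<Longrightarrow> gcong c d \<Longrightarrow> gcong (a * c) (b * d)"
proof -
  assume "gcong a b" "gcong c d"
  moreover have "a * c - b * d = (a - b) * c + b * (c - d)" by (simp add: algebra_simps)
  ultimately show ?thesis unfolding gcong_def by (simp only: dvd_add dvd_mult dvd_mult2)
qed

lemma gcong_power: "gcong a b \<Longrightarrow> gcong (a ^ n) (b ^ n)"
  by (induction n) (simp_all add: gcong_mult)

lemma gcong_gnorm: "gcong a b \<Longrightarrow> [gnorm a = gnorm b] (mod int p)"
  unfolding gcong_iff gnorm_def by (intro cong_add cong_pow) auto

lemma gcong_gre: "gcong a b \<Longrightarrow> [gre a = gre b] (mod int p)"
  by (simp add: gcong_iff)

text \<open>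
  An element whose norm is prime to \<open>p\<close> is a unit modulo \<open>p\<close>: multiply by its conjugate.
  This covers both cases, \<open>p\<close> split and \<open>p\<close> inert.
\<close>

lemma gcong_cancel:
  assumes "gcong (c * a) (c * b)" and "\<not> int p dvd gnorm c"
  shows "gcong a b"
proof -
  have "of_int (int p) dvd gcnj c * (c * a - c * b)"
    using assms(1) unfolding gcong_def by (rule dvd_mult)
  moreover have "gcnj c * (c * a - c * b) = of_int (gnorm c) * (a - b)"
    using mult_gcnj [of c] by (simp add: algebra_simps flip: mult.assoc)
  ultimately have "of_int (int p) dvd of_int (gnorm c) * (a - b)" by simp
  then show ?thesis using assms(2)
    unfolding gcong_def of_int_dvd_gauss_iff by (simp add: p_dvd_mult_iff)
qed

definition gres :: "gauss set" where
  "gres = (\<lambda>(x, y). Gauss x y) ` (Fp \<times> Fp)"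

definition gunits :: "gauss set" where
  "gunits = {a \<in> gres. \<not> int p dvd gnorm a}"

definition gmod :: "gauss \<Rightarrow> gauss" where
  "gmod a = Gauss (gre a mod int p) (gim a mod int p)"

lemma inj_Gauss: "inj_on (\<lambda>(x, y). Gauss x y) A"
  by (auto simp: inj_on_def)

lemma gres_iff: "a \<in> gres \<longleftrightarrow> gre a \<in> Fp \<and> gim a \<in> Fp"
  unfolding gres_def by (cases a) (auto simp: image_iff)

lemma finite_gres [simp]: "finite gres" by (simp add: gres_def)
lemma finite_gunits [simp]: "finite gunits" by (simp add: gunits_def)

lemma gmod_in_gres [simp]: "gmod a \<in> gres"
  by (simp add: gres_iff gmod_def)

lemma gcong_gmod [simp]: "gcong (gmod a) a"
  by (simp add: gcong_iff gmod_def)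

lemma gres_gcong_eq: "a \<in> gres \<Longrightarrow> b \<in> gres \<Longrightarrow> gcong a b \<Longrightarrow> a = b"
  unfolding gres_iff gcong_iff by (intro gauss.expand) (auto intro: Fp_cong_imp_eq)

lemma sum_gres: "(\<Sum>a\<in>gres. f a) = (\<Sum>x\<in>Fp. \<Sum>y\<in>Fp. (f (Gauss x y) :: int))"
  unfolding gres_def
  by (subst sum.reindex [OF inj_Gauss]) (simp add: sum.cartesian_product case_prod_unfold)

lemma sum_gres_reindex:
  assumes per: "\<And>a b. gcong a b \<Longrightarrow> f a = f b"
    and inj: "\<And>a b. gcong (h a) (h b) \<Longrightarrow> gcong a b"
  shows "(\<Sum>a\<in>gres. f (h a)) = (\<Sum>a\<in>gres. (f a :: int))"
proof -
  have "inj_on (\<lambda>a. gmod (h a)) gres"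
  proof (rule inj_onI)
    fix a b assume "a \<in> gres" "b \<in> gres" and eq: "gmod (h a) = gmod (h b)"
    have "gcong (h a) (h b)"
      using gcong_trans [OF gcong_sym [OF gcong_gmod [of "h a"]]] eq gcong_gmod [of "h b"] by simp
    then show "a = b" using inj gres_gcong_eq \<open>a \<in> gres\<close> \<open>b \<in> gres\<close> by blast
  qed
  moreover have "(\<lambda>a. gmod (h a)) ` gres \<subseteq> gres" by auto
  ultimately have "bij_betw (\<lambda>a. gmod (h a)) gres gres"
    by (simp add: bij_betw_def endo_inj_surj)
  from sum.reindex_bij_betw [OF this, of f] have "(\<Sum>a\<in>gres. f (gmod (h a))) = sum f gres" .
  moreover have "f (gmod (h a)) = f (h a)" for a by (rule per) simp
  ultimately show ?thesis by simp
qed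

lemma sum_gres_mult:
  assumes "\<And>a b. gcong a b \<Longrightarrow> f a = f b" and "\<not> int p dvd gnorm c"
  shows "(\<Sum>a\<in>gres. f (c * a)) = (\<Sum>a\<in>gres. (f a :: int))"
  using assms(1) gcong_cancel [OF _ assms(2)] by (rule sum_gres_reindex)

section \<open>A quadratic character sum over fourth powers\<close>

text \<open>
  This is the sum \<open>K\<close> of the introduction. If -2 is a square, \<open>K b\<close> is up to normalisation a
  combination of Jacobi sums (for \<open>p\<close> split) or Eisenstein sums (for \<open>p\<close> inert) of characters of
  order 8; written with quadratic characters alone, it is visibly an integer.
\<close>

definition octic_sum :: "gauss \<Rightarrow> int" where
  "octic_sum b = (\<Sum>a\<in>gres. chi (gnorm a) * chi (gre (b * a ^ 4)))"

lemma octic_summand_cong: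
  "gcong a a' \<Longrightarrow> chi (gnorm a) * chi (gre (b * a ^ 4)) = chi (gnorm a') * chi (gre (b * a' ^ 4))"
  by (intro arg_cong2 [of _ _ _ _ "(*)"] chi_cong gcong_gnorm gcong_gre gcong_mult gcong_power gcong_refl)

lemma octic_sum_cong: "gcong a b \<Longrightarrow> octic_sum a = octic_sum b"
  unfolding octic_sum_def
  by (intro sum.cong refl arg_cong2 [of _ _ _ _ "(*)"] chi_cong gcong_gre gcong_mult gcong_refl)

lemma octic_sum_of_int_mult: "octic_sum (of_int c * b) = chi c * octic_sum b"
  unfolding octic_sum_def sum_distrib_left
  by (intro sum.cong refl) (simp add: chi_mult mult.assoc flip: right_diff_distrib)

text \<open>
  Substituting \<open>c * a\<close> for \<open>a\<close> moves \<open>c ^ 4\<close> to the parameter and costs the factor \<open>\<chi> (N c)\<close>.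
\<close>

lemma octic_sum_power4_mult:
  assumes "\<not> int p dvd gnorm c"
  shows "octic_sum (c ^ 4 * b) = chi (gnorm c) * octic_sum b"
proof -
  define f where "f a = chi (gnorm a) * chi (gre (b * a ^ 4))" for a
  have "f a = f a'" if "gcong a a'" for a a'
    unfolding f_def by (rule octic_summand_cong [OF that])
  then have "octic_sum b = (\<Sum>a\<in>gres. f (c * a))"
    using sum_gres_mult [of f, OF _ assms] by (simp add: octic_sum_def f_def)
  also have "\<dots> = (\<Sum>a\<in>gres. chi (gnorm c) * (chi (gnorm a) * chi (gre (c ^ 4 * b * a ^ 4))))"
    unfolding f_def gnorm_mult chi_mult power_mult_distrib by (simp only: mult_ac)
  also have "\<dots> = chi (gnorm c) * octic_sum (c ^ 4 * b)"
    by (simp only: octic_sum_def sum_distrib_left)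
  finally have "chi (gnorm c) * octic_sum b = (chi (gnorm c) * chi (gnorm c)) * octic_sum (c ^ 4 * b)" by simp
  then show ?thesis using assms by (simp add: chi_mult_self)
qed

lemma octic_sum_gcnj: "octic_sum (gcnj b) = octic_sum b"
proof -
  define f where "f a = chi (gnorm a) * chi (gre (b * a ^ 4))" for a
  have per: "f a = f a'" if "gcong a a'" for a a'
    unfolding f_def by (rule octic_summand_cong [OF that])
  have inj: "gcong a a'" if "gcong (gcnj a) (gcnj a')" for a a'
    using that cong_minus_minus_iff [of "gim a" "gim a'"] unfolding gcong_iff gcnj_sel by blast
  have "octic_sum b = (\<Sum>a\<in>gres. f (gcnj a))"
    using sum_gres_reindex [of f gcnj, OF per inj] unfolding octic_sum_def f_def by (rule sym)
  moreover have "f (gcnj a) = chi (gnorm a) * chi (gre (gcnj b * a ^ 4))" for a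
  proof -
    have "gcnj (gcnj b * a ^ 4) = b * gcnj a ^ 4"
      by (simp add: gcnj_mult gcnj_power) (simp add: gcnj_def)
    then have "gre (b * gcnj a ^ 4) = gre (gcnj b * a ^ 4)" by (metis gcnj_sel(1))
    then show ?thesis by (simp add: f_def gnorm_gcnj)
  qed
  ultimately show ?thesis by (simp add: octic_sum_def)
qed

text \<open>
  Since \<open>(1 + i) ^ 4 = -4\<close> is rational and \<open>1 + i\<close> has norm 2, the value is multiplied by
  \<open>\<chi> 2\<close> as well as by \<open>\<chi> (-4) = \<chi> (-2) \<chi> 2\<close>.
\<close>

lemma octic_sum_one_eq_0:
  assumes "chi (- 2) = - 1"
  shows "octic_sum 1 = 0"
proof -
  define c where "c = Gauss 1 1"
  have n: "gnorm c = 2" by (simp add: c_def gnorm_def)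
  have "c ^ 4 * 1 = of_int (- 4) * 1"
    by (rule gauss.expand) (simp add: c_def power4_eq_xxxx)
  then have "chi 2 * octic_sum 1 = chi (- 4) * octic_sum 1"
    using octic_sum_power4_mult [of c 1] octic_sum_of_int_mult [of "- 4" 1] n not_p_dvd_2 by simp
  also have "\<dots> = chi (- 2) * chi 2 * octic_sum 1" using chi_mult [of "- 2" 2] by simp
  finally show ?thesis using assms chi_eq_0_iff [of 2] not_p_dvd_2 by simp
qed

text \<open>
  If \<open>c\<close> is not rational modulo \<open>p\<close>, then \<open>Re b\<close> and \<open>Re (b * c)\<close> are independent linear forms
  and the sum factors into two vanishing ones.
\<close>

lemma inner_sum:
  "(\<Sum>b\<in>gres. chi (gre b) * chi (gre (b * c))) =
     (if int p dvd gim c then chi (gre c) * (int p * (int p - 1)) else 0)"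
proof (cases "int p dvd gim c")
  case True
  have "chi (gre (b * c)) = chi (gre b) * chi (gre c)" for b
  proof -
    have "[gre (b * c) = gre b * gre c] (mod int p)"
      using True by (simp add: cong_iff_dvd_diff)
    from chi_cong [OF this] show ?thesis by (simp add: chi_mult)
  qed
  then have "chi (gre b) * chi (gre (b * c)) = (if int p dvd gre b then 0 else chi (gre c))" for b
    using chi_mult_self [of "gre b"] by (simp flip: mult.assoc)
  then have "(\<Sum>b\<in>gres. chi (gre b) * chi (gre (b * c)))
     = (\<Sum>x\<in>Fp. \<Sum>y\<in>Fp. if int p dvd x then 0 else chi (gre c))"
    by (simp add: sum_gres)
  also have "\<dots> = (\<Sum>y\<in>Fp. (int p - 1) * chi (gre c))"
    by (subst sum.swap) (simp only: sum_Fp_indicator)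
  finally show ?thesis using True by simp
next
  case False
  have "(\<Sum>y\<in>Fp. chi (gre (Gauss x y * c))) = 0" for x
    using sum_chi_affine [of "- gim c" "x * gre c"] False by (simp add: algebra_simps)
  then show ?thesis using False by (simp add: sum_gres flip: sum_distrib_left)
qed

section \<open>The second moment\<close>

text \<open>
  The units \<open>d\<close> with \<open>d ^ 4\<close> rational modulo \<open>p\<close>: those on the two axes and the two diagonals.
\<close>

definition real_fourth :: "gauss set" where
  "real_fourth = {d \<in> gunits. int p dvd gim (d ^ 4)}"

lemma real_fourth_subset: "real_fourth \<subseteq> gunits" by (auto simp: real_fourth_def)

lemma gim_power4_cases:
  assumes "int p dvd gim (d ^ 4)"
  shows "int p dvd gre d \<or> int p dvd gim d \<or> int p dvd gre d - gim d \<or> int p dvd gre d + gim d"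
  using assms not_p_dvd_4 unfolding gim_power4 p_dvd_mult_iff by blast

text \<open>
  The imaginary part of \<open>(x + i y) ^ 4\<close> is \<open>4 x y (x - y) (x + y)\<close>, so the set consists of four
  lines without their origin, and these meet only there because \<open>p\<close> is odd.
\<close>

lemma card_real_fourth: "int (card real_fourth) = 4 * (int p - 1)"
proof -
  define T where "T = {1..<int p}"
  define A\<^sub>1 A\<^sub>2 A\<^sub>3 A\<^sub>4 where
    "A\<^sub>1 = (\<lambda>t. Gauss t 0) ` T" and "A\<^sub>2 = (\<lambda>t. Gauss 0 t) ` T" and
    "A\<^sub>3 = (\<lambda>t. Gauss t t) ` T" and "A\<^sub>4 = (\<lambda>t. Gauss t (int p - t)) ` T"
  have T: "t \<in> T \<longleftrightarrow> t \<in> Fp \<and> \<not> int p dvd t" for t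
    using p_dvd_residue_iff [of t] by (auto simp: T_def Fp_def)
  have neg: "int p - t \<in> T" if "t \<in> T" for t using that by (auto simp: T_def)
  have "d \<in> real_fourth \<longleftrightarrow> d \<in> A\<^sub>1 \<union> A\<^sub>2 \<union> A\<^sub>3 \<union> A\<^sub>4" for d
  proof -
    obtain x y where d: "d = Gauss x y" by (cases d)
    show ?thesis
    proof
      assume "d \<in> real_fourth"
      then have xy: "x \<in> Fp" "y \<in> Fp" and n: "\<not> int p dvd x\<^sup>2 + y\<^sup>2"
        and four: "int p dvd gim (d ^ 4)"
        by (auto simp: real_fourth_def gunits_def gres_iff gnorm_def d)
      from gim_power4_cases [OF four]
      consider "int p dvd x" | "int p dvd y" | "int p dvd x - y" | "int p dvd x + y"
        by (auto simp: d)
      then show "d \<in> A\<^sub>1 \<union> A\<^sub>2 \<union> A\<^sub>3 \<union> A\<^sub>4"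
      proof cases
        case 1
        with xy have "x = 0" by (simp add: p_dvd_residue_iff)
        with n xy have "y \<in> T" by (auto simp: T p_dvd_power_iff)
        with \<open>x = 0\<close> show ?thesis by (auto simp: A\<^sub>2_def d)
      next
        case 2
        with xy have "y = 0" by (simp add: p_dvd_residue_iff)
        with n xy have "x \<in> T" by (auto simp: T p_dvd_power_iff)
        with \<open>y = 0\<close> show ?thesis by (auto simp: A\<^sub>1_def d)
      next
        case 3
        with xy have "x = y" by (simp add: Fp_cong_imp_eq cong_iff_dvd_diff)
        with n xy have "x \<in> T" by (auto simp: T p_dvd_power_iff)
        with \<open>x = y\<close> show ?thesis by (auto simp: A\<^sub>3_def d)
      next
        case 4
        have "\<not> int p dvd x"
        proof
          assume "int p dvd x"
          with 4 have "int p dvd y" by (simp add: dvd_add_right_iff)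
          with n \<open>int p dvd x\<close> show False by (simp add: p_dvd_power_iff dvd_add)
        qed
        with xy have x: "x \<in> T" by (simp add: T)
        have "[y = int p - x] (mod int p)"
          using 4 by (simp add: cong_iff_dvd_diff algebra_simps)
        then have "y = int p - x" using neg [OF x] xy T Fp_cong_imp_eq by blast
        with x show ?thesis by (auto simp: A\<^sub>4_def d)
      qed
    next
      assume "d \<in> A\<^sub>1 \<union> A\<^sub>2 \<union> A\<^sub>3 \<union> A\<^sub>4"
      then show "d \<in> real_fourth"
      proof (elim UnE)
        assume "d \<in> A\<^sub>1"
        then show ?thesis
          by (auto simp: A\<^sub>1_def T real_fourth_def gunits_def gres_iff gnorm_def gim_power4 p_dvd_power_iff)
      next
        assume "d \<in> A\<^sub>2"
        then show ?thesis
          by (auto simp: A\<^sub>2_def T real_fourth_def gunits_def gres_iff gnorm_def gim_power4 p_dvd_power_iff)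
      next
        assume "d \<in> A\<^sub>3"
        then obtain t where t: "t \<in> T" "d = Gauss t t" by (auto simp: A\<^sub>3_def)
        have "gnorm d = 2 * t\<^sup>2" by (simp add: t gnorm_def)
        then have "\<not> int p dvd gnorm d" using t T not_p_dvd_2 by (simp add: p_dvd_mult_iff p_dvd_power_iff)
        then show ?thesis using t by (simp add: T real_fourth_def gunits_def gres_iff gim_power4)
      next
        assume "d \<in> A\<^sub>4"
        then obtain t where t: "t \<in> T" "d = Gauss t (int p - t)" by (auto simp: A\<^sub>4_def)
        have "gnorm d = 2 * t\<^sup>2 + int p * (int p - 2 * t)"
          by (simp add: t gnorm_def power2_eq_square algebra_simps)
        moreover have "\<not> int p dvd 2 * t\<^sup>2" using t T not_p_dvd_2 by (simp add: p_dvd_mult_iff p_dvd_power_iff)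
        ultimately have "\<not> int p dvd gnorm d" by (simp add: dvd_add_left_iff)
        then show ?thesis using t neg [OF t(1)] T
          by (simp add: real_fourth_def gunits_def gres_iff gim_power4)
      qed
    qed
  qed
  then have "real_fourth = A\<^sub>1 \<union> (A\<^sub>2 \<union> (A\<^sub>3 \<union> A\<^sub>4))" by blast
  moreover have "A\<^sub>1 \<inter> (A\<^sub>2 \<union> (A\<^sub>3 \<union> A\<^sub>4)) = {}" "A\<^sub>2 \<inter> (A\<^sub>3 \<union> A\<^sub>4) = {}"
    by (auto simp: A\<^sub>1_def A\<^sub>2_def A\<^sub>3_def A\<^sub>4_def T_def)
  moreover have "A\<^sub>3 \<inter> A\<^sub>4 = {}"
  proof -
    have "t \<noteq> int p - t" for t
      using odd_p prime prime_odd_nat [OF prime] by presburger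
    then show ?thesis by (auto simp: A\<^sub>3_def A\<^sub>4_def)
  qed
  moreover have "finite A\<^sub>1" "finite A\<^sub>2" "finite A\<^sub>3" "finite A\<^sub>4"
    by (simp_all add: A\<^sub>1_def A\<^sub>2_def A\<^sub>3_def A\<^sub>4_def T_def)
  moreover have "card A\<^sub>1 = p - 1" "card A\<^sub>2 = p - 1" "card A\<^sub>3 = p - 1" "card A\<^sub>4 = p - 1"
    unfolding A\<^sub>1_def A\<^sub>2_def A\<^sub>3_def A\<^sub>4_def
    by (subst card_image; auto simp: inj_on_def T_def)+
  ultimately have "card real_fourth = 4 * (p - 1)"
    by (simp add: card_Un_disjoint)
  then show ?thesis using odd_p by (simp add: of_nat_diff)
qed

text \<open>
  On an axis both factors are characters of squares. On a diagonal the norm is \<open>2 y\<^sup>2\<close> and the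
  fourth power is \<open>-4 y ^ 4\<close>, with product \<open>-2\<close> times a square; this is where \<open>\<chi>(-2)\<close> enters.
\<close>

lemma real_fourth_weight:
  assumes "chi (- 2) = 1" and "d \<in> real_fourth"
  shows "chi (gnorm d) * chi (gre (d ^ 4)) = 1"
proof -
  define x y where "x = gre d" and "y = gim d"
  have n: "\<not> int p dvd x\<^sup>2 + y\<^sup>2" and four: "int p dvd gim (d ^ 4)"
    using assms(2) by (auto simp: real_fourth_def gunits_def gnorm_def x_def y_def)
  have P: "gre (d ^ 4) = x ^ 4 - 6 * x\<^sup>2 * y\<^sup>2 + y ^ 4" and N: "gnorm d = x\<^sup>2 + y\<^sup>2"
    by (simp_all add: gre_power4 gnorm_def x_def y_def)
  from gim_power4_cases [OF four]
  consider "int p dvd x" | "int p dvd y" | "int p dvd x\<^sup>2 - y\<^sup>2"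
    by (auto simp: x_def y_def power2_eq_square square_diff_square_factored p_dvd_mult_iff)
  then show ?thesis
  proof cases
    case 1
    then have *: "\<not> int p dvd y" using n by (auto simp: p_dvd_power_iff)
    from 1 have c: "[gnorm d = y\<^sup>2] (mod int p)" "[gre (d ^ 4) = y ^ 4] (mod int p)"
      unfolding P N by (auto simp: cong_iff_dvd_diff p_dvd_power_iff p_dvd_mult_iff intro!: dvd_diff)
    show ?thesis
      by (simp only: chi_cong [OF c(1)] chi_cong [OF c(2)] chi_square [OF *] chi_power4 [OF *] mult_1_left)
  next
    case 2
    then have *: "\<not> int p dvd x" using n by (auto simp: p_dvd_power_iff)
    from 2 have c: "[gnorm d = x\<^sup>2] (mod int p)" "[gre (d ^ 4) = x ^ 4] (mod int p)"
      unfolding P N by (auto simp: cong_iff_dvd_diff p_dvd_power_iff p_dvd_mult_iff)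
    show ?thesis
      by (simp only: chi_cong [OF c(1)] chi_cong [OF c(2)] chi_square [OF *] chi_power4 [OF *] mult_1_left)
  next
    case 3
    have "x\<^sup>2 + y\<^sup>2 - 2 * y\<^sup>2 = x\<^sup>2 - y\<^sup>2"
      "x ^ 4 - 6 * x\<^sup>2 * y\<^sup>2 + y ^ 4 - (- 4) * y ^ 4 = (x\<^sup>2 - y\<^sup>2) * (x\<^sup>2 - 5 * y\<^sup>2)"
      by (simp_all add: power2_eq_square power4_eq_xxxx algebra_simps)
    with 3 have c: "[gnorm d = 2 * y\<^sup>2] (mod int p)" "[gre (d ^ 4) = (- 4) * y ^ 4] (mod int p)"
      unfolding P N by (auto simp: cong_iff_dvd_diff simp del: mult_minus_left)
    have "\<not> int p dvd y"
      using n c(1) unfolding N by (auto simp: cong_dvd_iff p_dvd_power_iff)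
    then have y: "\<not> int p dvd 2 * y ^ 3" using not_p_dvd_2 by (simp add: p_dvd_mult_iff p_dvd_power_iff)
    have "chi (gnorm d) * chi (gre (d ^ 4)) = chi ((2 * y\<^sup>2) * ((- 4) * y ^ 4))"
      by (simp only: chi_cong [OF c(1)] chi_cong [OF c(2)] chi_mult [symmetric])
    also have "(2 * y\<^sup>2) * ((- 4) * y ^ 4) = (- 2) * (2 * y ^ 3)\<^sup>2" by (simp add: eval_nat_numeral)
    also have "chi \<dots> = 1" using assms(1) chi_square [OF y] by (simp only: chi_mult)
    finally show ?thesis .
  qed
qed

text \<open>
  Expand the square into a double sum over \<open>a\<close> and \<open>c\<close>. For a unit \<open>a\<close>, replacing \<open>c\<close> by \<open>a * c\<close>
  and then \<open>b * a ^ 4\<close> by \<open>b\<close> makes the inner sum independent of \<open>a\<close>; by \<open>inner_sum\<close> only those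
  \<open>c\<close> with rational fourth power contribute, each with weight 1.
\<close>

lemma second_moment:
  assumes "chi (- 2) = 1"
  shows "(\<Sum>b\<in>gres. (octic_sum b)\<^sup>2) = int (card gunits) * (4 * (int p - 1) * (int p * (int p - 1)))"
proof -
  define F where "F b a c = chi (gnorm a) * chi (gre (b * a ^ 4)) * (chi (gnorm c) * chi (gre (b * c ^ 4)))" for b a c
  have Fcong: "F b a c = F b a c'" if "gcong c c'" for a b c c'
    unfolding F_def octic_summand_cong [OF that] by (rule refl)
  have unit: "(\<Sum>b\<in>gres. \<Sum>c\<in>gres. F b a c) = 4 * (int p - 1) * (int p * (int p - 1))"
    if a: "\<not> int p dvd gnorm a" for a
  proof -
    have a4: "\<not> int p dvd gnorm (a ^ 4)" using a by (simp add: gnorm_power p_dvd_power_iff)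
    define h where "h c b = chi (gre b) * chi (gre (b * c ^ 4))" for b c
    have h: "F b a (a * c) = chi (gnorm c) * h c (a ^ 4 * b)" for b c
    proof -
      have e: "b * (a * c) ^ 4 = a ^ 4 * b * c ^ 4" "b * a ^ 4 = a ^ 4 * b"
        by (simp_all add: power_mult_distrib mult_ac)
      have "F b a (a * c) = (chi (gnorm a) * chi (gnorm a)) * (chi (gnorm c) * h c (a ^ 4 * b))"
        unfolding F_def h_def e gnorm_mult chi_mult by (simp only: mult_ac)
      then show ?thesis using a by (simp add: chi_mult_self)
    qed
    have hcong: "h c b = h c b'" if "gcong b b'" for b b' c
      using that unfolding h_def
      by (intro arg_cong2 [of _ _ _ _ "(*)"] chi_cong gcong_gre gcong_mult gcong_refl)
    have "(\<Sum>b\<in>gres. \<Sum>c\<in>gres. F b a c) = (\<Sum>b\<in>gres. \<Sum>c\<in>gres. F b a (a * c))"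
      by (intro sum.cong refl sum_gres_mult [symmetric] Fcong a)
    also have "\<dots> = (\<Sum>c\<in>gres. chi (gnorm c) * (\<Sum>b\<in>gres. h c (a ^ 4 * b)))"
      unfolding h by (subst sum.swap) (simp only: sum_distrib_left)
    also have "\<dots> = (\<Sum>c\<in>gres. chi (gnorm c) * (\<Sum>b\<in>gres. h c b))"
      by (intro sum.cong refl arg_cong2 [of _ _ _ _ "(*)"] sum_gres_mult hcong a4)
    also have "\<dots> = (\<Sum>c\<in>gres. if c \<in> real_fourth then int p * (int p - 1) else 0)"
    proof (intro sum.cong refl)
      fix c assume c: "c \<in> gres"
      show "chi (gnorm c) * (\<Sum>b\<in>gres. h c b) = (if c \<in> real_fourth then int p * (int p - 1) else 0)"
      proof (cases "c \<in> real_fourth")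
        case True
        then have "int p dvd gim (c ^ 4)" by (simp add: real_fourth_def)
        then have "chi (gnorm c) * (\<Sum>b\<in>gres. h c b)
            = (chi (gnorm c) * chi (gre (c ^ 4))) * (int p * (int p - 1))"
          unfolding h_def inner_sum by simp
        with True show ?thesis by (simp add: real_fourth_weight [OF assms])
      next
        case False
        then have "int p dvd gnorm c \<or> \<not> int p dvd gim (c ^ 4)"
          using c by (auto simp: real_fourth_def gunits_def)
        then have "chi (gnorm c) * (\<Sum>b\<in>gres. h c b) = 0"
          unfolding h_def inner_sum using chi_eq_0_iff [of "gnorm c"] by auto
        with False show ?thesis by simp
      qed
    qed
    also have "\<dots> = (\<Sum>c\<in>real_fourth. int p * (int p - 1))"
      by (rule sum.mono_neutral_cong_right) (use real_fourth_subset in \<open>auto simp: gunits_def\<close>)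
    also have "\<dots> = int (card real_fourth) * (int p * (int p - 1))" by simp
    finally show ?thesis by (simp only: card_real_fourth)
  qed
  have "(\<Sum>b\<in>gres. (octic_sum b)\<^sup>2) = (\<Sum>b\<in>gres. \<Sum>a\<in>gres. \<Sum>c\<in>gres. F b a c)"
    unfolding octic_sum_def power2_eq_square sum_product F_def by (rule refl)
  also have "\<dots> = (\<Sum>a\<in>gres. \<Sum>b\<in>gres. \<Sum>c\<in>gres. F b a c)"
    by (rule sum.swap)
  also have "\<dots> = (\<Sum>a\<in>gunits. \<Sum>b\<in>gres. \<Sum>c\<in>gres. F b a c)"
  proof (rule sum.mono_neutral_right)
    show "\<forall>a\<in>gres - gunits. (\<Sum>b\<in>gres. \<Sum>c\<in>gres. F b a c) = 0"
    proof
      fix a assume "a \<in> gres - gunits"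
      then have "chi (gnorm a) = 0" by (simp add: gunits_def chi_eq_0_iff)
      then show "(\<Sum>b\<in>gres. \<Sum>c\<in>gres. F b a c) = 0" by (simp add: F_def)
    qed
  qed (auto simp: gunits_def)
  also have "\<dots> = (\<Sum>a\<in>gunits. 4 * (int p - 1) * (int p * (int p - 1)))"
    by (intro sum.cong refl unit) (simp add: gunits_def)
  finally show ?thesis by simp
qed

section \<open>Classes modulo rational multiples of fourth powers\<close>

text \<open>
  If \<open>b\<close> is a nonzero zero divisor modulo \<open>p\<close>, then \<open>b * c = b\<close> modulo \<open>p\<close> for every
  \<open>c = 1 + t * gcnj b\<close>. Choosing \<open>t\<close> such that \<open>c\<close> has nonresidue norm, one finds
  \<open>K b = K (c ^ 4 * b) = - K b\<close>.
\<close>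

lemma octic_sum_nonunit:
  assumes "int p dvd gnorm b"
  shows "octic_sum b = 0"
proof (cases "int p dvd gre b")
  case True
  have "int p dvd (gim b)\<^sup>2"
    using assms True by (simp add: gnorm_def p_dvd_power_iff dvd_add_right_iff)
  with True have "gcong b 0" by (simp add: gcong_iff cong_0_iff p_dvd_power_iff)
  then have "octic_sum b = octic_sum 0" by (rule octic_sum_cong)
  also have "octic_sum 0 = 0" using chi_eq_0_iff [of 0] by (simp add: octic_sum_def)
  finally show ?thesis .
next
  case False
  obtain m where m: "chi m = - 1" using exists_nonresidue by blast
  then have "\<not> int p dvd m" using chi_eq_0_iff [of m] by auto
  have "\<not> int p dvd 2 * gre b" using False not_p_dvd_2 by (simp add: p_dvd_mult_iff)
  then have "coprime (2 * gre b) (int p)"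
    using prime_imp_coprime [OF prime_int_p] coprime_commute by blast
  then obtain v where v: "[2 * gre b * v = 1] (mod int p)"
    using cong_solve_coprime_int by blast
  define t where "t = v * (m - 1)"
  define c where "c = 1 + of_int t * gcnj b"
  have "gnorm c = 1 + 2 * gre b * v * (m - 1) + t\<^sup>2 * gnorm b"
    by (simp add: c_def t_def gnorm_def power2_eq_square algebra_simps)
  moreover have "[1 + 2 * gre b * v * (m - 1) + t\<^sup>2 * gnorm b = 1 + 1 * (m - 1) + t\<^sup>2 * 0] (mod int p)"
    using assms by (intro cong_add cong_mult cong_refl v) (simp add: cong_0_iff)
  ultimately have norm: "[gnorm c = m] (mod int p)" by simp
  then have "\<not> int p dvd gnorm c" using \<open>\<not> int p dvd m\<close> cong_dvd_iff by blast
  have "b * c = b + of_int t * (b * gcnj b)"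
    by (simp add: c_def algebra_simps)
  also have "\<dots> = b + of_int (t * gnorm b)" by (simp add: mult_gcnj)
  finally have "b * c - b = of_int (t * gnorm b)" by simp
  then have bc: "gcong (b * c) b"
    unfolding gcong_def using assms
    by (simp only: of_int_dvd_gauss_iff gauss_of_int dvd_mult dvd_0_right)
  have "gcong (b * c ^ n) b" for n
  proof (induction n)
    case (Suc n)
    have "gcong (b * c ^ n * c) (b * c)" using Suc by (rule gcong_mult) simp
    from gcong_trans [OF this bc] show ?case by (simp add: mult_ac)
  qed simp
  from octic_sum_cong [OF this [of 4]] have "octic_sum b = octic_sum (c ^ 4 * b)" by (simp add: mult.commute)
  also have "\<dots> = - octic_sum b"
    using octic_sum_power4_mult [OF \<open>\<not> int p dvd gnorm c\<close>] chi_cong [OF norm] m by simp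
  finally show ?thesis by simp
qed

text \<open>
  Suppose that \<open>g\<^sup>2\<close> were a rational multiple of a fourth power. Then \<open>e\<^sup>2\<close> is rational for a
  suitable \<open>e = g * square\<close>, so \<open>e\<close> lies on an axis and has square norm, but
  \<open>\<chi> (N e) = \<chi> (N g) = -1\<close>.
\<close>

lemma fourth_power_class_aux:
  assumes g: "chi (gnorm g) = - 1"
    and b: "\<not> int p dvd gnorm b" and b': "\<not> int p dvd gnorm b'" and c: "\<not> int p dvd c"
  shows "\<not> gcong (g\<^sup>2 * (of_int c * b ^ 4)) (of_int c' * b' ^ 4)"
proof
  assume *: "gcong (g\<^sup>2 * (of_int c * b ^ 4)) (of_int c' * b' ^ 4)"
  define e where "e = g * b\<^sup>2 * (gcnj b')\<^sup>2"
  have "gcong (g\<^sup>2 * (of_int c * b ^ 4) * gcnj b' ^ 4) (of_int c' * b' ^ 4 * gcnj b' ^ 4)"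
    by (rule gcong_mult [OF * gcong_refl])
  moreover have "g\<^sup>2 * (of_int c * b ^ 4) * gcnj b' ^ 4 = of_int c * e\<^sup>2"
    by (simp add: e_def power2_eq_square power4_eq_xxxx mult_ac)
  moreover have "of_int c' * b' ^ 4 * gcnj b' ^ 4 = of_int (c' * gnorm b' ^ 4)"
    by (simp add: mult.assoc mult_gcnj flip: power_mult_distrib)
  ultimately have "gcong (of_int c * e\<^sup>2) (of_int (c' * gnorm b' ^ 4))" by simp
  then have "[gim (of_int c * e\<^sup>2) = gim (of_int (c' * gnorm b' ^ 4))] (mod int p)"
    unfolding gcong_iff by blast
  then have "int p dvd c * (2 * (gre e * gim e))"
    by (simp add: cong_0_iff power2_eq_square mult_ac del: of_int_mult of_int_power)
  then have "int p dvd gre e \<or> int p dvd gim e"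
    using c not_p_dvd_2 by (simp add: p_dvd_mult_iff)
  moreover have ne: "chi (gnorm e) = - 1"
    using g b b' by (simp add: e_def gnorm_mult gnorm_power gnorm_gcnj chi_mult chi_square)
  ultimately show False
  proof (elim disjE)
    assume "int p dvd gre e"
    then have c: "[gnorm e = (gim e)\<^sup>2] (mod int p)"
      by (simp add: gnorm_def cong_iff_dvd_diff p_dvd_power_iff)
    show False using ne chi_eq_0_iff [of "gim e"] chi_range [of "gim e"]
      by (auto simp: chi_cong [OF c] power2_eq_square chi_mult)
  next
    assume "int p dvd gim e"
    then have c: "[gnorm e = (gre e)\<^sup>2] (mod int p)"
      by (simp add: gnorm_def cong_iff_dvd_diff p_dvd_power_iff)
    show False using ne chi_eq_0_iff [of "gre e"] chi_range [of "gre e"]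
      by (auto simp: chi_cong [OF c] power2_eq_square chi_mult)
  qed
qed

text \<open>
  The norm determines the parity of the exponent, and \<open>fourth_power_class_aux\<close> rules out the
  difference 2. So \<open>1, g, g\<^sup>2, g\<^sup>3\<close> lie in different classes.
\<close>

lemma fourth_power_class_unique:
  assumes g: "chi (gnorm g) = - 1"
    and b: "\<not> int p dvd gnorm b" and b': "\<not> int p dvd gnorm b'"
    and c: "\<not> int p dvd c" and c': "\<not> int p dvd c'" and e: "e < 4" and e': "e' < 4"
    and eq: "gcong (g ^ e * (of_int c * b ^ 4)) (g ^ e' * (of_int c' * b' ^ 4))"
  shows "e = e'"
proof -
  have gn: "\<not> int p dvd gnorm (g ^ k)" for k
    using g chi_eq_0_iff [of "gnorm g"] by (auto simp: gnorm_power p_dvd_power_iff)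
  have pow: "chi (x ^ k) = chi x ^ k" for x k by (induction k) (simp_all add: chi_mult)
  have "chi (gnorm (g ^ e * (of_int c * b ^ 4))) = (- 1) ^ e"
    "chi (gnorm (g ^ e' * (of_int c' * b' ^ 4))) = (- 1) ^ e'"
    using b b' c c' g by (simp_all add: gnorm_mult gnorm_power gnorm_of_int chi_mult chi_square chi_power4 pow [of "gnorm g"])
  with chi_cong [OF gcong_gnorm [OF eq]] have "(- 1 :: int) ^ e = (- 1) ^ e'" by simp
  then have par: "even e \<longleftrightarrow> even e'" by (cases "even e"; cases "even e'") auto
  have "e \<noteq> e' + 2"
  proof
    assume "e = e' + 2"
    then have "gcong (g ^ e' * (g\<^sup>2 * (of_int c * b ^ 4))) (g ^ e' * (of_int c' * b' ^ 4))"
      using eq by (simp add: power2_eq_square mult_ac)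
    from gcong_cancel [OF this gn] show False
      using fourth_power_class_aux [OF g b b' c] by blast
  qed
  moreover have "e' \<noteq> e + 2"
  proof
    assume "e' = e + 2"
    then have "gcong (g ^ e * (g\<^sup>2 * (of_int c' * b' ^ 4))) (g ^ e * (of_int c * b ^ 4))"
      using gcong_sym [OF eq] by (simp add: power2_eq_square mult_ac)
    from gcong_cancel [OF this gn] show False
      using fourth_power_class_aux [OF g b' b c'] by blast
  qed
  ultimately show ?thesis using e e' par by presburger
qed

lemma gmod_unit: "\<not> int p dvd gnorm a \<Longrightarrow> gmod a \<in> gunits"
  using cong_dvd_iff [OF gcong_gnorm [OF gcong_gmod [of a]]] by (simp add: gunits_def)

text \<open>
  Two triples with the same value have the same exponent \<open>e\<close>, and then the quotient of their
  third components has a rational fourth power and determines the second component. To avoid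
  inverses, the quotient by \<open>b\<^sub>0\<close> is replaced by the product with its conjugate.
\<close>

lemma fourth_power_fibre:
  assumes g: "chi (gnorm g) = - 1"
  defines "\<Omega> \<equiv> {..<4::nat} \<times> {1..<int p} \<times> gunits"
    and "\<phi> \<equiv> \<lambda>(e, c, b). gmod (g ^ e * (of_int c * b ^ 4))"
  shows "card {w \<in> \<Omega>. \<phi> w = a} \<le> card real_fourth"
proof (cases "{w \<in> \<Omega>. \<phi> w = a} = {}")
  case False
  then obtain e\<^sub>0 c\<^sub>0 b\<^sub>0 where w0: "e\<^sub>0 < 4" "c\<^sub>0 \<in> {1..<int p}" "b\<^sub>0 \<in> gunits"
      "gmod (g ^ e\<^sub>0 * (of_int c\<^sub>0 * b\<^sub>0 ^ 4)) = a"
    by (auto simp: \<Omega>_def \<phi>_def)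
  have U: "\<not> int p dvd gnorm b" if "b \<in> gunits" for b using that by (simp add: gunits_def)
  have gn: "\<not> int p dvd gnorm (g ^ k)" for k
    using g chi_eq_0_iff [of "gnorm g"] by (auto simp: gnorm_power p_dvd_power_iff)
  define \<psi> where "\<psi> = (\<lambda>(e :: nat, c :: int, b). gmod (gcnj b\<^sub>0 * b))"
  have gmod_eq: "gcong x y" if "gmod x = gmod y" for x y
    using gcong_trans [OF gcong_sym [OF gcong_gmod [of x]]] that gcong_gmod [of y] by simp
  have fib: "e = e\<^sub>0 \<and> gcong (of_int c * b ^ 4) (of_int c\<^sub>0 * b\<^sub>0 ^ 4) \<and> c \<in> {1..<int p} \<and> b \<in> gunits"
    if "(e, c, b) \<in> {w \<in> \<Omega>. \<phi> w = a}" for e c b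
  proof -
    from that have w: "e < 4" "c \<in> {1..<int p}" "b \<in> gunits" 
      and "gmod (g ^ e * (of_int c * b ^ 4)) = a"
      by (auto simp: \<Omega>_def \<phi>_def)
    then have eq: "gcong (g ^ e * (of_int c * b ^ 4)) (g ^ e\<^sub>0 * (of_int c\<^sub>0 * b\<^sub>0 ^ 4))"
      using w0 by (intro gmod_eq) simp
    have "e = e\<^sub>0"
      by (rule fourth_power_class_unique [OF g U U not_p_dvd_less not_p_dvd_less _ _ eq]) (use w w0 in auto)
    with eq gcong_cancel [OF _ gn] w show ?thesis by blast
  qed
  have "inj_on \<psi> {w \<in> \<Omega>. \<phi> w = a}"
  proof (rule inj_onI)
    fix w w' assume W: "w \<in> {w \<in> \<Omega>. \<phi> w = a}" "w' \<in> {w \<in> \<Omega>. \<phi> w = a}" and eq: "\<psi> w = \<psi> w'"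
    obtain e c b e' c' b' where w: "w = (e, c, b)" "w' = (e', c', b')" by (metis prod_cases3)
    have f: "e = e\<^sub>0" "gcong (of_int c * b ^ 4) (of_int c\<^sub>0 * b\<^sub>0 ^ 4)" "c \<in> {1..<int p}" "b \<in> gunits"
      using fib [of e c b] W w by auto
    have f': "e' = e\<^sub>0" "gcong (of_int c' * b' ^ 4) (of_int c\<^sub>0 * b\<^sub>0 ^ 4)" "c' \<in> {1..<int p}" "b' \<in> gunits"
      using fib [of e' c' b'] W w by auto
    have "gcong (gcnj b\<^sub>0 * b) (gcnj b\<^sub>0 * b')" using eq by (intro gmod_eq) (simp add: \<psi>_def w)
    then have "gcong b b'" by (rule gcong_cancel) (simp add: gnorm_gcnj U w0)
    then have "b = b'" using f f' gres_gcong_eq by (auto simp: gunits_def)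
    have "gcong (b ^ 4 * of_int c) (b ^ 4 * of_int c')"
      using gcong_trans [OF f(2) gcong_sym [OF f'(2)]] \<open>b = b'\<close> by (simp add: mult.commute)
    then have "gcong (of_int c) (of_int c')"
      by (rule gcong_cancel) (use U [OF f(4)] in \<open>simp add: gnorm_power p_dvd_power_iff\<close>)
    then have "[c = c'] (mod int p)" by (simp add: gcong_iff)
    then have "c = c'" using f f' by (intro Fp_cong_imp_eq) (auto simp: Fp_def)
    then show "w = w'" using w f f' \<open>b = b'\<close> by simp
  qed
  moreover have "\<psi> ` {w \<in> \<Omega>. \<phi> w = a} \<subseteq> real_fourth"
  proof
    fix d assume "d \<in> \<psi> ` {w \<in> \<Omega>. \<phi> w = a}"
    then obtain e c b where W: "(e, c, b) \<in> {w \<in> \<Omega>. \<phi> w = a}" and d: "d = gmod (gcnj b\<^sub>0 * b)"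
      by (auto simp: \<psi>_def)
    from fib [OF W] have f: "gcong (of_int c * b ^ 4) (of_int c\<^sub>0 * b\<^sub>0 ^ 4)" "c \<in> {1..<int p}" "b \<in> gunits"
      by auto
    have du: "d \<in> gunits"
      unfolding d by (rule gmod_unit) (simp add: gnorm_mult gnorm_gcnj p_dvd_mult_iff U f w0)
    have "gcong (of_int c * d ^ 4) (of_int c * (gcnj b\<^sub>0 * b) ^ 4)"
      unfolding d by (intro gcong_mult gcong_power gcong_refl gcong_gmod)
    moreover have "of_int c * (gcnj b\<^sub>0 * b) ^ 4 = of_int c * b ^ 4 * gcnj b\<^sub>0 ^ 4"
      by (simp add: power_mult_distrib mult_ac)
    moreover have "gcong (of_int c * b ^ 4 * gcnj b\<^sub>0 ^ 4) (of_int c\<^sub>0 * b\<^sub>0 ^ 4 * gcnj b\<^sub>0 ^ 4)"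
      by (intro gcong_mult f gcong_refl)
    moreover have "of_int c\<^sub>0 * b\<^sub>0 ^ 4 * gcnj b\<^sub>0 ^ 4 = of_int (c\<^sub>0 * gnorm b\<^sub>0 ^ 4)"
      by (simp add: mult.assoc mult_gcnj flip: power_mult_distrib)
    ultimately have "gcong (of_int c * d ^ 4) (of_int (c\<^sub>0 * gnorm b\<^sub>0 ^ 4))"
      using gcong_trans by metis
    then have "[gim (of_int c * d ^ 4) = gim (of_int (c\<^sub>0 * gnorm b\<^sub>0 ^ 4))] (mod int p)"
      unfolding gcong_iff by blast
    then have "int p dvd c * gim (d ^ 4)" by (simp add: cong_0_iff del: of_int_mult of_int_power)
    then have "int p dvd gim (d ^ 4)" using not_p_dvd_less [OF f(2)] by (simp add: p_dvd_mult_iff)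
    with du show "d \<in> real_fourth" by (simp add: real_fourth_def)
  qed
  moreover have "finite real_fourth" using real_fourth_subset by (rule finite_subset) simp
  ultimately show ?thesis by (rule card_inj_on_le)
qed (simp only: card.empty le0)

text \<open>
  The map \<open>(e, c, b) \<mapsto> g ^ e * c * b ^ 4\<close> goes from a set of \<open>4 (p - 1)\<close> times as many elements as
  there are units to the units, and its fibres have at most \<open>4 (p - 1)\<close> elements by
  \<open>fourth_power_fibre\<close>; hence all fibres have exactly that size and the four classes exhaust
  the units. Summing \<open>K\<^sup>2\<close> over the domain therefore gives \<open>4 (p - 1)\<close> times the second moment.
  Conjugation exchanges the classes of \<open>g\<close> and \<open>g\<^sup>3\<close> and fixes that of \<open>g\<^sup>2\<close>, with a change of
  sign there.
\<close>

lemma octic_sum_class_sum: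
  assumes two: "chi (- 2) = 1" and g: "chi (gnorm g) = - 1"
  shows "(octic_sum 1)\<^sup>2 + 2 * (octic_sum g)\<^sup>2 = 16 * int p * (int p - 1)\<^sup>2"
proof -
  define \<Omega> where "\<Omega> = {..<4::nat} \<times> {1..<int p} \<times> gunits"
  define \<phi> where "\<phi> = (\<lambda>(e, c, b). gmod (g ^ e * (of_int c * b ^ 4)))"
  define \<kappa> where "\<kappa> b = (octic_sum b)\<^sup>2" for b
  have U: "\<not> int p dvd gnorm b" if "b \<in> gunits" for b using that by (simp add: gunits_def)
  have gn1: "\<not> int p dvd gnorm g"
    using g chi_eq_0_iff [of "gnorm g"] by auto
  have fin: "finite \<Omega>" by (simp add: \<Omega>_def)
  have card\<Omega>: "card \<Omega> = card real_fourth * card gunits"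
  proof -
    have "int (card \<Omega>) = 4 * (int p - 1) * int (card gunits)"
      using odd_p by (simp add: \<Omega>_def card_cartesian_product of_nat_diff)
    also have "\<dots> = int (card real_fourth * card gunits)"
      by (simp add: card_real_fourth)
    finally show ?thesis by (simp only: of_nat_eq_iff)
  qed
  have im: "\<phi> ` \<Omega> \<subseteq> gunits"
  proof
    fix a assume "a \<in> \<phi> ` \<Omega>"
    then obtain e c b where w: "c \<in> {1..<int p}" "b \<in> gunits" "a = gmod (g ^ e * (of_int c * b ^ 4))"
      by (auto simp: \<Omega>_def \<phi>_def)
    show "a \<in> gunits" unfolding w(3)
      by (rule gmod_unit)
         (simp only: gnorm_mult p_dvd_mult_iff gn1 gnorm_power p_dvd_power_iff gnorm_of_int not_p_dvd_less [OF w(1)] U [OF w(2)], simp)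
  qed
  have sq: "(chi x)\<^sup>2 = 1" if "\<not> int p dvd x" for x
    using that by (simp add: power2_eq_square chi_mult_self)
  have \<kappa>: "\<kappa> (\<phi> (e, c, b)) = \<kappa> (g ^ e)" if "c \<in> {1..<int p}" "b \<in> gunits" for e c b
  proof -
    have "octic_sum (\<phi> (e, c, b)) = octic_sum (of_int c * (b ^ 4 * g ^ e))"
      unfolding \<phi>_def using octic_sum_cong [OF gcong_gmod] by (simp add: mult_ac)
    also have "\<dots> = chi c * (chi (gnorm b) * octic_sum (g ^ e))"
      by (simp only: octic_sum_of_int_mult octic_sum_power4_mult [OF U [OF that(2)]])
    finally show ?thesis by (simp add: \<kappa>_def power_mult_distrib sq not_p_dvd_less [OF that(1)] U [OF that(2)])
  qed
  have fib: "card {w \<in> \<Omega>. \<phi> w = a} \<le> card real_fourth" for a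
    unfolding \<Omega>_def \<phi>_def by (rule fourth_power_fibre [OF g])
  have "(\<Sum>a\<in>gunits. card {w \<in> \<Omega>. \<phi> w = a}) = card \<Omega>"
    using sum.group [OF fin finite_gunits im, of "\<lambda>_. 1 :: nat"] by simp
  then have "(\<Sum>a\<in>gunits. card real_fourth - card {w \<in> \<Omega>. \<phi> w = a}) = 0"
    using fib card\<Omega> by (subst sum_subtractf_nat) auto
  then have fibre: "card {w \<in> \<Omega>. \<phi> w = a} = card real_fourth" if "a \<in> gunits" for a
    using that fib [of a] by (auto simp: le_antisym)
  have "(\<Sum>w\<in>\<Omega>. \<kappa> (\<phi> w)) = (\<Sum>a\<in>gunits. \<Sum>w\<in>{w \<in> \<Omega>. \<phi> w = a}. \<kappa> (\<phi> w))"
    by (rule sum.group [OF fin finite_gunits im, symmetric])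
  also have "\<dots> = (\<Sum>a\<in>gunits. int (card real_fourth) * \<kappa> a)"
    by (intro sum.cong refl) (simp add: fibre)
  also have "\<dots> = int (card real_fourth) * (\<Sum>a\<in>gunits. \<kappa> a)"
    by (simp only: sum_distrib_left)
  also have "(\<Sum>a\<in>gunits. \<kappa> a) = (\<Sum>a\<in>gres. \<kappa> a)"
    by (rule sum.mono_neutral_left) (auto simp: gunits_def \<kappa>_def octic_sum_nonunit)
  also have "\<dots> = int (card gunits) * (4 * (int p - 1) * (int p * (int p - 1)))"
    unfolding \<kappa>_def by (rule second_moment [OF two])
  finally have s1: "(\<Sum>w\<in>\<Omega>. \<kappa> (\<phi> w))
    = (4 * (int p - 1)) * (int (card gunits) * (4 * (int p - 1) * (int p * (int p - 1))))"
    by (simp only: card_real_fourth)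
  have "(\<Sum>w\<in>\<Omega>. \<kappa> (\<phi> w)) = (\<Sum>e<4. \<Sum>c\<in>{1..<int p}. \<Sum>b\<in>gunits. \<kappa> (\<phi> (e, c, b)))"
    unfolding \<Omega>_def by (simp add: sum.cartesian_product)
  also have "\<dots> = (\<Sum>e<4. \<Sum>c\<in>{1..<int p}. \<Sum>b\<in>gunits. \<kappa> (g ^ e))"
    by (intro sum.cong refl \<kappa>) auto
  also have "\<dots> = (int p - 1) * int (card gunits) * (\<Sum>e<4. \<kappa> (g ^ e))"
    using odd_p by (simp add: of_nat_diff sum_distrib_left mult.assoc)
  finally have s2: "(\<Sum>w\<in>\<Omega>. \<kappa> (\<phi> w)) = (int p - 1) * int (card gunits) * (\<Sum>e<4. \<kappa> (g ^ e))" .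
  \<comment> \<open>as \<open>g * gcnj g\<close> is rational, \<open>g ^ 4 * gcnj g ^ n\<close> is a rational multiple of \<open>g ^ k\<close>\<close>
  have conj: "chi (gnorm g ^ n) * octic_sum (g ^ k) = - octic_sum (g ^ n)" if "n + k = 4" for n k
  proof -
    have "g ^ 4 * gcnj g ^ n = of_int (gnorm g ^ n) * g ^ k"
    proof -
      have "g ^ 4 * gcnj g ^ n = (g * gcnj g) ^ n * g ^ k"
        unfolding that [symmetric] by (simp add: power_add power_mult_distrib mult_ac)
      then show ?thesis by (simp add: mult_gcnj)
    qed
    then have "octic_sum (of_int (gnorm g ^ n) * g ^ k) = octic_sum (g ^ 4 * gcnj g ^ n)" by (simp only:)
    also have "\<dots> = - octic_sum (gcnj (g ^ n))" using octic_sum_power4_mult [OF gn1] g by (simp add: gcnj_power)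
    finally show ?thesis by (simp only: octic_sum_of_int_mult octic_sum_gcnj)
  qed
  have "chi (gnorm g ^ 2) = 1" by (rule chi_square [OF gn1])
  then have k2: "\<kappa> (g ^ 2) = 0" using conj [of 2 2] by (simp add: \<kappa>_def)
  have "(chi (gnorm g ^ 3))\<^sup>2 = 1" by (rule sq) (simp add: p_dvd_power_iff gn1)
  then have "\<kappa> g = \<kappa> (g ^ 3)"
    using arg_cong [OF conj [of 3 1], of "\<lambda>x. x\<^sup>2"] by (simp add: \<kappa>_def power_mult_distrib)
  then have "(\<Sum>e<4. \<kappa> (g ^ e)) = \<kappa> 1 + 2 * \<kappa> g"
    using k2 by (simp add: eval_nat_numeral)
  moreover have "gmod 1 \<in> gunits"
    using odd_p by (intro gmod_unit) (simp add: gnorm_def)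
  then have "int (card gunits) > 0" by (auto simp: card_gt_0_iff)
  moreover have "int p - 1 > 0" using odd_p by simp
  moreover have "(int p - 1) * int (card gunits) * (\<Sum>e<4. \<kappa> (g ^ e))
      = (int p - 1) * int (card gunits) * (16 * int p * (int p - 1)\<^sup>2)"
    unfolding s2 [symmetric] s1 by (simp add: power2_eq_square algebra_simps)
  ultimately show ?thesis by (auto simp: \<kappa>_def)
qed

section \<open>The elliptic curve sum\<close>

text \<open>
  The summand is homogeneous of even degree in \<open>a = x + i y\<close>, so for \<open>x \<noteq> 0\<close> it depends only
  on \<open>t = y / x\<close>; the first term accounts for \<open>x = 0\<close>.
\<close>

lemma octic_sum_homogeneous:
  "octic_sum b = (int p - 1) * (chi (gre b) + (\<Sum>t\<in>Fp. chi (1 + t\<^sup>2) * chi (gre (b * Gauss 1 t ^ 4))))"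
proof -
  define f where "f a = chi (gnorm a) * chi (gre (b * a ^ 4))" for a
  have fcong: "f a = f a'" if "gcong a a'" for a a'
    unfolding f_def by (rule octic_summand_cong [OF that])
  define S where "S = (\<Sum>t\<in>Fp. chi (1 + t\<^sup>2) * chi (gre (b * Gauss 1 t ^ 4)))"
  have zero: "f (Gauss 0 y) = (if int p dvd y then 0 else chi (gre b))" for y
  proof -
    have "b * Gauss 0 y ^ 4 = of_int (y ^ 4) * b"
      by (rule gauss.expand) (simp add: power4_eq_xxxx)
    then have "gre (b * Gauss 0 y ^ 4) = y ^ 4 * gre b" by (simp del: of_int_power)
    then have "f (Gauss 0 y) = chi (y\<^sup>2) * (chi (y ^ 4) * chi (gre b))"
      by (simp add: f_def gnorm_def chi_mult)
    then show ?thesis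
      using chi_eq_0_iff [of "y\<^sup>2"] by (auto simp: p_dvd_power_iff chi_square chi_power4)
  qed
  have nonzero: "(\<Sum>y\<in>Fp. f (Gauss x y)) = S" if "\<not> int p dvd x" for x
  proof -
    have "(\<Sum>y\<in>Fp. f (Gauss x y)) = (\<Sum>t\<in>Fp. f (Gauss x (x * t + 0)))"
      by (rule sum_Fp_affine [symmetric, OF fcong that]) (simp add: gcong_iff)
    also have "\<dots> = S" unfolding S_def
    proof (intro sum.cong refl)
      fix t
      have e: "Gauss x (x * t + 0) = of_int x * Gauss 1 t" by (rule gauss.expand) simp
      have "b * (of_int x * Gauss 1 t) ^ 4 = of_int (x ^ 4) * (b * Gauss 1 t ^ 4)"
        by (simp add: power_mult_distrib mult_ac)
      then have "gre (b * (of_int x * Gauss 1 t) ^ 4) = x ^ 4 * gre (b * Gauss 1 t ^ 4)"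
        by (simp only: gauss_sel gauss_of_int mult_zero_left diff_0_right)
      moreover have "gnorm (Gauss 1 t) = 1 + t\<^sup>2" by (simp add: gnorm_def)
      ultimately show "f (Gauss x (x * t + 0)) = chi (1 + t\<^sup>2) * chi (gre (b * Gauss 1 t ^ 4))"
        using that unfolding e f_def gnorm_mult gnorm_of_int
        by (simp add: chi_mult chi_square chi_power4)
    qed
    finally show ?thesis .
  qed
  have "octic_sum b = (\<Sum>x\<in>Fp. \<Sum>y\<in>Fp. f (Gauss x y))"
    by (simp add: octic_sum_def f_def sum_gres)
  also have "\<dots> = (\<Sum>y\<in>Fp. f (Gauss 0 y)) + (\<Sum>x\<in>Fp - {0}. \<Sum>y\<in>Fp. f (Gauss x y))"
    by (rule sum.remove) simp_all
  also have "(\<Sum>y\<in>Fp. f (Gauss 0 y)) = (int p - 1) * chi (gre b)"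
    by (simp only: zero sum_Fp_indicator)
  also have "(\<Sum>x\<in>Fp - {0}. \<Sum>y\<in>Fp. f (Gauss x y)) = (\<Sum>x\<in>Fp - {0}. S)"
    by (intro sum.cong refl nonzero) (auto simp: p_dvd_residue_iff)
  also have "\<dots> = (int p - 1) * S"
    using odd_p by (simp add: card_Diff_singleton of_nat_diff)
  finally show ?thesis by (simp add: S_def distrib_left)
qed

lemma fermat_inverse: "\<not> int p dvd a \<Longrightarrow> [a * a ^ (p - 2) = 1] (mod int p)"
proof -
  have "a * a ^ (p - 2) = a ^ Suc (p - 2)" by simp
  also have "Suc (p - 2) = p - 1" using odd_p by simp
  finally show "\<not> int p dvd a \<Longrightarrow> ?thesis" using fermat [of a] by simp
qed

lemma card_square_roots:
  assumes "\<tau> \<in> Fp"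
  shows "int (card {t \<in> Fp. t\<^sup>2 mod int p = \<tau>}) = 1 + chi \<tau>"
proof -
  have tau: "\<tau> mod int p = \<tau>" using assms by (simp add: Fp_def)
  consider "chi \<tau> = 0" | "chi \<tau> = - 1" | "chi \<tau> = 1" using chi_range [of \<tau>] by auto
  then show ?thesis
  proof cases
    case 1
    then have "\<tau> = 0" using assms by (simp add: chi_eq_0_iff p_dvd_residue_iff)
    then have "{t \<in> Fp. t\<^sup>2 mod int p = \<tau>} = {0}"
      using p_dvd_residue_iff by (auto simp: p_dvd_power_iff simp flip: dvd_eq_mod_eq_0)
    with 1 show ?thesis by simp
  next
    case 2
    have "{t \<in> Fp. t\<^sup>2 mod int p = \<tau>} = {}"
    proof (rule ccontr)
      assume "{t \<in> Fp. t\<^sup>2 mod int p = \<tau>} \<noteq> {}"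
      then obtain t where "t\<^sup>2 mod int p = \<tau>" by blast
      then have "chi \<tau> = chi (t\<^sup>2)" by (intro chi_cong) (auto simp: cong_def)
      with 2 show False using chi_range [of t] by (auto simp: power2_eq_square chi_mult)
    qed
    with 2 show ?thesis by simp
  next
    case 3
    then obtain y where "[y\<^sup>2 = \<tau>] (mod int p)"
      unfolding Legendre_def QuadRes_def by (auto split: if_splits)
    then have y: "y\<^sup>2 mod int p = \<tau>" by (simp add: cong_def tau)
    have "\<not> int p dvd \<tau>" using 3 chi_eq_0_iff [of \<tau>] by auto
    then have ny: "\<not> int p dvd y"
      using y by (auto simp: power2_eq_square dvd_mod)
    have "{t \<in> Fp. t\<^sup>2 mod int p = \<tau>} = {y mod int p, (- y) mod int p}"
    proof (intro equalityI subsetI)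
      fix t assume "t \<in> {t \<in> Fp. t\<^sup>2 mod int p = \<tau>}"
      then have t: "t \<in> Fp" "[t\<^sup>2 = y\<^sup>2] (mod int p)" using y by (auto simp: cong_def)
      then have "int p dvd (t - y) * (t + y)"
        by (simp add: cong_iff_dvd_diff power2_eq_square square_diff_square_factored mult.commute)
      then consider "[t = y] (mod int p)" | "[t = - y] (mod int p)"
        by (auto simp: p_dvd_mult_iff cong_iff_dvd_diff)
      then show "t \<in> {y mod int p, (- y) mod int p}"
        using t(1) by cases (auto simp: cong_def Fp_def)
    next
      fix t assume "t \<in> {y mod int p, (- y) mod int p}"
      then show "t \<in> {t \<in> Fp. t\<^sup>2 mod int p = \<tau>}"
        using y by (auto simp: power_mod)
    qed
    moreover have "y mod int p \<noteq> (- y) mod int p"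
    proof
      assume "y mod int p = (- y) mod int p"
      then have "int p dvd 2 * y" by (simp add: mod_eq_dvd_iff)
      then show False using ny not_p_dvd_2 p_dvd_mult_iff by blast
    qed
    ultimately show ?thesis using 3 by simp
  qed
qed

lemma sum_squares:
  assumes "\<And>x y. [x = y] (mod int p) \<Longrightarrow> f x = f y"
  shows "(\<Sum>t\<in>Fp. f (t\<^sup>2)) = (\<Sum>x\<in>Fp. (1 + chi x) * (f x :: int))"
proof -
  have "f (t\<^sup>2) = f (t\<^sup>2 mod int p)" for t by (rule assms) (simp add: cong_def)
  then have "(\<Sum>t\<in>Fp. f (t\<^sup>2)) = (\<Sum>t\<in>Fp. f (t\<^sup>2 mod int p))" by (intro sum.cong refl)
  also have "\<dots> = (\<Sum>x\<in>Fp. \<Sum>t\<in>{t \<in> Fp. t\<^sup>2 mod int p = x}. f (t\<^sup>2 mod int p))"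
    by (rule sum.group [symmetric]) auto
  also have "\<dots> = (\<Sum>x\<in>Fp. (1 + chi x) * f x)"
    by (intro sum.cong refl) (simp flip: card_square_roots)
  finally show ?thesis .
qed

text \<open>
  This is minus the trace of Frobenius of the curve \<open>v\<^sup>2 = u\<^sup>3 + 4 u\<^sup>2 + 2 u\<close> over the field with
  \<open>p\<close> elements.
\<close>

definition curve_sum :: int where
  "curve_sum = (\<Sum>u\<in>Fp. chi (u * (u\<^sup>2 + 4 * u + 2)))"

text \<open>
  After dehomogenising, \<open>K 1\<close> is a sum over \<open>t\<close> of a function \<open>h (t\<^sup>2)\<close>, that is, a sum over \<open>x\<close>
  of \<open>(1 + \<chi> x) * h x\<close>. The inversion of \<open>x\<close> turns the part with \<open>\<chi> x\<close> into the part without it,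
  except for \<open>x = 0\<close>; and \<open>x = -2 u - 1\<close> turns \<open>h\<close> into the cubic of the curve.
\<close>

lemma octic_sum_one: "octic_sum 1 = 2 * (int p - 1) * (chi (- 2) * curve_sum)"
proof -
  define h where "h x = chi ((1 + x) * (x\<^sup>2 - 6 * x + 1))" for x :: int
  have hcong: "h x = h y" if "[x = y] (mod int p)" for x y
    using that unfolding h_def
    by (intro chi_cong cong_mult cong_add cong_diff cong_pow cong_refl)
  have "chi (1 + t\<^sup>2) * chi (gre (1 * Gauss 1 t ^ 4)) = h (t\<^sup>2)" for t
    unfolding h_def chi_mult mult_1_left gre_power4 by (simp add: algebra_simps)
  then have "(\<Sum>t\<in>Fp. chi (1 + t\<^sup>2) * chi (gre (1 * Gauss 1 t ^ 4)))
      = (\<Sum>x\<in>Fp. (1 + chi x) * h x)"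
    using sum_squares [of h, OF hcong] by simp
  also have "\<dots> = sum h Fp + (\<Sum>x\<in>Fp. chi x * h x)"
    by (simp add: distrib_right sum.distrib)
  \<comment> \<open>the power \<open>x ^ (p - 2)\<close> is the inverse of \<open>x\<close>, and 0 for \<open>x = 0\<close>\<close>
  also have "(\<Sum>x\<in>Fp. chi x * h x) = (\<Sum>x\<in>Fp. chi (x ^ (p - 2)) * h (x ^ (p - 2)))"
  proof (rule sum_Fp_reindex [symmetric])
    show "chi x * h x = chi y * h y" if "[x = y] (mod int p)" for x y
      using that by (simp only: chi_cong [OF that] hcong [OF that])
    show "[x = y] (mod int p)" if xy: "[x ^ (p - 2) = y ^ (p - 2)] (mod int p)" for x y
    proof (cases "int p dvd x \<or> int p dvd y")
      case True
      with cong_dvd_iff [OF xy] have "int p dvd x" "int p dvd y"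
        using odd_p by (auto simp: p_dvd_power_iff)
      then show ?thesis by (simp add: cong_iff_dvd_diff)
    next
      case False
      have "[x * 1 = x * (y * y ^ (p - 2))] (mod int p)"
        using False by (intro cong_mult cong_refl cong_sym [OF fermat_inverse]) auto
      also have "[x * (y * y ^ (p - 2)) = x * (y * x ^ (p - 2))] (mod int p)"
        by (intro cong_mult cong_refl cong_sym [OF xy])
      also have "x * (y * x ^ (p - 2)) = y * (x * x ^ (p - 2))" by simp
      also have "[\<dots> = y * 1] (mod int p)"
        using False by (intro cong_mult cong_refl fermat_inverse) auto
      finally show ?thesis by simp
    qed
  qed
  also have "\<dots> = (\<Sum>x\<in>Fp. if x = 0 then 0 else h x)"
  proof (intro sum.cong refl)
    fix x assume x: "x \<in> Fp"
    show "chi (x ^ (p - 2)) * h (x ^ (p - 2)) = (if x = 0 then 0 else h x)"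
    proof (cases "x = 0")
      case True
      then show ?thesis using odd_p chi_eq_0_iff [of 0] by (simp add: power_0_left)
    next
      case False
      with x have x0: "\<not> int p dvd x" by (simp add: p_dvd_residue_iff)
      define y where "y = x ^ (p - 2)"
      have xy: "[x * y = 1] (mod int p)" using fermat_inverse [OF x0] by (simp add: y_def)
      have "chi y * h y = chi (x ^ 4 * (y * ((1 + y) * (y\<^sup>2 - 6 * y + 1))))"
        by (simp add: h_def chi_mult chi_power4 [OF x0])
      also have "x ^ 4 * (y * ((1 + y) * (y\<^sup>2 - 6 * y + 1)))
          = (x * y) * ((x + x * y) * ((x * y)\<^sup>2 - 6 * (x * y) * x + x\<^sup>2))"
        by (simp add: power2_eq_square power4_eq_xxxx algebra_simps)
      also have "chi \<dots> = chi (1 * ((x + 1) * (1\<^sup>2 - 6 * 1 * x + x\<^sup>2)))"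
        by (intro chi_cong cong_mult cong_add cong_diff cong_pow cong_refl xy)
      also have "\<dots> = h x" by (simp add: h_def algebra_simps)
      finally show ?thesis using False by (simp add: y_def)
    qed
  qed
  also have "\<dots> = sum h Fp - h 0"
    by (subst sum.remove [of _ 0]) (simp_all add: sum.remove [of Fp 0 h])
  also have "h 0 = 1" by (simp add: h_def)
  also have "sum h Fp = chi (- 2) * curve_sum"
  proof -
    have e: "h ((- 2) * u + (- 1)) = chi (- 2) * chi (u * (u\<^sup>2 + 4 * u + 2))" for u
    proof -
      have "(1 + ((- 2) * u + (- 1))) * (((- 2) * u + (- 1))\<^sup>2 - 6 * ((- 2) * u + (- 1)) + 1)
          = 2\<^sup>2 * ((- 2) * (u * (u\<^sup>2 + 4 * u + 2)))"
        by (simp add: power2_eq_square algebra_simps)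
      then show ?thesis unfolding h_def by (simp only: chi_mult chi_square [OF not_p_dvd_2] mult_1_left)
    qed
    have "sum h Fp = (\<Sum>u\<in>Fp. h ((- 2) * u + (- 1)))"
      by (rule sum_Fp_affine [symmetric, OF hcong]) (use not_p_dvd_2 in auto)
    also have "\<dots> = (\<Sum>u\<in>Fp. chi (- 2) * chi (u * (u\<^sup>2 + 4 * u + 2)))"
      by (intro sum.cong refl e)
    finally show ?thesis by (simp add: curve_sum_def sum_distrib_left)
  qed
  finally show ?thesis using octic_sum_homogeneous [of 1] by (simp add: algebra_simps)
qed

lemma curve_sum_eq_0:
  assumes "chi (- 2) = - 1" shows "curve_sum = 0"
  using octic_sum_one octic_sum_one_eq_0 [OF assms] assms odd_p by simp

text \<open>
  A \<open>g\<close> of nonresidue norm exists because some nonresidue is a sum of two squares. Removing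
  the factor \<open>(p - 1)\<^sup>2\<close> from \<open>octic_sum_class_sum\<close> leaves \<open>4 \<Lambda>\<^sup>2 + 2 k\<^sup>2 = 16 p\<close>; parity
  then shows that \<open>\<Lambda> = 2 a\<close> and \<open>k = 4 b\<close>.
\<close>

lemma curve_sum_two_squares:
  assumes "chi (- 2) = 1"
  shows "\<exists>a b. int p = a\<^sup>2 + 2 * b\<^sup>2 \<and> curve_sum = 2 * a"
proof -
  obtain m where m: "chi m = - 1" "chi (m - 1) = 1" using exists_nonresidue by blast
  then obtain y where y: "[y\<^sup>2 = m - 1] (mod int p)"
    unfolding Legendre_def QuadRes_def by (auto split: if_splits)
  define g where "g = Gauss y 1"
  have "[y\<^sup>2 + 1 = m - 1 + 1] (mod int p)" by (intro cong_add y cong_refl)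
  then have "chi (gnorm g) = - 1" using m chi_cong [of "y\<^sup>2 + 1" m] by (simp add: g_def gnorm_def)
  note sum = octic_sum_class_sum [OF assms this]
  obtain k where k: "octic_sum g = (int p - 1) * k" using octic_sum_homogeneous by blast
  have "(int p - 1)\<^sup>2 * (4 * curve_sum\<^sup>2 + 2 * k\<^sup>2) = (int p - 1)\<^sup>2 * (16 * int p)"
    using sum unfolding octic_sum_one k assms by (simp add: power2_eq_square algebra_simps)
  then have eq: "4 * curve_sum\<^sup>2 + 2 * k\<^sup>2 = 16 * int p" using odd_p by simp
  then have "k\<^sup>2 = 2 * (4 * int p - curve_sum\<^sup>2)" by simp
  then have "even (k\<^sup>2)" by (rule dvdI)
  then obtain m where m: "k = 2 * m" by auto
  with eq have eq2: "curve_sum\<^sup>2 + 2 * m\<^sup>2 = 4 * int p" by (simp add: power_mult_distrib)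
  then have "curve_sum\<^sup>2 = 2 * (2 * int p - m\<^sup>2)" by simp
  then have "even (curve_sum\<^sup>2)" by (rule dvdI)
  then obtain a where a: "curve_sum = 2 * a" by auto
  with eq2 have eq3: "2 * a\<^sup>2 + m\<^sup>2 = 2 * int p" by (simp add: power_mult_distrib)
  then have "m\<^sup>2 = 2 * (int p - a\<^sup>2)" by simp
  then have "even (m\<^sup>2)" by (rule dvdI)
  then obtain b where b: "m = 2 * b" by auto
  with eq3 have "int p = a\<^sup>2 + 2 * b\<^sup>2" by (simp add: power_mult_distrib)
  with a show ?thesis by blast
qed

section \<open>The elliptic curve sum as a truncated series\<close>

definition half :: nat where "half = (p - 1) div 2"

lemma two_half: "2 * half = p - 1"
  using prime_odd_nat [OF prime] odd_p by (simp add: half_def even_two_times_div_two)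

lemma int_two_half: "2 * int half = int p - 1"
  using arg_cong [OF two_half, of int] odd_p by (simp add: of_nat_diff)

lemma cong_cancel_p: "\<not> int p dvd a \<Longrightarrow> [a * x = a * y] (mod int p) \<Longrightarrow> [x = y] (mod int p)"
  by (simp add: cong_iff_dvd_diff p_dvd_mult_iff flip: right_diff_distrib)

text \<open>
  The recurrences for the two sides agree modulo \<open>p\<close>, since \<open>2 * half = -1\<close> modulo \<open>p\<close>; formally,
  \<open>c j = (-4) ^ j * (-1/2 choose j)\<close>.
\<close>

lemma central_binomial_cong:
  "j < p \<Longrightarrow> [int ((2 * j) choose j) = (- 4) ^ j * int (half choose j)] (mod int p)"
proof (induction j)
  case (Suc j)
  let ?c = "\<lambda>j. int ((2 * j) choose j)" and ?b = "\<lambda>j. int (half choose j)"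
  have "\<not> int p dvd int (Suc j)" using Suc.prems zdvd_imp_le [of "int p" "int (Suc j)"] by auto
  moreover have "[int (Suc j) * ?c (Suc j) = int (Suc j) * ((- 4) ^ Suc j * ?b (Suc j))] (mod int p)"
  proof -
    have "int (Suc j) * ?c (Suc j) = 2 * (2 * int j + 1) * ?c j"
      using arg_cong [OF Suc_mult_central_binomial [of j], of int]
      by (simp only: of_nat_mult of_nat_add of_nat_1 of_nat_numeral Suc_eq_plus1)
    also have "[\<dots> = 2 * (2 * int j + 1) * ((- 4) ^ j * ?b j)] (mod int p)"
      using Suc by (intro cong_mult cong_refl) auto
    also have "2 * (2 * int j + 1) * ((- 4) ^ j * ?b j)
        = (- 4) ^ j * ((int p - 1 - 2 * int half) + (2 * (2 * int j + 1))) * ?b j"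
      unfolding int_two_half by simp
    also have "[\<dots> = (- 4) ^ j * ((- 4) * (int half - int j)) * ?b j] (mod int p)"
    proof (intro cong_mult cong_refl)
      have "int p - 1 - 2 * int half + 2 * (2 * int j + 1) - (- 4) * (int half - int j) = int p * 2"
        using int_two_half by (simp add: algebra_simps)
      then show "[int p - 1 - 2 * int half + 2 * (2 * int j + 1) = (- 4) * (int half - int j)] (mod int p)"
        by (simp only: cong_iff_dvd_diff dvd_triv_left)
    qed
    also have "(- 4) ^ j * ((- 4) * (int half - int j)) * ?b j = (- 4) ^ Suc j * (int (Suc j) * ?b (Suc j))"
      unfolding Suc_mult_binomial_Suc by (simp only: power_Suc mult_ac)
    finally show ?thesis by (simp only: mult_ac)
  qed
  ultimately show ?case by (rule cong_cancel_p)
qed simp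

text \<open>
  If \<open>p - 1\<close> does not divide \<open>e\<close>, multiplication of the variable by a primitive root \<open>g\<close> scales
  the sum by \<open>g ^ e \<noteq> 1\<close>.
\<close>

lemma power_sum_cong:
  assumes e: "0 < e" "e < 2 * (p - 1)"
  shows "[(\<Sum>u\<in>Fp. u ^ e) = (if e = p - 1 then - 1 else 0)] (mod int p)"
proof (cases "e = p - 1")
  case True
  have "[(\<Sum>u\<in>Fp. u ^ e) = (\<Sum>u\<in>Fp. if int p dvd u then 0 else 1)] (mod int p)"
    using fermat True odd_p by (intro cong_sum) (auto simp: cong_0_iff p_dvd_power_iff)
  also have "(\<Sum>u\<in>Fp. if int p dvd u then 0 else 1) = int p - 1"
    by (simp add: sum_Fp_indicator)
  also have "[\<dots> = - 1] (mod int p)" by (simp add: cong_iff_dvd_diff)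
  finally show ?thesis using True by simp
next
  case False
  have "p > 1" using odd_p by simp
  then obtain g where g: "residue_primroot p g"
    using prime_primitive_root_exists [OF _ prime] by blast
  then have ord: "ord p g = p - 1" and cop: "coprime p g"
    using prime by (simp_all add: residue_primroot_def totient_prime)
  have "\<not> p - 1 dvd e"
  proof
    assume "p - 1 dvd e"
    then obtain k where k: "e = (p - 1) * k" by (rule dvdE)
    have "(p - 1) * k < (p - 1) * 2" using e(2) unfolding k by simp
    then have "k < 2" by (simp only: mult_less_cancel1)
    then have "k = 0 \<or> k = 1" by auto
    then show False using e(1) False unfolding k by auto
  qed
  then have "\<not> [g ^ e = 1] (mod p)" by (simp only: ord_divides ord not_False_eq_True)
  then have "\<not> [int g ^ e = 1] (mod int p)"
    using cong_int_iff [of "g ^ e" 1 p] by simp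
  then have ge: "\<not> int p dvd int g ^ e - 1" by (simp add: cong_iff_dvd_diff)
  have pg: "\<not> int p dvd int g"
    using coprime_common_divisor [OF cop dvd_refl] odd_p by (auto simp: int_dvd_int_iff)
  have "[(\<Sum>u\<in>Fp. int g ^ e * u ^ e) = (\<Sum>u\<in>Fp. (int g * u + 0) ^ e mod int p)] (mod int p)"
    by (intro cong_sum) (simp add: cong_def power_mult_distrib)
  also have "(\<Sum>u\<in>Fp. (int g * u + 0) ^ e mod int p) = (\<Sum>u\<in>Fp. u ^ e mod int p)"
  proof (rule sum_Fp_affine [OF _ pg])
    fix x y assume "[x = y] (mod int p)"
    then have "[x ^ e = y ^ e] (mod int p)" by (rule cong_pow)
    then show "x ^ e mod int p = y ^ e mod int p" by (simp only: cong_def)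
  qed
  also have "[(\<Sum>u\<in>Fp. u ^ e mod int p) = (\<Sum>u\<in>Fp. u ^ e)] (mod int p)"
    by (intro cong_sum) (simp add: cong_def)
  finally have "[(\<Sum>u\<in>Fp. int g ^ e * u ^ e) = (\<Sum>u\<in>Fp. u ^ e)] (mod int p)" .
  then have "int p dvd (int g ^ e - 1) * (\<Sum>u\<in>Fp. u ^ e)"
    by (simp add: cong_iff_dvd_diff left_diff_distrib flip: sum_distrib_left)
  with ge show ?thesis using False by (simp add: p_dvd_mult_iff cong_0_iff)
qed

text \<open>
  By Euler's criterion, \<open>\<Lambda>\<close> is the sum over \<open>u\<close> of the \<open>half\<close>-th powers of the cubic. Its exponents
  in \<open>u\<close> lie between \<open>half\<close> and \<open>3 * half\<close>, so only the coefficient of \<open>u ^ (p - 1)\<close> survives,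
  which is the coefficient of \<open>u ^ half\<close> in \<open>(u\<^sup>2 + 4 u + 2) ^ half\<close>.
\<close>

lemma curve_sum_cong_sum:
  "[curve_sum = - (\<Sum>i\<le>half. int (half choose (2 * i)) * int ((2 * i) choose i) * 2 ^ i * 4 ^ (half - 2 * i))] (mod int p)"
proof -
  define C where "C j i = int (half choose j) * int (j choose i) * 2 ^ (j - i) * 4 ^ (half - j)" for j i
  have half: "half > 0" using two_half odd_p by linarith
  have expand: "(u * (u\<^sup>2 + 4 * u + 2)) ^ half
      = (\<Sum>j\<le>half. \<Sum>i\<le>half. C j i * u ^ (half + (half - j) + 2 * i))" for u :: int
  proof -
    have sq: "(u\<^sup>2 + 2) ^ j = (\<Sum>i\<le>half. int (j choose i) * (u ^ (2 * i) * 2 ^ (j - i)))" if "j \<le> half" for j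
    proof -
      have "(u\<^sup>2 + 2) ^ j = (\<Sum>i\<le>j. int (j choose i) * (u ^ (2 * i) * 2 ^ (j - i)))"
        unfolding binomial_ring by (simp add: power_mult mult.assoc)
      also have "\<dots> = (\<Sum>i\<le>half. int (j choose i) * (u ^ (2 * i) * 2 ^ (j - i)))"
        using that by (intro sum.mono_neutral_left) auto
      finally show ?thesis .
    qed
    have "(u * (u\<^sup>2 + 4 * u + 2)) ^ half = u ^ half * ((u\<^sup>2 + 2) + 4 * u) ^ half"
      by (simp add: power_mult_distrib add_ac)
    also have "\<dots> = u ^ half * (\<Sum>j\<le>half. int (half choose j) * (u\<^sup>2 + 2) ^ j * (4 * u) ^ (half - j))"
      unfolding binomial_ring by simp
    also have "\<dots> = (\<Sum>j\<le>half. u ^ half * (int (half choose j) * (u\<^sup>2 + 2) ^ j * (4 * u) ^ (half - j)))"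
      by (simp only: sum_distrib_left)
    also have "\<dots> = (\<Sum>j\<le>half. \<Sum>i\<le>half. C j i * u ^ (half + (half - j) + 2 * i))"
    proof (intro sum.cong refl)
      fix j assume j: "j \<in> {..half}"
      define d where "d = half - j"
      have "u ^ half * (int (half choose j) * (u\<^sup>2 + 2) ^ j * (4 * u) ^ d)
          = (\<Sum>i\<le>half. u ^ half * (int (half choose j) * (int (j choose i) * (u ^ (2 * i) * 2 ^ (j - i))) * (4 * u) ^ d))"
        using j by (simp only: sq atMost_iff sum_distrib_left sum_distrib_right)
      also have "\<dots> = (\<Sum>i\<le>half. C j i * u ^ (half + d + 2 * i))"
        by (intro sum.cong refl) (simp add: C_def power_add power_mult_distrib mult_ac flip: d_def)
      finally show "u ^ half * (int (half choose j) * (u\<^sup>2 + 2) ^ j * (4 * u) ^ (half - j))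
          = (\<Sum>i\<le>half. C j i * u ^ (half + (half - j) + 2 * i))" by (simp only: d_def)
    qed
    finally show ?thesis .
  qed
  have "[curve_sum = (\<Sum>u\<in>Fp. (u * (u\<^sup>2 + 4 * u + 2)) ^ half)] (mod int p)"
    unfolding curve_sum_def half_def by (intro cong_sum chi_euler)
  also have "(\<Sum>u\<in>Fp. (u * (u\<^sup>2 + 4 * u + 2)) ^ half)
      = (\<Sum>u\<in>Fp. \<Sum>j\<le>half. \<Sum>i\<le>half. C j i * u ^ (half + (half - j) + 2 * i))"
    by (simp only: expand)
  also have "\<dots> = (\<Sum>j\<le>half. \<Sum>u\<in>Fp. \<Sum>i\<le>half. C j i * u ^ (half + (half - j) + 2 * i))"
    by (rule sum.swap)
  also have "\<dots> = (\<Sum>j\<le>half. \<Sum>i\<le>half. \<Sum>u\<in>Fp. C j i * u ^ (half + (half - j) + 2 * i))"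
    by (intro sum.cong refl sum.swap)
  also have "\<dots> = (\<Sum>j\<le>half. \<Sum>i\<le>half. C j i * (\<Sum>u\<in>Fp. u ^ (half + (half - j) + 2 * i)))"
    by (simp only: sum_distrib_left)
  also have "[\<dots> = (\<Sum>j\<le>half. \<Sum>i\<le>half. C j i * (if j = 2 * i then - 1 else 0))] (mod int p)"
  proof (intro cong_sum)
    fix j i assume j: "j \<in> {..half}" and "i \<in> {..half}"
    show "[C j i * (\<Sum>u\<in>Fp. u ^ (half + (half - j) + 2 * i)) = C j i * (if j = 2 * i then - 1 else 0)] (mod int p)"
    proof (cases "i \<le> j")
      case True
      have "(half + (half - j) + 2 * i = p - 1) = (j = 2 * i)"
        using two_half j True by auto
      moreover have "0 < half + (half - j) + 2 * i" "half + (half - j) + 2 * i < 2 * (p - 1)"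
        using half two_half j True by auto
      ultimately show ?thesis
        using power_sum_cong [of "half + (half - j) + 2 * i"] by (intro cong_mult cong_refl) simp
    qed (simp add: C_def binomial_eq_0)
  qed
  also have "(\<Sum>j\<le>half. \<Sum>i\<le>half. C j i * (if j = 2 * i then - 1 else 0))
      = (\<Sum>i\<le>half. \<Sum>j\<le>half. if j = 2 * i then - C j i else 0)"
    by (subst sum.swap) (intro sum.cong refl, simp)
  also have "\<dots> = (\<Sum>i\<le>half. - (int (half choose (2 * i)) * int ((2 * i) choose i) * 2 ^ i * 4 ^ (half - 2 * i)))"
    by (intro sum.cong refl) (simp add: C_def binomial_eq_0 mult_2)
  finally show ?thesis by (simp only: sum_negf)
qed

text \<open>
  The factors \<open>128 ^ (p - 1 - k)\<close> stand for \<open>128 ^ (- k)\<close>. For \<open>k \<le> half\<close> the coefficient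
  \<open>c (2 * k)\<close> is congruent to \<open>16 ^ k * (half choose 2 * k)\<close>; for larger \<open>k\<close> the factor \<open>c k\<close>
  vanishes modulo \<open>p\<close>.
\<close>

lemma curve_sum_cong_truncated_series:
  "[curve_sum = - (\<Sum>k<p. int (quartic_coeff k) * 128 ^ (p - 1 - k))] (mod int p)"
proof -
  define B where "B = (\<Sum>k<p. int (quartic_coeff k) * 128 ^ (p - 1 - k))"
  define A where "A = (\<Sum>k\<le>half. int (half choose (2 * k)) * int ((2 * k) choose k) * 2 ^ k * 4 ^ (half - 2 * k))"
  have split: "B
      = (\<Sum>k\<le>half. int (quartic_coeff k) * 128 ^ (p - 1 - k))
      + (\<Sum>k\<in>{..<p} - {..half}. int (quartic_coeff k) * 128 ^ (p - 1 - k))"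
    unfolding B_def using two_half odd_p by (subst add.commute, intro sum.subset_diff) auto
  have "[B = (\<Sum>k\<le>half. int (half choose (2 * k)) * int ((2 * k) choose k) * 2 ^ k * 4 ^ (half - 2 * k))
      + (\<Sum>k\<in>{..<p} - {..half}. 0)] (mod int p)"
    unfolding split
  proof (intro cong_add cong_sum)
    fix k assume k: "k \<in> {..<p} - {..half}"
    then have "[int ((2 * k) choose k) = 0] (mod int p)"
      using central_binomial_cong [of k] by (simp add: binomial_eq_0)
    then show "[int (quartic_coeff k) * 128 ^ (p - 1 - k) = 0] (mod int p)"
      by (simp add: cong_0_iff)
  next
    fix k assume k: "k \<in> {..half}"
    then have "2 * k < p" using two_half odd_p by auto
    from central_binomial_cong [OF this]
    have c: "[int ((4 * k) choose (2 * k)) = 16 ^ k * int (half choose (2 * k))] (mod int p)"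
      by (simp add: power_mult)
    show "[int (quartic_coeff k) * 128 ^ (p - 1 - k)
        = int (half choose (2 * k)) * int ((2 * k) choose k) * 2 ^ k * 4 ^ (half - 2 * k)] (mod int p)"
    proof (cases "2 * k \<le> half")
      case True
      \<comment> \<open>both sides are the same power of 2; the excess \<open>(2 ^ (p - 1)) ^ 6\<close> is 1 modulo \<open>p\<close>\<close>
      have two: "(16 :: int) ^ k * 128 ^ (p - 1 - k) = (2 ^ (p - 1)) ^ 6 * (2 ^ k * 4 ^ (half - 2 * k))"
      proof -
        have "(16 :: int) ^ k * 128 ^ (p - 1 - k) = 2 ^ (4 * k + 7 * (p - 1 - k))"
          by (simp add: power_add power_mult)
        also have "4 * k + 7 * (p - 1 - k) = (p - 1) * 6 + (k + 2 * (half - 2 * k))"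
          using True two_half by linarith
        also have "(2 :: int) ^ \<dots> = (2 ^ (p - 1)) ^ 6 * (2 ^ k * 4 ^ (half - 2 * k))"
          by (simp add: power_add power_mult)
        finally show ?thesis .
      qed
      have "[int (quartic_coeff k) * 128 ^ (p - 1 - k)
          = (16 ^ k * int (half choose (2 * k))) * int ((2 * k) choose k) * 128 ^ (p - 1 - k)] (mod int p)"
        unfolding of_nat_mult by (intro cong_mult cong_refl c)
      also have "(16 ^ k * int (half choose (2 * k))) * int ((2 * k) choose k) * 128 ^ (p - 1 - k)
          = (16 ^ k * 128 ^ (p - 1 - k)) * (int (half choose (2 * k)) * int ((2 * k) choose k))"
        by (simp only: mult_ac)
      also have "\<dots> = (2 ^ (p - 1)) ^ 6 * (2 ^ k * 4 ^ (half - 2 * k)) * (int (half choose (2 * k)) * int ((2 * k) choose k))"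
        by (simp only: two)
      also have "[\<dots> = 1 ^ 6 * (2 ^ k * 4 ^ (half - 2 * k)) * (int (half choose (2 * k)) * int ((2 * k) choose k))] (mod int p)"
        by (intro cong_mult cong_refl cong_pow fermat not_p_dvd_2)
      finally show ?thesis by (simp add: mult_ac)
    next
      case False
      then have z: "half choose (2 * k) = 0" by (simp add: binomial_eq_0)
      have "int p dvd int ((4 * k) choose (2 * k))"
        using c unfolding z of_nat_0 mult_zero_right cong_0_iff .
      then show ?thesis unfolding z of_nat_0 mult_zero_left cong_0_iff of_nat_mult
        by (intro dvd_mult2)
    qed
  qed
  then have "[B = A] (mod int p)"
    unfolding A_def sum.neutral_const add_0_right .
  then have "[- A = - B] (mod int p)"
    by (rule cong_minus_minus_iff [THEN iffD2, OF cong_sym])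
  with curve_sum_cong_sum show ?thesis unfolding A_def B_def by (rule cong_trans)
qed

section \<open>Lucas congruences\<close>

lemma p_dvd_binomial: "0 < a \<Longrightarrow> a < p \<Longrightarrow> p dvd (p choose a)"
  using prime by (simp add: dvd_choose_prime)

text \<open>
  Vandermonde's identity, in which \<open>p choose a\<close> vanishes modulo \<open>p\<close> except for \<open>a = 0\<close> and \<open>a = p\<close>.
\<close>

lemma binomial_add_p:
  "[int ((N + p) choose j) = int (N choose j) + (if p \<le> j then int (N choose (j - p)) else 0)] (mod int p)"
proof -
  let ?t = "\<lambda>a. int (p choose a) * int (N choose (j - a))"
  have "int ((N + p) choose j) = (\<Sum>a\<le>j. ?t a)"
    unfolding add.commute [of N p] vandermonde [of p N j, symmetric] of_nat_sum of_nat_mult by (rule refl)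
  also have "[(\<Sum>a\<le>j. ?t a) = (\<Sum>a\<le>j. (if a = 0 then int (N choose j) else 0) + (if a = p then int (N choose (j - p)) else 0))] (mod int p)"
  proof (rule cong_sum)
    fix a
    consider "a = 0" | "0 < a" "a < p" | "a = p" | "p < a" by linarith
    then show "[?t a = (if a = 0 then int (N choose j) else 0) + (if a = p then int (N choose (j - p)) else 0)] (mod int p)"
    proof cases
      case 2
      then have "int p dvd int (p choose a)" by (simp add: p_dvd_binomial)
      with 2 show ?thesis by (simp add: cong_0_iff)
    qed (use odd_p in \<open>auto simp: binomial_eq_0\<close>)
  qed
  also have "(\<Sum>a\<le>j. (if a = 0 then int (N choose j) else 0) + (if a = p then int (N choose (j - p)) else 0))
      = int (N choose j) + (if p \<le> j then int (N choose (j - p)) else 0)"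
    by (simp add: sum.distrib)
  finally show ?thesis .
qed

lemma lucas:
  assumes "k < p" "j < p"
  shows "[int ((k + p * m) choose (j + p * i)) = int (k choose j) * int (m choose i)] (mod int p)"
proof (induction m arbitrary: i)
  case 0
  show ?case
  proof (cases i)
    case (Suc i')
    then have "k < j + p * i" using assms(1) by (simp add: trans_less_add1 trans_less_add2)
    then show ?thesis using Suc by (simp add: binomial_eq_0)
  qed simp
next
  case (Suc m)
  have e: "k + p * Suc m = (k + p * m) + p" by simp
  show ?case
  proof (cases i)
    case 0
    then show ?thesis using binomial_add_p [of "k + p * m" j] Suc.IH [of 0] assms(2)
      unfolding e by (auto intro: cong_trans)
  next
    case i: (Suc i')
    have "j + p * i - p = j + p * i'" "p \<le> j + p * i" by (simp_all add: i)
    then have "[int (((k + p * m) + p) choose (j + p * i))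
        = int ((k + p * m) choose (j + p * i)) + int ((k + p * m) choose (j + p * i'))] (mod int p)"
      using binomial_add_p [of "k + p * m" "j + p * i"] by simp
    also have "[int ((k + p * m) choose (j + p * i)) + int ((k + p * m) choose (j + p * i'))
        = int (k choose j) * int (m choose i) + int (k choose j) * int (m choose i')] (mod int p)"
      by (intro cong_add Suc.IH)
    also have "int (k choose j) * int (m choose i) + int (k choose j) * int (m choose i')
        = int (k choose j) * int (Suc m choose i)"
      by (simp add: i distrib_left)
    finally show ?thesis unfolding e .
  qed
qed

text \<open>
  Doubling the last digit \<open>k\<close> produces a carry, and the new last digit \<open>2 k - p\<close> is less than \<open>k\<close>.
\<close>

lemma central_binomial_p_dvd:
  assumes "k < p" "p \<le> 2 * k"
  shows "int p dvd int ((2 * (k + p * m)) choose (k + p * m))"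
proof -
  have e: "2 * (k + p * m) = (2 * k - p) + p * (2 * m + 1)" and "2 * k - p < p" and less: "2 * k - p < k"
    using assms by (simp_all add: algebra_simps)
  then have "[int ((2 * (k + p * m)) choose (k + p * m)) = int ((2 * k - p) choose k) * int ((2 * m + 1) choose m)] (mod int p)"
    unfolding e by (intro lucas assms)
  with less show ?thesis by (simp add: binomial_eq_0 cong_0_iff)
qed

lemma central_binomial_lucas:
  assumes "k < p"
  shows "[int ((2 * (k + p * m)) choose (k + p * m)) = int ((2 * k) choose k) * int ((2 * m) choose m)] (mod int p)"
proof (cases "2 * k < p")
  case True
  have "2 * (k + p * m) = 2 * k + p * (2 * m)" by (simp add: algebra_simps)
  then show ?thesis using lucas [OF True assms, of "2 * m" m] by (simp only:)
next
  case False
  then have "int p dvd int ((2 * k) choose k)" "int p dvd int ((2 * (k + p * m)) choose (k + p * m))"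
    using central_binomial_p_dvd [OF assms, of 0] central_binomial_p_dvd [OF assms, of m] by simp_all
  then show ?thesis by (simp add: cong_iff_dvd_diff)
qed

lemma sum_by_blocks: "(\<Sum>j<M * p. g j) = (\<Sum>i<M. \<Sum>j<p. (g (j + p * i) :: int))"
proof -
  have "sum g {i * p..<i * p + p} = (\<Sum>j<p. g (j + p * i))" for i
    using sum.shift_bounds_nat_ivl [of g 0 "i * p" p]
    by (simp add: lessThan_atLeast0 add.commute mult.commute)
  then show ?thesis using sum.nat_group [of g p M] by simp
qed

text \<open>
  Group the summation index by its last digit in base \<open>p\<close> and apply \<open>lucas\<close> to each term.
\<close>

lemma franel_lucas:
  assumes "k < p"
  shows "[int (franel (k + p * m)) = int (franel k) * int (franel m)] (mod int p)"
proof -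
  have ext: "int (franel n) = (\<Sum>j<N. int (n choose j) ^ 3)" if "n < N" for n N
    unfolding franel_def of_nat_sum of_nat_power
    by (rule sum.mono_neutral_left) (use that in auto)
  have "k + p * m < Suc m * p" using assms by simp
  from ext [OF this] have "int (franel (k + p * m)) = (\<Sum>i<Suc m. \<Sum>j<p. int ((k + p * m) choose (j + p * i)) ^ 3)"
    by (simp only: sum_by_blocks)
  also have "[\<dots> = (\<Sum>i<Suc m. \<Sum>j<p. (int (k choose j) * int (m choose i)) ^ 3)] (mod int p)"
    by (intro cong_sum cong_pow lucas assms) auto
  also have "(\<Sum>i<Suc m. \<Sum>j<p. (int (k choose j) * int (m choose i)) ^ 3)
      = (\<Sum>j<p. int (k choose j) ^ 3) * (\<Sum>i<Suc m. int (m choose i) ^ 3)"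
    unfolding sum_product by (subst sum.swap) (simp only: power_mult_distrib)
  also have "\<dots> = int (franel k) * int (franel m)"
    using ext [OF assms] ext [of m "Suc m"] by simp
  finally show ?thesis .
qed

definition lucas_seq :: "(nat \<Rightarrow> int) \<Rightarrow> bool" where
  "lucas_seq a \<longleftrightarrow> (\<forall>k m. k < p \<longrightarrow> [a (k + p * m) = a k * a m] (mod int p))"

lemma lucas_seq_central_franel: "lucas_seq (\<lambda>n. int (central_franel n))"
  unfolding lucas_seq_def
proof (intro allI impI)
  fix k m assume "k < p"
  from cong_mult [OF central_binomial_lucas [OF this, of m] franel_lucas [OF this, of m]]
  show "[int (((2 * (k + p * m)) choose (k + p * m)) * franel (k + p * m))
      = int (central_franel k) * int (central_franel m)] (mod int p)"
    by (simp only: of_nat_mult mult_ac)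
qed

lemma lucas_seq_quartic: "lucas_seq (\<lambda>n. int (quartic_coeff n))"
  unfolding lucas_seq_def
proof (intro allI impI)
  fix k m assume k: "k < p"
  show "[int (((4 * (k + p * m)) choose (2 * (k + p * m))) * ((2 * (k + p * m)) choose (k + p * m)))
      = int (quartic_coeff k) * int (quartic_coeff m)] (mod int p)"
  proof (cases "2 * k < p")
    case True
    have e: "2 * (2 * (k + p * m)) = 4 * (k + p * m)" "2 * k + p * (2 * m) = 2 * (k + p * m)"
      "2 * (2 * k) = 4 * k" "2 * (2 * m) = 4 * m" by (simp_all add: algebra_simps)
    from cong_mult [OF central_binomial_lucas [OF True, of "2 * m", unfolded e] central_binomial_lucas [OF k, of m]]
    show ?thesis by (simp only: of_nat_mult mult_ac)
  next
    case False
    then have "int p dvd int ((2 * k) choose k)" "int p dvd int ((2 * (k + p * m)) choose (k + p * m))"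
      using central_binomial_p_dvd [OF k, of 0] central_binomial_p_dvd [OF k, of m] by simp_all
    then show ?thesis unfolding cong_iff_dvd_diff of_nat_mult
      by (intro dvd_diff) (simp_all add: dvd_mult dvd_mult2)
  qed
qed

section \<open>The Frobenius map on integral power series\<close>

lemma freshman:
  fixes F G :: "'a :: comm_ring_1"
  shows "of_nat p dvd (F + G) ^ p - (F ^ p + G ^ p)"
proof -
  have "(F + G) ^ p = (\<Sum>k\<le>p. of_nat (p choose k) * F ^ k * G ^ (p - k))" by (rule binomial_ring)
  also have "\<dots> = (\<Sum>k\<in>{0, p}. of_nat (p choose k) * F ^ k * G ^ (p - k))
      + (\<Sum>k\<in>{..p} - {0, p}. of_nat (p choose k) * F ^ k * G ^ (p - k))"
    by (subst add.commute, rule sum.subset_diff) auto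
  also have "(\<Sum>k\<in>{0, p}. of_nat (p choose k) * F ^ k * G ^ (p - k)) = F ^ p + G ^ p"
    using odd_p by simp
  finally have "(F + G) ^ p - (F ^ p + G ^ p) = (\<Sum>k\<in>{..p} - {0, p}. of_nat (p choose k) * F ^ k * G ^ (p - k))"
    by simp
  moreover have "of_nat p dvd (\<Sum>k\<in>{..p} - {0, p}. of_nat (p choose k) * F ^ k * G ^ (p - k))"
  proof (rule dvd_sum)
    fix k assume "k \<in> {..p} - {0, p}"
    then have "p dvd (p choose k)" by (intro p_dvd_binomial) auto
    then have "(of_nat p :: 'a) dvd of_nat (p choose k)" by (auto elim!: dvdE)
    then show "of_nat p dvd of_nat (p choose k) * F ^ k * G ^ (p - k)" by (intro dvd_mult2)
  qed
  ultimately show ?thesis by simp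
qed

definition fcong :: "int fps \<Rightarrow> int fps \<Rightarrow> bool" where
  "fcong F G \<longleftrightarrow> of_nat p dvd F - G"

lemma fps_of_nat_dvd_iff: "of_nat m dvd (F :: int fps) \<longleftrightarrow> (\<forall>n. int m dvd fps_nth F n)"
proof
  assume "of_nat m dvd F"
  then obtain G where "F = of_nat m * G" by (rule dvdE)
  then have "fps_nth F n = int m * fps_nth G n" for n by (simp add: fps_of_nat [symmetric])
  then show "\<forall>n. int m dvd fps_nth F n" by simp
next
  assume "\<forall>n. int m dvd fps_nth F n"
  then have "F = of_nat m * Abs_fps (\<lambda>n. fps_nth F n div int m)"
    by (intro fps_ext) (simp add: fps_of_nat [symmetric])
  then show "of_nat m dvd F" by (rule dvdI)
qed

lemma fcong_iff: "fcong F G \<longleftrightarrow> (\<forall>n. [fps_nth F n = fps_nth G n] (mod int p))"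
  by (simp add: fcong_def fps_of_nat_dvd_iff cong_iff_dvd_diff)

lemma fcong_refl [simp]: "fcong F F" by (simp add: fcong_def)

lemma fcong_sym: "fcong F G \<Longrightarrow> fcong G F"
  by (simp add: fcong_iff cong_sym)

lemma fcong_trans [trans]: "fcong F G \<Longrightarrow> fcong G H \<Longrightarrow> fcong F H"
  unfolding fcong_iff using cong_trans by blast

lemma fcong_mult: "fcong F G \<Longrightarrow> fcong H L \<Longrightarrow> fcong (F * H) (G * L)"
proof -
  assume "fcong F G" "fcong H L"
  moreover have "F * H - G * L = (F - G) * H + G * (H - L)" by (simp add: algebra_simps)
  ultimately show ?thesis unfolding fcong_def by (simp only: dvd_add dvd_mult dvd_mult2)
qed

lemma freshman_fps: "fcong ((F + G) ^ p) (F ^ p + G ^ p)"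
  unfolding fcong_def by (rule freshman)

lemma int_power_p: "[(a :: int) ^ p = a] (mod int p)"
proof (cases "int p dvd a")
  case True
  then have "int p dvd a ^ p" using odd_p by (simp add: p_dvd_power_iff)
  with True show ?thesis by (simp add: cong_iff_dvd_diff)
next
  case False
  then have "[a * a ^ (p - 1) = a * 1] (mod int p)" by (intro cong_mult cong_refl fermat)
  moreover have "a * a ^ (p - 1) = a ^ p" using odd_p by (cases p) simp_all
  ultimately show ?thesis by simp
qed

text \<open>
  Frobenius: \<open>F ^ p\<close> is congruent to \<open>F\<close> evaluated at \<open>X ^ p\<close>. The coefficient of degree \<open>n\<close> only
  depends on the truncation of \<open>F\<close> after degree \<open>n\<close>, to which the freshman's dream applies term
  by term.
\<close>

lemma fps_power_p_nth:
  "[fps_nth (F ^ p) n = (if p dvd n then fps_nth F (n div p) else 0)] (mod int p)"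
proof -
  define T where "T N = (\<Sum>i<N. fps_const (fps_nth F i) * fps_X ^ i)" for N
  have T: "[fps_nth (T N ^ p) n = (\<Sum>i<N. if i * p = n then fps_nth F i else 0)] (mod int p)" for N
  proof (induction N)
    case 0 then show ?case using odd_p by (simp add: T_def power_0_left)
  next
    case (Suc N)
    have "T (Suc N) = T N + fps_const (fps_nth F N) * fps_X ^ N" by (simp add: T_def)
    then have "[fps_nth (T (Suc N) ^ p) n = fps_nth (T N ^ p + (fps_const (fps_nth F N) * fps_X ^ N) ^ p) n] (mod int p)"
      using freshman_fps unfolding fcong_iff by simp
    also have "fps_nth (T N ^ p + (fps_const (fps_nth F N) * fps_X ^ N) ^ p) n
        = fps_nth (T N ^ p) n + (if N * p = n then fps_nth F N ^ p else 0)"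
      by (auto simp: power_mult_distrib fps_const_power simp flip: power_mult)
    also have "[\<dots> = (\<Sum>i<N. if i * p = n then fps_nth F i else 0) + (if N * p = n then fps_nth F N else 0)] (mod int p)"
      using int_power_p by (intro cong_add Suc.IH) simp
    finally show ?case by simp
  qed
  define R where "R = fps_shift (Suc n) F"
  have split: "F = T (Suc n) + fps_X ^ Suc n * R"
  proof (rule fps_ext)
    fix j
    have "fps_nth (T (Suc n)) j = (\<Sum>i<Suc n. if i = j then fps_nth F i else 0)"
      unfolding T_def fps_sum_nth by (intro sum.cong refl) auto
    then have "fps_nth (T (Suc n)) j = (if j < Suc n then fps_nth F j else 0)" by simp
    then show "fps_nth F j = fps_nth (T (Suc n) + fps_X ^ Suc n * R) j"
      by (simp add: R_def fps_X_power_mult_nth del: power_Suc)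
  qed
  have "[fps_nth (F ^ p) n = fps_nth (T (Suc n) ^ p + (fps_X ^ Suc n * R) ^ p) n] (mod int p)"
    using freshman_fps [of "T (Suc n)" "fps_X ^ Suc n * R"] split unfolding fcong_iff by simp
  also have "fps_nth ((fps_X ^ Suc n * R) ^ p) n = 0"
  proof -
    have "n < Suc n * p" using odd_p by (cases p) auto
    then show ?thesis
      by (simp add: power_mult_distrib fps_X_power_mult_nth del: power_Suc flip: power_mult)
  qed
  then have "fps_nth (T (Suc n) ^ p + (fps_X ^ Suc n * R) ^ p) n = fps_nth (T (Suc n) ^ p) n" by simp
  also have "[\<dots> = (\<Sum>i<Suc n. if i * p = n then fps_nth F i else 0)] (mod int p)" by (rule T)
  also have "(\<Sum>i<Suc n. if i * p = n then fps_nth F i else 0) = (if p dvd n then fps_nth F (n div p) else 0)"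
  proof (cases "p dvd n")
    case True
    then have "i * p = n \<longleftrightarrow> i = n div p" for i using odd_p by auto
    moreover have "n div p < Suc n" by (simp add: less_Suc_eq_le)
    ultimately show ?thesis using True by simp
  qed (auto intro!: sum.neutral)
  finally show ?thesis .
qed

text \<open>
  The coefficient of degree \<open>n\<close> of the product on the right has a single term, from the last
  digit of \<open>n\<close> in the truncation and the remaining digits in the \<open>p\<close>-th power; it is
  \<open>a (n mod p) * a (n div p)\<close>.
\<close>

lemma lucas_seq_fcong:
  assumes "lucas_seq a"
  shows "fcong (Abs_fps a) ((\<Sum>k<p. fps_const (a k) * fps_X ^ k) * Abs_fps a ^ p)"
  unfolding fcong_iff
proof
  fix n
  let ?T = "\<Sum>k<p. fps_const (a k) * fps_X ^ k"
  have T: "fps_nth ?T j = (if j < p then a j else 0)" for j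
  proof -
    have "fps_nth ?T j = (\<Sum>i<p. if i = j then a i else 0)"
      unfolding fps_sum_nth by (intro sum.cong refl) auto
    then show ?thesis by simp
  qed
  have np: "n mod p < p" using odd_p by simp
  have pw: "[fps_nth (Abs_fps a ^ p) j = (if p dvd j then a (j div p) else 0)] (mod int p)" for j
    using fps_power_p_nth [of "Abs_fps a" j] unfolding fps_nth_Abs_fps .
  have "[fps_nth (?T * Abs_fps a ^ p) n
      = (\<Sum>i=0..n. (if i < p then a i else 0) * (if p dvd n - i then a ((n - i) div p) else 0))] (mod int p)"
    unfolding fps_mult_nth T by (intro cong_sum cong_mult cong_refl pw)
  also have "(\<Sum>i=0..n. (if i < p then a i else 0) * (if p dvd n - i then a ((n - i) div p) else 0))
      = (\<Sum>i=0..n. if i = n mod p then a (n mod p) * a (n div p) else 0)"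
  proof (intro sum.cong refl)
    fix i assume "i \<in> {0..n}"
    then have "i < p \<and> p dvd n - i \<longleftrightarrow> i = n mod p"
      using np by (auto simp: mod_eq_dvd_iff_nat [symmetric])
    moreover have "(n - n mod p) div p = n div p" using odd_p by (simp add: minus_mod_eq_mult_div)
    ultimately show "(if i < p then a i else 0) * (if p dvd n - i then a ((n - i) div p) else 0)
        = (if i = n mod p then a (n mod p) * a (n div p) else 0)"
      by auto
  qed
  also have "\<dots> = a (n mod p) * a (n div p)" by simp
  also have "[\<dots> = a (n mod p + p * (n div p))] (mod int p)"
    using assms np unfolding lucas_seq_def by (blast intro: cong_sym)
  finally show "[fps_nth (Abs_fps a) n = fps_nth (?T * Abs_fps a ^ p) n] (mod int p)"
    by (simp add: cong_sym_eq)
qed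

end

section \<open>Reduction of the identity modulo the prime\<close>

text \<open>
  The identities between power series were derived over the rationals. All series involved have
  integral coefficients, so the identities hold over the integers, where they can be reduced.
\<close>

definition to_rat_fps :: "int fps \<Rightarrow> rat fps" where
  "to_rat_fps F = Abs_fps (\<lambda>n. of_int (fps_nth F n))"

lemma to_rat_fps_nth [simp]: "fps_nth (to_rat_fps F) n = of_int (fps_nth F n)"
  by (simp add: to_rat_fps_def)

lemma to_rat_fps_inject: "to_rat_fps F = to_rat_fps G \<longleftrightarrow> F = G"
  by (simp add: fps_eq_iff)

lemma to_rat_fps_hom:
  "to_rat_fps (F + G) = to_rat_fps F + to_rat_fps G" "to_rat_fps (F - G) = to_rat_fps F - to_rat_fps G"
  "to_rat_fps (F * G) = to_rat_fps F * to_rat_fps G" "to_rat_fps 1 = 1"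
  "to_rat_fps (numeral k) = numeral k" "to_rat_fps fps_X = fps_X"
  by (rule fps_ext, simp add: fps_mult_nth fps_numeral_fps_const fps_X_def)+

lemma to_rat_fps_power: "to_rat_fps (F ^ n) = to_rat_fps F ^ n"
  by (induction n) (simp_all add: to_rat_fps_hom)

lemma to_rat_fps_compose: "to_rat_fps (F oo G) = to_rat_fps F oo to_rat_fps G"
  by (rule fps_ext) (simp add: fps_compose_nth flip: to_rat_fps_power)

context
  fixes P q r S M :: "int fps"
  defines "P \<equiv> (1 + fps_X) * (1 - 8 * fps_X)"
    and "q \<equiv> 1 + 8 * (fps_X * fps_X)"
    and "r \<equiv> 1 - 4 * fps_X - 8 * (fps_X * fps_X)"
    and "S \<equiv> Abs_fps (\<lambda>n. int (central_franel n))"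
    and "M \<equiv> Abs_fps (\<lambda>n. int (quartic_coeff n))"
begin

text \<open>
  The combination \<open>r S(z) = q M(y)\<^sup>2\<close> of \<open>central_franel_compose\<close> and \<open>quartic_compose\<close>, in which
  \<open>G\<close> is eliminated. The equations for \<open>z\<close> and \<open>y\<close> replace their definitions as quotients.
\<close>

lemma integral_identity:
  obtains z y :: "int fps"
  where "fps_nth z 0 = 0" "fps_nth y 0 = 0"
    "z * (q * q) = fps_X * P" "y * (r * r) = fps_X * (fps_X * (fps_X * (1 + fps_X)))"
    "r * (S oo z) = q * ((M oo y) * (M oo y))"
proof -
  define Q where "Q = fps_right_inverse q 1"
  have qQ: "q * Q = 1" unfolding Q_def by (rule fps_right_inverse) (simp add: q_def)
  define R where "R = fps_right_inverse r 1"
  have rR: "r * R = 1" unfolding R_def by (rule fps_right_inverse) (simp add: r_def)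
  define z where "z = fps_X * P * (Q * Q)"
  define y where "y = fps_X * (fps_X * (fps_X * (1 + fps_X))) * (R * R)"
  have q: "to_rat_fps q = qf" by (simp add: q_def qf_def to_rat_fps_hom)
  have r: "to_rat_fps r = rf" by (simp add: r_def rf_def to_rat_fps_hom)
  have "qf * to_rat_fps Q = 1" unfolding q [symmetric] to_rat_fps_hom(3) [symmetric] qQ to_rat_fps_hom(4) ..
  then have Q: "to_rat_fps Q = inverse qf" by (rule fps_inverse_unique [symmetric])
  have "rf * to_rat_fps R = 1" unfolding r [symmetric] to_rat_fps_hom(3) [symmetric] rR to_rat_fps_hom(4) ..
  then have R: "to_rat_fps R = inverse rf" by (rule fps_inverse_unique [symmetric])
  have z: "to_rat_fps z = zf" by (simp add: z_def zf_def to_rat_fps_hom P_def Pf_def Q)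
  have y: "to_rat_fps y = yf" by (simp add: y_def yf_def to_rat_fps_hom R)
  have S: "to_rat_fps S = central_franel_fps" by (rule fps_ext) (simp add: S_def central_franel_fps_def)
  have M: "to_rat_fps M = quartic_fps" by (rule fps_ext) (simp add: M_def quartic_fps_def)
  have "to_rat_fps (r * (S oo z)) = rf * (qf * (franel_fps * franel_fps))"
    by (simp add: to_rat_fps_hom to_rat_fps_compose r z S central_franel_compose)
  also have "\<dots> = qf * (rf * (franel_fps * franel_fps))" by (simp only: mult_ac)
  also have "\<dots> = to_rat_fps (q * ((M oo y) * (M oo y)))"
    by (simp add: to_rat_fps_hom to_rat_fps_compose q y M quartic_compose)
  finally have id: "r * (S oo z) = q * ((M oo y) * (M oo y))" by (simp only: to_rat_fps_inject)
  have "z * (q * q) = fps_X * P * ((q * Q) * (q * Q))" unfolding z_def by (simp only: mult_ac)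
  moreover have "y * (r * r) = fps_X * (fps_X * (fps_X * (1 + fps_X))) * ((r * R) * (r * R))"
    unfolding y_def by (simp only: mult_ac)
  ultimately show ?thesis
    using that [of z y] id by (simp add: qQ rR z_def y_def mult.assoc)
qed

end

context odd_prime
begin

lemma fcong_compose: "fcong F G \<Longrightarrow> fcong (F oo z) (G oo z)"
  unfolding fcong_iff fps_compose_nth by (auto intro!: cong_sum cong_mult)

lemma fcong_cancel:
  assumes "fps_nth V 0 = 1" and "fcong (V * F) (V * G)"
  shows "fcong F G"
proof -
  have V: "V * fps_right_inverse V 1 = 1" using assms(1) by (intro fps_right_inverse) simp
  have "fcong (V * F * fps_right_inverse V 1) (V * G * fps_right_inverse V 1)"
    by (intro fcong_mult assms(2) fcong_refl)
  moreover have "V * H * fps_right_inverse V 1 = H" for H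
    using V by (metis mult.assoc mult.commute mult_1)
  ultimately show ?thesis by simp
qed

lemma lucas_seq_compose:
  assumes "lucas_seq a" and z: "fps_nth z 0 = 0"
  shows "fcong (Abs_fps a oo z) ((\<Sum>k<p. fps_const (a k) * z ^ k) * (Abs_fps a oo z) ^ p)"
proof -
  have "((\<Sum>k<p. fps_const (a k) * fps_X ^ k) * Abs_fps a ^ p) oo z
      = (\<Sum>k<p. fps_const (a k) * z ^ k) * (Abs_fps a oo z) ^ p"
    by (simp add: fps_compose_mult_distrib [OF z] fps_compose_sum_distrib fps_compose_power [OF z, symmetric] z)
  then show ?thesis using fcong_compose [OF lucas_seq_fcong [OF assms(1)], of z] by simp
qed

text \<open>
  Clearing denominators in a truncated series at \<open>z = N / q\<^sup>2\<close>.
\<close>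

lemma scaled_truncation:
  fixes z q N :: "'a :: comm_ring_1"
  assumes "z * (q * q) = N"
  shows "q ^ (2 * (p - 1)) * (\<Sum>k<p. c k * z ^ k) = (\<Sum>k<p. c k * N ^ k * q ^ (2 * (p - 1 - k)))"
  unfolding sum_distrib_left
proof (intro sum.cong refl)
  fix k assume "k \<in> {..<p}"
  then have "2 * (p - 1) = 2 * k + 2 * (p - 1 - k)" by auto
  then have "q ^ (2 * (p - 1)) = (q * q) ^ k * q ^ (2 * (p - 1 - k))"
    by (simp only: power_add power_mult power2_eq_square)
  then show "q ^ (2 * (p - 1)) * (c k * z ^ k) = c k * N ^ k * q ^ (2 * (p - 1 - k))"
    unfolding assms [symmetric] power_mult_distrib by (simp only: mult_ac)
qed

text \<open>
  Let \<open>s = S(z)\<close> and \<open>m = M(y)\<close>, with truncations \<open>\<sigma>\<close> and \<open>\<mu>\<close>, so that \<open>s = \<sigma> s ^ p\<close> and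
  \<open>m = \<mu> m ^ p\<close> modulo \<open>p\<close>. Comparing \<open>r s = q m\<^sup>2\<close> with its \<open>p\<close>-th power gives
  \<open>q ^ (p - 1) \<sigma> = r ^ (p - 1) \<mu>\<^sup>2\<close> modulo \<open>p\<close>, after cancelling the invertible series \<open>V\<close>. The
  remaining powers of \<open>q\<close> and \<open>r\<close> clear the denominators of \<open>z\<close> and \<open>y\<close>.
\<close>

lemma truncated_polynomial_fcong:
  fixes q r P Y :: "int fps"
  defines "q \<equiv> 1 + 8 * (fps_X * fps_X)"
    and "r \<equiv> 1 - 4 * fps_X - 8 * (fps_X * fps_X)"
    and "P \<equiv> fps_X * ((1 + fps_X) * (1 - 8 * fps_X))"
    and "Y \<equiv> fps_X * (fps_X * (fps_X * (1 + fps_X)))"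
  shows "fcong
    (r ^ (3 * (p - 1)) * (\<Sum>k<p. fps_const (int (central_franel k)) * P ^ k * q ^ (2 * (p - 1 - k))))
    (q ^ (p - 1) * (\<Sum>k<p. fps_const (int (quartic_coeff k)) * Y ^ k * r ^ (2 * (p - 1 - k)))\<^sup>2)"
proof -
  define S M where "S = Abs_fps (\<lambda>n. int (central_franel n))"
    and "M = Abs_fps (\<lambda>n. int (quartic_coeff n))"
  obtain z y where z: "fps_nth z 0 = 0" "z * (q * q) = P" and y: "fps_nth y 0 = 0" "y * (r * r) = Y"
    and id: "r * (S oo z) = q * ((M oo y) * (M oo y))"
    unfolding q_def r_def P_def Y_def S_def M_def by (rule integral_identity)
  define s m where "s = S oo z" and "m = M oo y"
  define \<sigma> \<mu> where "\<sigma> = (\<Sum>k<p. fps_const (int (central_franel k)) * z ^ k)"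
    and "\<mu> = (\<Sum>k<p. fps_const (int (quartic_coeff k)) * y ^ k)"
  have s: "fcong s (\<sigma> * s ^ p)"
    unfolding s_def S_def \<sigma>_def by (rule lucas_seq_compose [OF lucas_seq_central_franel z(1)])
  have m: "fcong m (\<mu> * m ^ p)"
    unfolding m_def M_def \<mu>_def by (rule lucas_seq_compose [OF lucas_seq_quartic y(1)])
  have rs: "r * s = q * (m * m)" using id by (simp only: s_def m_def)
  have pow: "F ^ p = F ^ (p - 1) * F" for F :: "int fps"
    using odd_p by (cases p) simp_all
  define V where "V = q * (m ^ p * m ^ p)"
  have V0: "fps_nth V 0 = 1"
    by (simp add: V_def q_def m_def M_def fps_nth_power_0)
  have "fcong (V * (q ^ (p - 1) * \<sigma>)) (V * (r ^ (p - 1) * (\<mu> * \<mu>)))"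
  proof -
    have "V * (q ^ (p - 1) * \<sigma>) = \<sigma> * (q ^ (p - 1) * q) * (m ^ p * m ^ p)"
      unfolding V_def by (simp only: mult_ac)
    also have "\<dots> = \<sigma> * (q * (m * m)) ^ p"
      by (simp only: pow [of q] power_mult_distrib mult_ac)
    also have "\<dots> = \<sigma> * (r ^ (p - 1) * r) * s ^ p"
      unfolding rs [symmetric] by (simp only: power_mult_distrib pow [of r] mult_ac)
    also have "\<dots> = r ^ (p - 1) * (r * (\<sigma> * s ^ p))" by (simp only: mult_ac)
    also have "fcong \<dots> (r ^ (p - 1) * (r * s))"
      by (intro fcong_mult fcong_refl fcong_sym [OF s])
    also have "r ^ (p - 1) * (r * s) = r ^ (p - 1) * (q * (m * m))" by (simp only: rs)
    also have "fcong \<dots> (r ^ (p - 1) * (q * ((\<mu> * m ^ p) * (\<mu> * m ^ p))))"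
      by (intro fcong_mult fcong_refl m)
    also have "r ^ (p - 1) * (q * ((\<mu> * m ^ p) * (\<mu> * m ^ p))) = V * (r ^ (p - 1) * (\<mu> * \<mu>))"
      unfolding V_def by (simp only: mult_ac)
    finally show ?thesis .
  qed
  from fcong_cancel [OF V0 this] have core: "fcong (q ^ (p - 1) * \<sigma>) (r ^ (p - 1) * (\<mu> * \<mu>))" .
  have e: "3 * (p - 1) + (p - 1) = 2 * (p - 1) + 2 * (p - 1)" "2 * (p - 1) = (p - 1) + (p - 1)" by simp_all
  have "r ^ (3 * (p - 1)) * (q ^ (2 * (p - 1)) * \<sigma>) = r ^ (3 * (p - 1)) * q ^ (p - 1) * (q ^ (p - 1) * \<sigma>)"
    unfolding e(2) power_add by (simp only: mult_ac)
  also have "fcong \<dots> (r ^ (3 * (p - 1)) * q ^ (p - 1) * (r ^ (p - 1) * (\<mu> * \<mu>)))"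
    by (intro fcong_mult fcong_refl core)
  also have "r ^ (3 * (p - 1)) * q ^ (p - 1) * (r ^ (p - 1) * (\<mu> * \<mu>))
      = r ^ (3 * (p - 1) + (p - 1)) * (q ^ (p - 1) * (\<mu> * \<mu>))"
    by (simp only: power_add mult_ac)
  also have "\<dots> = q ^ (p - 1) * (r ^ (2 * (p - 1)) * \<mu>)\<^sup>2"
    unfolding e(1) by (simp only: power_add power2_eq_square mult_ac)
  finally show ?thesis
    unfolding \<sigma>_def \<mu>_def scaled_truncation [OF z(2)] scaled_truncation [OF y(2)] .
qed

lemma fcong_poly_eval:
  assumes "fcong (fps_of_poly A) (fps_of_poly B)"
  shows "[poly A x = poly B x] (mod int p)"
proof -
  have "int p dvd poly.coeff (A - B) i" for i
    using assms by (simp add: fcong_iff cong_iff_dvd_diff)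
  then have "int p dvd poly (A - B) x"
    unfolding poly_altdef by (intro dvd_sum dvd_mult2)
  then show ?thesis by (simp add: cong_iff_dvd_diff)
qed

lemma truncated_polynomial_cong:
  fixes x :: int
  defines "q \<equiv> 1 + 8 * (x * x)"
    and "r \<equiv> 1 - 4 * x - 8 * (x * x)"
    and "P \<equiv> x * ((1 + x) * (1 - 8 * x))"
    and "Y \<equiv> x * (x * (x * (1 + x)))"
  shows "[r ^ (3 * (p - 1)) * (\<Sum>k<p. int (central_franel k) * P ^ k * q ^ (2 * (p - 1 - k)))
    = q ^ (p - 1) * (\<Sum>k<p. int (quartic_coeff k) * Y ^ k * r ^ (2 * (p - 1 - k)))\<^sup>2] (mod int p)"
proof -
  let ?X = "[:0, 1:] :: int poly"
  define q' r' P' Y' where "q' = 1 + 8 * (?X * ?X)" and "r' = 1 - 4 * ?X - 8 * (?X * ?X)"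
    and "P' = ?X * ((1 + ?X) * (1 - 8 * ?X))" and "Y' = ?X * (?X * (?X * (1 + ?X)))"
  define A where "A = r' ^ (3 * (p - 1)) * (\<Sum>k<p. [:int (central_franel k):] * P' ^ k * q' ^ (2 * (p - 1 - k)))"
  define B where "B = q' ^ (p - 1) * (\<Sum>k<p. [:int (quartic_coeff k):] * Y' ^ k * r' ^ (2 * (p - 1 - k)))\<^sup>2"
  have X: "fps_of_poly ?X = fps_X" by (rule fps_ext) (simp add: fps_X_def coeff_pCons split: nat.split)
  have AB: "fcong (fps_of_poly A) (fps_of_poly B)"
    using truncated_polynomial_fcong
    unfolding A_def B_def q'_def r'_def P'_def Y'_def fps_of_poly_mult fps_of_poly_power fps_of_poly_sum
      fps_of_poly_add fps_of_poly_diff fps_of_poly_numeral fps_of_poly_1 X fps_of_poly_const .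
  have eval: "poly q' x = q" "poly r' x = r" "poly P' x = P" "poly Y' x = Y"
    by (simp_all add: q'_def r'_def P'_def Y'_def q_def r_def P_def Y_def mult_ac)
  have const: "poly [:c:] x = c" for c by simp
  from fcong_poly_eval [OF AB, of x]
  have "[poly A x = poly B x] (mod int p)" .
  then show ?thesis
    unfolding A_def B_def poly_mult poly_power poly_sum eval const .
qed

section \<open>Quadratic characters of 2, 3 and -1\<close>

lemma gauss_freshman: "gcong ((a + b) ^ p) (a ^ p + b ^ p)"
  unfolding gcong_def of_int_of_nat_eq by (rule freshman)

text \<open>
  Compare \<open>(1 + i) ^ p = 1 + i ^ p\<close>, valid modulo \<open>p\<close>, with \<open>(1 + i) ^ p = (2 i) ^ half * (1 + i)\<close>.
\<close>

lemma chi_2: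
  "half = 2 * j \<Longrightarrow> chi 2 = (- 1) ^ j" "half = 2 * j + 1 \<Longrightarrow> chi 2 = (- 1) ^ (j + 1)"
proof -
  define i where "i = Gauss 0 1"
  have i2: "i ^ 2 = of_int (- 1)" and i1: "(1 + i) ^ 2 = of_int 2 * i"
    by (rule gauss.expand, simp add: i_def power2_eq_square)+
  have p: "a ^ p = a ^ (2 * half + 1)" for a :: gauss
    by (rule arg_cong [of p]) (use two_half odd_p in simp)
  have ieven: "i ^ (2 * k) = of_int ((- 1) ^ k)" for k
    unfolding power_mult i2 by simp
  have l: "(1 + i) ^ p = of_int (2 ^ half) * (i ^ half * (1 + i))"
    unfolding p power_add power_mult i1 by (simp add: power_mult_distrib mult_ac)
  have r: "1 ^ p + i ^ p = 1 + of_int ((- 1) ^ half) * i"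
    unfolding p power_add ieven by simp
  have main: "gcong (of_int (2 ^ half) * (i ^ half * (1 + i))) (1 + of_int ((- 1) ^ half) * i)"
    using gauss_freshman [of 1 i] unfolding l r .
  have euler: "[chi 2 = 2 ^ half] (mod int p)" unfolding half_def by (rule chi_euler)
  show "chi 2 = (- 1) ^ j" if h: "half = 2 * j"
  proof (rule eq_of_cong_small)
    have ih: "i ^ half = of_int ((- 1) ^ j)" unfolding h by (rule ieven)
    have "[2 ^ half * (- 1) ^ j = 1] (mod int p)"
      using gcong_gre [OF main] unfolding ih gauss_sel gauss_of_int by (simp add: i_def)
    from cong_mult [OF this cong_refl [of "(- 1) ^ j"]] have "[2 ^ half = (- 1) ^ j] (mod int p)"
      by (simp add: mult.assoc flip: power_mult_distrib)
    with euler show "[chi 2 = (- 1) ^ j] (mod int p)" by (rule cong_trans)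
    show "chi 2 \<in> {- 1, 0, 1}" by (rule chi_range)
    show "(- 1 :: int) ^ j \<in> {- 1, 0, 1}" by (cases "even j") auto
  qed
  show "chi 2 = (- 1) ^ (j + 1)" if h: "half = 2 * j + 1"
  proof (rule eq_of_cong_small)
    have ih: "i ^ half = of_int ((- 1) ^ j) * i" unfolding h power_add ieven by simp
    have o: "(- 1 :: int) ^ half = - 1" unfolding h by simp
    have "[2 ^ half * (- 1) ^ j = - 1] (mod int p)"
      using main unfolding gcong_iff ih o gauss_sel gauss_of_int by (simp add: i_def)
    from cong_mult [OF this cong_refl [of "(- 1) ^ j"]] have "[2 ^ half = (- 1) ^ (j + 1)] (mod int p)"
      by (simp add: mult.assoc flip: power_mult_distrib)
    with euler show "[chi 2 = (- 1) ^ (j + 1)] (mod int p)" by (rule cong_trans)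
    show "chi 2 \<in> {- 1, 0, 1}" by (rule chi_range)
    show "(- 1 :: int) ^ (j + 1) \<in> {- 1, 0, 1}" by (cases "even j") auto
  qed
qed

lemma chi_minus_1: "chi (- 1) = (- 1) ^ half"
proof (rule eq_of_cong_small)
  show "[chi (- 1) = (- 1) ^ half] (mod int p)" unfolding half_def by (rule chi_euler)
  show "(- 1 :: int) ^ half \<in> {- 1, 0, 1}" by (cases "even half") auto
qed (rule chi_range)

lemma chi_3:
  assumes "p \<noteq> 3"
  shows "p mod 3 = 1 \<Longrightarrow> chi 3 = (- 1) ^ half" "p mod 3 = 2 \<Longrightarrow> chi 3 = (- 1) ^ (half + 1)"
proof -
  interpret three: odd_prime 3 by unfold_locales simp_all
  have rec: "Legendre (int p) 3 * chi 3 = (- 1) ^ half"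
    using Quadratic_Reciprocity [OF prime odd_p three.prime three.odd_p assms] by (simp add: half_def)
  have leg: "[Legendre (int p) 3 = int p] (mod 3)"
    using three.chi_euler [of "int p"] by simp
  show "chi 3 = (- 1) ^ half" if "p mod 3 = 1"
  proof -
    have "int p mod 3 = 1" using arg_cong [OF that, of int] by (simp add: zmod_int)
    then have "[Legendre (int p) 3 = 1] (mod 3)"
      using leg by (simp add: cong_def)
    then have "Legendre (int p) 3 = 1"
      using three.eq_of_cong_small [of "Legendre (int p) 3" 1] three.chi_range [of "int p"] by simp
    then show ?thesis using rec by simp
  qed
  show "chi 3 = (- 1) ^ (half + 1)" if "p mod 3 = 2"
  proof -
    have "int p mod 3 = 2" using arg_cong [OF that, of int] by (simp add: zmod_int)
    then have "[Legendre (int p) 3 = - 1] (mod 3)"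
      using leg by (simp add: cong_def)
    then have "Legendre (int p) 3 = - 1"
      using three.eq_of_cong_small [of "Legendre (int p) 3" "- 1"] three.chi_range [of "int p"] by simp
    then show ?thesis using rec by simp
  qed
qed

lemma chi_mod_24:
  "p mod 24 \<in> {1, 5, 19, 23} \<Longrightarrow> chi 6 = 1"
  "p mod 24 \<in> {1, 19} \<Longrightarrow> chi (- 2) = 1"
  "p mod 24 \<in> {5, 23} \<Longrightarrow> chi (- 2) = - 1"
proof -
  define t where "t = p div 24"
  have p: "p = 24 * t + p mod 24" by (simp add: t_def)
  have c6: "chi 6 = chi 2 * chi 3" and cm2: "chi (- 2) = chi (- 1) * chi 2"
    using chi_mult [of 2 3] chi_mult [of "- 1" 2] by simp_all
  define n where "n = half"
  have h: "2 * n = p - 1" unfolding n_def by (rule two_half)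
  have v: "chi 6 = 1 \<and> chi (- 2) = (if p mod 24 \<in> {1, 19} then 1 else - 1)" if "p mod 24 \<in> {1, 5, 19, 23}"
  proof -
    have n3: "p \<noteq> 3" using that by auto
    from that consider "p mod 24 = 1" | "p mod 24 = 5" | "p mod 24 = 19" | "p mod 24 = 23" by blast
    then show ?thesis
    proof cases
      case 1
      have "p = 24 * t + 1" using p unfolding 1 by simp
      then have hh: "half = 2 * (6 * t)" unfolding n_def [symmetric] using h by simp
      have m: "p mod 3 = 1" using mod_mod_cancel [of 3 24 p] 1 by simp
      show ?thesis using chi_2(1) [OF hh] chi_3(1) [OF n3 m] chi_minus_1 unfolding c6 cm2 hh 1 by simp
    next
      case 2
      have "p = 24 * t + 5" using p unfolding 2 by simp
      then have hh: "half = 2 * (6 * t + 1)" unfolding n_def [symmetric] using h by simp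
      have m: "p mod 3 = 2" using mod_mod_cancel [of 3 24 p] 2 by simp
      show ?thesis using chi_2(1) [OF hh] chi_3(2) [OF n3 m] chi_minus_1 unfolding c6 cm2 hh 2 by simp
    next
      case 3
      have "p = 24 * t + 19" using p unfolding 3 by simp
      then have hh: "half = 2 * (6 * t + 4) + 1" unfolding n_def [symmetric] using h by simp
      have m: "p mod 3 = 1" using mod_mod_cancel [of 3 24 p] 3 by simp
      show ?thesis using chi_2(2) [OF hh] chi_3(1) [OF n3 m] chi_minus_1 unfolding c6 cm2 hh 3 by simp
    next
      case 4
      have "p = 24 * t + 23" using p unfolding 4 by simp
      then have hh: "half = 2 * (6 * t + 5) + 1" unfolding n_def [symmetric] using h by simp
      have m: "p mod 3 = 2" using mod_mod_cancel [of 3 24 p] 4 by simp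
      show ?thesis using chi_2(2) [OF hh] chi_3(2) [OF n3 m] chi_minus_1 unfolding c6 cm2 hh 4 by simp
    qed
  qed
  show "p mod 24 \<in> {1, 5, 19, 23} \<Longrightarrow> chi 6 = 1" using v by blast
  show "p mod 24 \<in> {1, 19} \<Longrightarrow> chi (- 2) = 1" using v by fastforce
  show "p mod 24 \<in> {5, 23} \<Longrightarrow> chi (- 2) = - 1" using v by fastforce
qed

section \<open>Specialisation and conclusion\<close>

text \<open>
  If \<open>N / q\<^sup>2 = 1 / c\<close> modulo \<open>p\<close>, the homogenised sum can be rewritten in terms of \<open>c\<close>, because
  \<open>(p - 1)\<close>-st powers are 1.
\<close>

lemma power_base_change:
  assumes "[c * N = q\<^sup>2] (mod int p)" and c: "\<not> int p dvd c" and q: "\<not> int p dvd q"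
  shows "[(\<Sum>k<p. a k * N ^ k * q ^ (2 * (p - 1 - k))) = (\<Sum>k<p. a k * c ^ (p - 1 - k))] (mod int p)"
proof (rule cong_cancel_p)
  show "\<not> int p dvd c ^ (p - 1)" using c by (simp add: p_dvd_power_iff)
  show "[c ^ (p - 1) * (\<Sum>k<p. a k * N ^ k * q ^ (2 * (p - 1 - k))) = c ^ (p - 1) * (\<Sum>k<p. a k * c ^ (p - 1 - k))] (mod int p)"
    unfolding sum_distrib_left
  proof (rule cong_sum)
    fix k assume "k \<in> {..<p}"
    then have e: "p - 1 = k + (p - 1 - k)" by auto
    have "c ^ (p - 1) * (a k * N ^ k * q ^ (2 * (p - 1 - k)))
        = a k * c ^ (p - 1 - k) * ((c * N) ^ k * (q\<^sup>2) ^ (p - 1 - k))"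
      by (subst e) (simp only: power_add power_mult_distrib power_mult mult_ac)
    also have "[\<dots> = a k * c ^ (p - 1 - k) * ((q\<^sup>2) ^ k * (q\<^sup>2) ^ (p - 1 - k))] (mod int p)"
      by (intro cong_mult cong_refl cong_pow assms(1))
    also have "(q\<^sup>2) ^ k * (q\<^sup>2) ^ (p - 1 - k) = (q ^ (p - 1))\<^sup>2"
      unfolding power_add [symmetric] e [symmetric] by (simp only: power_mult [symmetric] mult.commute)
    also have "[a k * c ^ (p - 1 - k) * (q ^ (p - 1))\<^sup>2 = a k * c ^ (p - 1 - k) * 1\<^sup>2] (mod int p)"
      by (intro cong_mult cong_refl cong_pow fermat q)
    also have "a k * c ^ (p - 1 - k) * 1\<^sup>2 = 1 * (a k * c ^ (p - 1 - k))" by simp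
    also have "[\<dots> = c ^ (p - 1) * (a k * c ^ (p - 1 - k))] (mod int p)"
      by (intro cong_mult cong_refl cong_sym [OF fermat] c)
    finally show "[c ^ (p - 1) * (a k * N ^ k * q ^ (2 * (p - 1 - k))) = c ^ (p - 1) * (a k * c ^ (p - 1 - k))] (mod int p)" .
  qed
qed

lemma not_p_dvd_3: "p > 3 \<Longrightarrow> \<not> int p dvd 3"
  using zdvd_imp_le [of "int p" 3] by auto

text \<open>
  The parameter \<open>x = (-2 + \<surd>6) / 4\<close> is a root of \<open>8 x\<^sup>2 + 8 x - 1\<close>. Modulo this polynomial
  \<open>96 N = q\<^sup>2\<close> and \<open>128 Y = r\<^sup>2\<close>, that is, \<open>z = 1/96\<close> and \<open>y = 1/128\<close>.
\<close>

lemma special_value: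
  assumes p: "p > 3" and six: "chi 6 = 1"
  shows "[(\<Sum>k<p. int (central_franel k) * 96 ^ (p - 1 - k))
    = (\<Sum>k<p. int (quartic_coeff k) * 128 ^ (p - 1 - k))\<^sup>2] (mod int p)"
proof -
  obtain s where s: "[s\<^sup>2 = 6] (mod int p)"
    using six unfolding Legendre_def QuadRes_def by (auto split: if_splits)
  have "coprime 4 (int p)"
    using prime_imp_coprime [OF prime_int_p not_p_dvd_4] coprime_commute by blast
  then obtain v where v: "[4 * v = 1] (mod int p)" using cong_solve_coprime_int by blast
  define x where "x = v * (s - 2)"
  have "[4 * v * (s - 2) + 2 = 1 * (s - 2) + 2] (mod int p)" by (intro cong_add cong_mult cong_refl v)
  then have "[4 * x + 2 = s] (mod int p)" by (simp add: x_def mult.assoc)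
  then have "[(4 * x + 2)\<^sup>2 = 6] (mod int p)" using cong_pow s cong_trans by blast
  moreover have "(4 * x + 2)\<^sup>2 - 6 = 2 * (8 * (x * x) + 8 * x - 1)"
    by (simp add: power2_eq_square algebra_simps)
  ultimately have "int p dvd 2 * (8 * (x * x) + 8 * x - 1)"
    by (simp only: cong_iff_dvd_diff)
  then have e: "int p dvd 8 * (x * x) + 8 * x - 1"
    using not_p_dvd_2 p_dvd_mult_iff [of 2 "8 * (x * x) + 8 * x - 1"] by blast
  define q r N Y where "q = 1 + 8 * (x * x)" and "r = 1 - 4 * x - 8 * (x * x)"
    and "N = x * ((1 + x) * (1 - 8 * x))" and "Y = x * (x * (x * (1 + x)))"
  have qN: "[96 * N = q\<^sup>2] (mod int p)"
  proof -
    have "q\<^sup>2 - 96 * N = (8 * (x * x) + 8 * x - 1) * (8 * (x * x) + 88 * x - 1)"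
      by (simp add: q_def N_def power2_eq_square algebra_simps)
    then have "int p dvd q\<^sup>2 - 96 * N" using e by simp
    then show ?thesis by (simp add: cong_iff_dvd_diff dvd_diff_commute)
  qed
  have rY: "[128 * Y = r\<^sup>2] (mod int p)"
  proof -
    have "128 * Y - r\<^sup>2 = (8 * (x * x) + 8 * x - 1) * (1 + 8 * (x * x))"
      by (simp add: r_def Y_def power2_eq_square algebra_simps)
    then have "int p dvd 128 * Y - r\<^sup>2" using e by simp
    then show ?thesis by (simp add: cong_iff_dvd_diff)
  qed
  \<comment> \<open>12 is a combination of the polynomials \<open>q\<close> and \<open>8 x\<^sup>2 + 8 x - 1\<close>\<close>
  have q: "\<not> int p dvd q"
  proof
    assume dq: "int p dvd q"
    have "int p dvd 8 * q + (8 * x + 2) * (q - (8 * (x * x) + 8 * x - 1))"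
      by (rule dvd_add [OF dvd_mult [OF dq] dvd_mult [OF dvd_diff [OF dq e]]])
    moreover have "8 * q + (8 * x + 2) * (q - (8 * (x * x) + 8 * x - 1)) = 4 * 3"
      by (simp add: q_def algebra_simps)
    ultimately show False using not_p_dvd_4 not_p_dvd_3 [OF p] by (auto simp only: p_dvd_mult_iff)
  qed
  have r: "\<not> int p dvd r"
  proof
    assume dr: "int p dvd r"
    have "int p dvd r + (8 * (x * x) + 8 * x - 1)" by (rule dvd_add [OF dr e])
    moreover have "r + (8 * (x * x) + 8 * x - 1) = 4 * x" by (simp add: r_def)
    ultimately have "int p dvd x" using not_p_dvd_4 by (simp add: p_dvd_mult_iff)
    then have "int p dvd 8 * (x * x) + 8 * x" by simp
    from dvd_diff [OF this e] have "int p dvd 1" by simp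
    then show False using prime_int_p by (simp add: not_prime_unit)
  qed
  have c: "\<not> int p dvd 96" "\<not> int p dvd 128"
  proof -
    have "\<not> int p dvd 2 ^ 5 * 3" "\<not> int p dvd 2 ^ 7"
      using not_p_dvd_2 not_p_dvd_3 [OF p] unfolding p_dvd_mult_iff p_dvd_power_iff by blast+
    then show "\<not> int p dvd 96" "\<not> int p dvd 128" by simp_all
  qed
  let ?A = "\<Sum>k<p. int (central_franel k) * N ^ k * q ^ (2 * (p - 1 - k))"
  let ?B = "\<Sum>k<p. int (quartic_coeff k) * Y ^ k * r ^ (2 * (p - 1 - k))"
  have "[(r ^ (p - 1)) ^ 3 * ?A = q ^ (p - 1) * ?B\<^sup>2] (mod int p)"
    using truncated_polynomial_cong [of x]
    unfolding q_def [symmetric] r_def [symmetric] N_def [symmetric] Y_def [symmetric]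
    by (simp only: power_mult [symmetric] mult.commute [of 3])
  moreover have "[(r ^ (p - 1)) ^ 3 * ?A = 1 ^ 3 * ?A] (mod int p)"
    by (intro cong_mult cong_pow cong_refl fermat r)
  moreover have "[q ^ (p - 1) * ?B\<^sup>2 = 1 * ?B\<^sup>2] (mod int p)"
    by (intro cong_mult cong_refl fermat q)
  ultimately have "[?A = ?B\<^sup>2] (mod int p)"
    unfolding power_one mult_1_left by (meson cong_sym cong_trans)
  moreover note power_base_change [OF qN c(1) q, of "\<lambda>k. int (central_franel k)"]
  moreover note cong_pow [OF power_base_change [OF rY c(2) r, of "\<lambda>k. int (quartic_coeff k)"], of 2]
  ultimately show ?thesis by (meson cong_sym cong_trans)
qed

lemma franel_sum_cong_curve_sum:
  assumes "p > 3" and "chi 6 = 1"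
  shows "[(\<Sum>k<p. int (central_franel k) * 96 ^ (p - 1 - k)) = curve_sum\<^sup>2] (mod int p)"
proof -
  have "[curve_sum\<^sup>2 = (- (\<Sum>k<p. int (quartic_coeff k) * 128 ^ (p - 1 - k)))\<^sup>2] (mod int p)"
    by (rule cong_pow [OF curve_sum_cong_truncated_series])
  then show ?thesis
    using cong_trans [OF special_value [OF assms]] unfolding power2_minus by (meson cong_sym)
qed

text \<open>
  Multiplying the two representations gives \<open>p\<^sup>2 = (x a + 2 y b)\<^sup>2 + 2 (x b - y a)\<^sup>2\<close>. After a
  change of the sign of \<open>y\<close>, the prime \<open>p\<close> divides \<open>x b - y a\<close>, which must then be 0.
\<close>

lemma two_squares_unique:
  fixes x y a b :: int
  assumes xy: "int p = x\<^sup>2 + 2 * y\<^sup>2" and ab: "int p = a\<^sup>2 + 2 * b\<^sup>2"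
  shows "x\<^sup>2 = a\<^sup>2"
proof -
  have pos: "int p > 0" using odd_p by simp
  have aux: "x\<^sup>2 = a\<^sup>2" if d: "int p dvd x * b - a * y" and xy: "int p = x\<^sup>2 + 2 * y\<^sup>2" for y
  proof -
    from d obtain t where t: "x * b - a * y = int p * t" by (rule dvdE)
    have "(int p)\<^sup>2 = (x\<^sup>2 + 2 * y\<^sup>2) * (a\<^sup>2 + 2 * b\<^sup>2)" using xy ab by (simp add: power2_eq_square)
    also have "\<dots> = (x * a + 2 * y * b)\<^sup>2 + 2 * (x * b - a * y)\<^sup>2"
      by (simp add: power2_eq_square algebra_simps)
    finally have "(int p)\<^sup>2 = (x * a + 2 * y * b)\<^sup>2 + (int p)\<^sup>2 * (2 * t\<^sup>2)"
      by (simp add: t power_mult_distrib)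
    then have "(int p)\<^sup>2 * (2 * t\<^sup>2) \<le> (int p)\<^sup>2 * 1"
      using zero_le_power2 [of "x * a + 2 * y * b"] by linarith
    then have "2 * t\<^sup>2 \<le> 1" using pos by (simp only: mult_le_cancel_left_pos zero_less_power)
    then have "t\<^sup>2 = 0" using zero_le_power2 [of t] by linarith
    then have "x * b = a * y" using t by simp
    then have "x\<^sup>2 * b\<^sup>2 = a\<^sup>2 * y\<^sup>2" by (simp flip: power_mult_distrib)
    moreover have "x\<^sup>2 * b\<^sup>2 - a\<^sup>2 * y\<^sup>2 = int p * (b\<^sup>2 - y\<^sup>2)"
    proof -
      have e: "x\<^sup>2 = int p - 2 * y\<^sup>2" "a\<^sup>2 = int p - 2 * b\<^sup>2" using xy ab by simp_all
      show ?thesis unfolding e by (simp add: algebra_simps)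
    qed
    ultimately have "b\<^sup>2 = y\<^sup>2" using pos by simp
    then show ?thesis using xy ab by simp
  qed
  have "x\<^sup>2 * b\<^sup>2 - a\<^sup>2 * y\<^sup>2 = int p * (b\<^sup>2 - y\<^sup>2)"
  proof -
    have e: "x\<^sup>2 = int p - 2 * y\<^sup>2" "a\<^sup>2 = int p - 2 * b\<^sup>2" using xy ab by simp_all
    show ?thesis unfolding e by (simp add: algebra_simps)
  qed
  moreover have "x\<^sup>2 * b\<^sup>2 - a\<^sup>2 * y\<^sup>2 = (x * b - a * y) * (x * b - a * (- y))"
    by (simp add: power2_eq_square algebra_simps)
  ultimately have "int p dvd (x * b - a * y) * (x * b - a * (- y))" by simp
  then have "int p dvd x * b - a * y \<or> int p dvd x * b - a * (- y)" by (simp only: p_dvd_mult_iff)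
  then show ?thesis using aux [of y] aux [of "- y"] xy by auto
qed

lemma p_integral_divide:
  assumes "\<not> int p dvd b"
  shows "of_int a / of_int b \<in> p_integral p"
proof -
  obtain n d where nd: "quotient_of (of_int a / of_int b) = (n, d)" by (cases "quotient_of (of_int a / of_int b)")
  have "of_int a / of_int b = (of_int n / of_int d :: rat)" using nd by (rule quotient_of_div)
  moreover have "b \<noteq> 0" "d \<noteq> 0" using assms quotient_of_denom_pos [OF nd] by auto
  ultimately have "(of_int (a * d) :: rat) = of_int (n * b)" by (simp add: field_simps)
  then have "a * d = n * b" by (simp only: of_int_eq_iff)
  then have "d dvd n * b" by (metis dvd_triv_right)
  then have "d dvd b" using quotient_of_coprime [OF nd] by (simp add: coprime_dvd_mult_right_iff coprime_commute)
  then have "\<not> int p dvd d" using assms dvd_trans by blast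
  then show ?thesis by (simp add: p_integral_def nd)
qed

text \<open>
  Over the common denominator \<open>96 ^ (p - 1)\<close>, which is 1 modulo \<open>p\<close>, the numerator of the sum is
  the integer in the hypothesis.
\<close>

lemma rat_cong_franel_sum:
  assumes "p > 3" and cong: "[(\<Sum>k<p. int (central_franel k) * 96 ^ (p - 1 - k)) = c] (mod int p)"
  shows "rat_cong (\<Sum>k=0..p-1. of_nat ((2 * k) choose k) * (of_nat (franel k) / 96 ^ k)) (of_int c) p"
proof -
  define A where "A = (\<Sum>k<p. int (central_franel k) * 96 ^ (p - 1 - k))"
  have "\<not> int p dvd 2 ^ 5 * 3"
    using not_p_dvd_2 not_p_dvd_3 [OF assms(1)] unfolding p_dvd_mult_iff p_dvd_power_iff by blast
  then have p96: "\<not> int p dvd 96" by simp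
  define D where "D = (96 :: int) ^ (p - 1)"
  have D: "\<not> int p dvd D" using p96 by (simp add: D_def p_dvd_power_iff)
  have "{0..p - 1} = {..<p}" using odd_p by auto
  then have "(\<Sum>k=0..p-1. of_nat ((2 * k) choose k) * (of_nat (franel k) / 96 ^ k)) = (of_int A / of_int D :: rat)"
    unfolding A_def D_def of_int_sum sum_divide_distrib
  proof (intro sum.cong)
    fix k assume "k \<in> {..<p}"
    then have "p - 1 = k + (p - 1 - k)" by auto
    then have "(96 :: rat) ^ (p - 1) = 96 ^ k * 96 ^ (p - 1 - k)" by (metis power_add)
    then show "of_nat ((2 * k) choose k) * (of_nat (franel k) / 96 ^ k)
        = (of_int (int (central_franel k) * 96 ^ (p - 1 - k)) / of_int (96 ^ (p - 1)) :: rat)"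
      by simp
  qed
  moreover have "rat_cong (of_int A / of_int D) (of_int c) p"
  proof -
    have "[c * D = c * 1] (mod int p)" unfolding D_def by (intro cong_mult cong_refl fermat p96)
    from cong_trans [OF cong [folded A_def] cong_sym [OF this [unfolded mult_1_right]]]
    obtain t where t: "A - c * D = int p * t" by (auto simp: cong_iff_dvd_diff elim: dvdE)
    have "D \<noteq> 0" using D by auto
    then have "of_int A / of_int D - of_int c = (of_int (A - c * D) / of_int D :: rat)"
      by (simp add: field_simps)
    then have "of_int A / of_int D - of_int c = of_nat p * (of_int t / of_int D :: rat)"
      unfolding t by simp
    moreover have "of_int c \<in> p_integral p"
      using p_integral_divide [of 1 c] odd_p by simp
    ultimately show ?thesis
      unfolding rat_cong_def using p_integral_divide [OF D] by blast
  qed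
  ultimately show ?thesis by simp
qed

end

theorem theorem2p9:
  fixes p :: nat
  assumes "prime p" and "p > 5" and "p mod 24 \<in> {1, 5, 19, 23}"
  shows "(p mod 24 \<in> {1, 19} \<longrightarrow>
           (\<exists>x y :: int. int p = x\<^sup>2 + 2 * y\<^sup>2) \<and>
           (\<forall>x y :: int. int p = x\<^sup>2 + 2 * y\<^sup>2 \<longrightarrow>
              rat_cong (\<Sum>k=0..p-1. of_nat ((2 * k) choose k) * (of_nat (franel k) / 96 ^ k))
                       (of_int (4 * x\<^sup>2)) p)) \<and>
         (p mod 24 \<in> {5, 23} \<longrightarrow>
           rat_cong (\<Sum>k=0..p-1. of_nat ((2 * k) choose k) * (of_nat (franel k) / 96 ^ k)) 0 p)"
proof -
  interpret odd_prime p using assms(1,2) by unfold_locales simp_all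
  have p3: "p > 3" using assms(2) by simp
  note cong = franel_sum_cong_curve_sum [OF p3 chi_mod_24(1) [OF assms(3)]]
  show ?thesis
  proof (intro conjI impI)
    assume "p mod 24 \<in> {1, 19}"
    from curve_sum_two_squares [OF chi_mod_24(2) [OF this]]
    obtain a b where ab: "int p = a\<^sup>2 + 2 * b\<^sup>2" and tr: "curve_sum = 2 * a" by blast
    show "\<exists>x y :: int. int p = x\<^sup>2 + 2 * y\<^sup>2" using ab by blast
    show "\<forall>x y :: int. int p = x\<^sup>2 + 2 * y\<^sup>2 \<longrightarrow>
        rat_cong (\<Sum>k=0..p-1. of_nat ((2 * k) choose k) * (of_nat (franel k) / 96 ^ k)) (of_int (4 * x\<^sup>2)) p"
    proof (intro allI impI)
      fix x y :: int assume "int p = x\<^sup>2 + 2 * y\<^sup>2"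
      then have "x\<^sup>2 = a\<^sup>2" using ab by (rule two_squares_unique)
      then have "curve_sum\<^sup>2 = 4 * x\<^sup>2" by (simp add: tr power_mult_distrib)
      with cong show "rat_cong (\<Sum>k=0..p-1. of_nat ((2 * k) choose k) * (of_nat (franel k) / 96 ^ k)) (of_int (4 * x\<^sup>2)) p"
        by (intro rat_cong_franel_sum p3) (simp only:)
    qed
  next
    assume "p mod 24 \<in> {5, 23}"
    from curve_sum_eq_0 [OF chi_mod_24(3) [OF this]] have "curve_sum\<^sup>2 = 0" by simp
    with cong rat_cong_franel_sum [OF p3, of 0]
    show "rat_cong (\<Sum>k=0..p-1. of_nat ((2 * k) choose k) * (of_nat (franel k) / 96 ^ k)) 0 p"
      by simp
  qed
qed

end
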